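(* Let $\Omega\subset\mathbb{R}^n$ be open and bounded and $\Omega'\Subset\Omega$. Let $s\in(0,1)$, $p\in(1,+\infty)$ and $f\in L^p(\Omega)$. Let $u\in L^p(\mathbb{R}^n)$ be a distributional solution of $(-\Delta)^su=f$ in $\Omega$. Then (the restriction of) $u$ belongs to $\mathcal{L}^p_{2s}(\Omega')$ and $\|u\|_{\mathcal{L}^p_{2s}(\Omega')}\le C\big(\|f\|_{L^p(\Omega)}+\|u\|_{L^p(\mathbb{R}^n)}\big)$ for a constant $C>0$ depending only on $n$, $s$, $p$, $\Omega$ and $\Omega'$.
   Context: $(-\Delta)^s\varphi:=\mathcal{F}^{-1}((2\pi|\xi|)^{2s}\widehat\varphi)$, $\widehat\varphi(\xi)=\int\varphi(x)e^{-2\pi ix\cdot\xi}dx$. Distributional solution in $\Omega$: $\int_{\mathbb{R}^n}u\,(-\Delta)^s\varphi\,dx=\int_\Omega f\varphi\,dx$ for all $\varphi\in C^\infty_c(\Omega)$. Bessel potential space: $\mathcal{L}^p_{2s}(\mathbb{R}^n):=\{v\in L^p: v=\mathcal{B}^{(s)}*g,\ g\in L^p\}$ with norm $\|g\|_{L^p}$, where $\mathcal{B}^{(s)}$ is the integrable function with Fourier transform $(1+4\pi^2|\xi|^2)^{-s}$. $\mathcal{L}^p_{2s}(\Omega')$ consists of restrictions to $\Omega'$ of elements of $\mathcal{L}^p_{2s}(\mathbb{R}^n)$, normed by $\|v\|_{\mathcal{L}^p_{2s}(\Omega')}:=\inf\{\|\tilde v\|_{\mathcal{L}^p_{2s}(\mathbb{R}^n)}:\tilde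 v=v\text{ in }\Omega'\}$. *)

theory Defs
  imports "HOL-Analysis.Analysis"
begin

fun dderiv :: "'a::euclidean_space list \<Rightarrow> ('a \<Rightarrow> real) \<Rightarrow> ('a \<Rightarrow> real)" where
  "dderiv [] f = f"
| "dderiv (v # vs) f = (\<lambda>x. frechet_derivative (dderiv vs f) (at x) v)"

definition smooth_fun :: "('a::euclidean_space \<Rightarrow> real) \<Rightarrow> bool" where
  "smooth_fun f \<longleftrightarrow> (\<forall>vs. set vs \<subseteq> Basis \<longrightarrow> (\<forall>x. dderiv vs f differentiable (at x)))"

definition tsupport :: "('a::topological_space \<Rightarrow> real) \<Rightarrow> 'a set" where
  "tsupport f = closure {x. f x \<noteq> 0}"

definition test_fun :: "'a::euclidean_space set \<Rightarrow> ('a \<Rightarrow> real) \<Rightarrow> bool" where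
  "test_fun \<Omega> \<phi> \<longleftrightarrow> smooth_fun \<phi> \<and> compact (tsupport \<phi>) \<and> tsupport \<phi> \<subseteq> \<Omega>"

definition fourier :: "('a::euclidean_space \<Rightarrow> real) \<Rightarrow> 'a \<Rightarrow> complex" where
  "fourier \<phi> \<xi> = (\<integral>x. complex_of_real (\<phi> x) * exp (- (2 * pi * \<i> * complex_of_real (x \<bullet> \<xi>))) \<partial>lebesgue)"

text \<open>Fractional Laplacian (-Delta)^s phi = F^{-1}((2 pi |xi|)^{2s} hat phi); real-valued for real phi.\<close>
definition frac_lap :: "real \<Rightarrow> ('a::euclidean_space \<Rightarrow> real) \<Rightarrow> 'a \<Rightarrow> real" where
  "frac_lap s \<phi> x = Re (\<integral>\<xi>. complex_of_real ((2 * pi * norm \<xi>) powr (2 * s)) * fourier \<phi> \<xi>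
        * exp (2 * pi * \<i> * complex_of_real (x \<bullet> \<xi>)) \<partial>lebesgue)"

definition Lp_mem :: "real \<Rightarrow> 'a measure \<Rightarrow> ('a \<Rightarrow> real) \<Rightarrow> bool" where
  "Lp_mem p M f \<longleftrightarrow> f \<in> borel_measurable M \<and> integrable M (\<lambda>x. \<bar>f x\<bar> powr p)"

definition Lp_norm :: "real \<Rightarrow> 'a measure \<Rightarrow> ('a \<Rightarrow> real) \<Rightarrow> real" where
  "Lp_norm p M f = (\<integral>x. \<bar>f x\<bar> powr p \<partial>M) powr (1 / p)"

definition dist_solution :: "real \<Rightarrow> 'a::euclidean_space set \<Rightarrow> ('a \<Rightarrow> real) \<Rightarrow> ('a \<Rightarrow> real) \<Rightarrow> bool" where
  "dist_solution s \<Omega> u f \<longleftrightarrow> (\<forall>\<phi>. test_fun \<Omega> \<phi> \<longrightarrow>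
      (\<integral>x. u x * frac_lap s \<phi> x \<partial>lebesgue) = (LINT x:\<Omega>|lebesgue. f x * \<phi> x))"

definition bessel_kernel :: "real \<Rightarrow> ('a::euclidean_space \<Rightarrow> real) \<Rightarrow> bool" where
  "bessel_kernel s G \<longleftrightarrow> integrable lebesgue G \<and>
     (\<forall>\<xi>. fourier G \<xi> = complex_of_real ((1 + 4 * pi\<^sup>2 * (norm \<xi>)\<^sup>2) powr (- s)))"

definition conv :: "('a::euclidean_space \<Rightarrow> real) \<Rightarrow> ('a \<Rightarrow> real) \<Rightarrow> 'a \<Rightarrow> real" where
  "conv G g x = (\<integral>y. G (x - y) * g y \<partial>lebesgue)"

text \<open>Representations of v in L^p_{2s}(R^n) restricted to Omega': pairs (G, g) with
  v~ = B^(s) * g in L^p(R^n), g in L^p, and v~ = u a.e. in Omega'.  Value: ||g||_{L^p}.\<close>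
definition bessel_reps :: "real \<Rightarrow> real \<Rightarrow> 'a::euclidean_space set \<Rightarrow> ('a \<Rightarrow> real) \<Rightarrow> real set" where
  "bessel_reps s p \<Omega>' u = {Lp_norm p lebesgue g | g G v.
      bessel_kernel s G \<and> Lp_mem p lebesgue g \<and> Lp_mem p lebesgue v \<and>
      (AE x in lebesgue. v x = conv G g x) \<and>
      (AE x in lebesgue. x \<in> \<Omega>' \<longrightarrow> v x = u x)}"

definition in_bessel_space :: "real \<Rightarrow> real \<Rightarrow> 'a::euclidean_space set \<Rightarrow> ('a \<Rightarrow> real) \<Rightarrow> bool" where
  "in_bessel_space s p \<Omega>' u \<longleftrightarrow> bessel_reps s p \<Omega>' u \<noteq> {}"

definition bessel_norm :: "real \<Rightarrow> real \<Rightarrow> 'a::euclidean_space set \<Rightarrow> ('a \<Rightarrow> real) \<Rightarrow> real" where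
  "bessel_norm s p \<Omega>' u = Inf (bessel_reps s p \<Omega>' u)"

end

theory Submission
  imports Defs "HOL-Probability.Probability"
begin

text \<open>
  The idea is to construct a compactly supported parametrix that factors through the Bessel kernel. Let
  \<open>L = 1 + 4 \<pi>\<^sup>2 |\<xi>|\<^sup>2\<close>, let \<open>G\<close> be the Bessel kernel with transform \<open>L powr (- s)\<close>, and put \<open>\<psi> = \<chi> G\<close>
  for a cutoff \<open>\<chi>\<close> supported in a small ball. Since \<open>G\<close> is a superposition of heat kernels and \<open>1 - \<chi>\<close>
  vanishes near the origin, \<open>G - \<psi>\<close> has transform \<open>L powr (- 2)\<close> times that of an integrable function, so
  \<open>\<psi> = G - G * h\<close> with \<open>h\<close> integrable. Moreover \<open>L powr s - (2 \<pi> |\<xi>|) powr (2 s)\<close> is the transform of an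
  integrable function, again a superposition of heat kernels, and therefore
  \<open>(2 \<pi> |\<xi>|) powr (2 s)\<close> times the transform of \<open>\<psi>\<close> is that of \<open>\<delta> - G * k\<close> with \<open>k\<close> integrable.
  Testing the equation with reflected translates of \<open>\<psi>\<close>, regularised by mollifiers, gives
  \<open>u = G * k * u + \<psi> * f\<close> near \<open>\<Omega>'\<close>, that is, \<open>u = G * g\<close> with \<open>g = k * u + f - h * f\<close>, and Young's
  inequality bounds \<open>g\<close>. Only convolutions with integrable kernels occur, so no singular integrals are needed.
\<close>

section \<open>Convolution and the Fourier transform\<close>

text \<open>The obstacle is nonlocality: the operator spreads every test function over the whole
  space, so multiplying \<open>u\<close> by a cutoff leaves commutators to estimate. Cutting off the
  kernel instead leaves \<open>u\<close> untouched, and the equation is used only through test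
  functions supported near a point. The symbol \<open>(2 \<pi> |\<xi>|) powr (2 s)\<close> is
  unbounded and not smooth at frequency zero. Subtracting it from \<open>L powr s\<close> removes
  the growth and leaves the Laplace transform of a positive integrable weight, evaluated at
  \<open>4 \<pi>^2 |\<xi>|^2\<close>. The power \<open>L powr (- 2)\<close> is dictated by what the
  argument consumes. One factor \<open>L powr s\<close> comes from the symbol, another from
  splitting off \<open>G\<close>, and \<open>L powr (2 s - 2)\<close> still decays for every
  \<open>s < 1\<close>. A single power of \<open>1 / L\<close> would leave
  \<open>L powr (2 s - 1)\<close>, which grows for \<open>s > 1/2\<close>. Heat kernels are used
  throughout because their transforms are explicit and they are positive: Tonelli's theorem and
  Gamma integrals replace the asymptotics of Bessel functions.\<close>

lemma distr_lborel_translate: "distr lborel borel (\<lambda>x. x + c) = (lborel :: 'a::euclidean_space measure)"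
  using lborel_affine[of 1 c] by (simp add: density_1 add.commute)

lemma distr_lborel_reflect: "distr lborel borel (\<lambda>x. c - x) = (lborel :: 'a::euclidean_space measure)"
  using lborel_affine[of "-1" c] by (simp add: density_1)

lemma
  fixes f :: "'a::euclidean_space \<Rightarrow> 'b::{banach, second_countable_topology}"
  assumes [measurable]: "f \<in> borel_measurable borel"
  shows integral_lborel_translate: "(LBINT x. f (x + c)) = (LBINT x. f x)"
    and integral_lborel_reflect: "(LBINT x. f (c - x)) = (LBINT x. f x)"
    and integrable_lborel_translate: "integrable lborel (\<lambda>x. f (x + c)) \<longleftrightarrow> integrable lborel f"
    and integrable_lborel_reflect: "integrable lborel (\<lambda>x. f (c - x)) \<longleftrightarrow> integrable lborel f"
proof -
  show "(LBINT x. f (x + c)) = (LBINT x. f x)"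
    by (subst (2) distr_lborel_translate[symmetric, of c]) (simp add: integral_distr)
  show "(LBINT x. f (c - x)) = (LBINT x. f x)"
    by (subst (2) distr_lborel_reflect[symmetric, of c]) (simp add: integral_distr)
  show "integrable lborel (\<lambda>x. f (x + c)) \<longleftrightarrow> integrable lborel f"
    by (subst (2) distr_lborel_translate[symmetric, of c]) (simp add: integrable_distr_eq)
  show "integrable lborel (\<lambda>x. f (c - x)) \<longleftrightarrow> integrable lborel f"
    by (subst (2) distr_lborel_reflect[symmetric, of c]) (simp add: integrable_distr_eq)
qed

lemma nn_integral_lborel_translate:
  fixes f :: "'a::euclidean_space \<Rightarrow> ennreal"
  assumes [measurable]: "f \<in> borel_measurable borel"
  shows "(\<integral>\<^sup>+x. f (x + c) \<partial>lborel) = (\<integral>\<^sup>+x. f x \<partial>lborel)"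
  by (subst (2) distr_lborel_translate[symmetric, of c]) (simp add: nn_integral_distr)

lemma AE_lborel_reflect:
  fixes P :: "'a::euclidean_space \<Rightarrow> bool"
  assumes "AE x in lborel. P x"
  shows "AE x in lborel. P (c - x)"
proof -
  have "AE x in distr lborel borel (\<lambda>x. c - x). P x"
    using assms by (metis distr_lborel_reflect)
  then show ?thesis
    by (rule AE_distrD[rotated]) simp
qed

text \<open>Lebesgue measure is the image of a product of one-dimensional measures
  (\<open>lborel_eq\<close>), so product integrands factor. This reduces Gaussian integrals to one
  dimension.\<close>

lemma
  fixes f :: "'a::euclidean_space \<Rightarrow> real \<Rightarrow> 'b::{real_normed_field,banach,second_countable_topology}"
  assumes f: "\<And>b. b \<in> Basis \<Longrightarrow> integrable lborel (f b)"
  shows integrable_prod_Basis: "integrable lborel (\<lambda>x::'a. \<Prod>b\<in>Basis. f b (x \<bullet> b))"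
    and integral_prod_Basis: "(LBINT x. (\<Prod>b\<in>Basis. f b ((x::'a) \<bullet> b))) = (\<Prod>b\<in>Basis. \<integral>y. f b y \<partial>lborel)"
proof -
  interpret product_sigma_finite "\<lambda>b::'a. lborel :: real measure" ..
  have m[measurable]: "f b \<in> borel_measurable borel" if "b \<in> Basis" for b
    using borel_measurable_integrable[OF f[OF that]] by simp
  have eq: "(\<lambda>y. \<Prod>b\<in>Basis. f b ((\<Sum>c\<in>Basis. y c *\<^sub>R c) \<bullet> b)) = (\<lambda>y. \<Prod>b\<in>Basis. f b (y b))"
    by (intro ext prod.cong) auto
  show "integrable lborel (\<lambda>x::'a. \<Prod>b\<in>Basis. f b (x \<bullet> b))"
    by (subst lborel_eq) (use product_integrable_prod[of Basis f] f in \<open>simp add: integrable_distr_eq eq\<close>)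
  show "(LBINT x. (\<Prod>b\<in>Basis. f b ((x::'a) \<bullet> b))) = (\<Prod>b\<in>Basis. \<integral>y. f b y \<partial>lborel)"
    by (subst lborel_eq) (use product_integral_prod[of Basis f] f in \<open>simp add: integral_distr eq\<close>)
qed

text \<open>The Gauss-Weierstrass kernel, normalised to mass one for \<open>0 < t\<close>. Only
  positive times count: the weights in \<open>t\<close> used below vanish for
  \<open>t \<le> 0\<close>.\<close>

definition heat_kernel :: "real \<Rightarrow> 'a::euclidean_space \<Rightarrow> real" where
  "heat_kernel t x = (4 * pi * t) powr (- (DIM('a) / 2)) * exp (- ((norm x)\<^sup>2 / (4 * t)))"

lemma borel_measurable_heat_kernel [measurable (raw)]:
  assumes "f \<in> borel_measurable M" "g \<in> borel_measurable M"
  shows "(\<lambda>x. heat_kernel (f x) (g x)) \<in> borel_measurable M"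
  using assms unfolding heat_kernel_def by measurable

lemma heat_kernel_nonneg [simp]: "0 \<le> heat_kernel t x"
  by (simp add: heat_kernel_def)

abbreviation char_pos :: "'a::euclidean_space \<Rightarrow> 'a \<Rightarrow> complex" where
  "char_pos x \<xi> \<equiv> exp (2 * pi * \<i> * complex_of_real (x \<bullet> \<xi>))"

abbreviation char_neg :: "'a::euclidean_space \<Rightarrow> 'a \<Rightarrow> complex" where
  "char_neg x \<xi> \<equiv> exp (- (2 * pi * \<i> * complex_of_real (x \<bullet> \<xi>)))"

text \<open>The density has variance \<open>2 * t\<close>; rescaling by \<open>sqrt (2 * t)\<close>
  turns the integral into the characteristic function of the standard normal distribution, which is
  known.\<close>

lemma gaussian_fourier_real:
  fixes t a :: real
  assumes "0 < t"
  shows "integrable lborel (\<lambda>y. complex_of_real (inverse (sqrt (4 * pi * t)) * exp (- (y\<^sup>2 / (4 * t)))) * exp (- (2 * pi * \<i> * complex_of_real (y * a))))"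
    and "(LBINT y. complex_of_real (inverse (sqrt (4 * pi * t)) * exp (- (y\<^sup>2 / (4 * t)))) * exp (- (2 * pi * \<i> * complex_of_real (y * a))))
       = complex_of_real (exp (- (4 * pi\<^sup>2 * t * a\<^sup>2)))"
proof -
  let ?\<sigma> = "sqrt (2 * t)"
  let ?b = "- (2 * pi * a * ?\<sigma>)"
  let ?h = "\<lambda>x::real. complex_of_real (std_normal_density x) * iexp (?b * x)"
  have \<sigma>: "0 < ?\<sigma>" using assms by simp
  have h: "integrable lborel ?h"
    by (rule Bochner_Integration.integrable_bound[of _ "std_normal_density"])
       (auto simp: norm_mult intro!: integrable_normal_density)
  have hv: "(LBINT x. ?h x) = exp (- (?b\<^sup>2 / 2))"
  proof -
    have "char std_normal_distribution ?b = (LBINT x. ?h x)"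
      unfolding char_def by (subst integral_density) (auto simp: scaleR_conv_of_real)
    then show ?thesis by (simp add: char_std_normal_distribution)
  qed
  have eq: "?h (0 + inverse ?\<sigma> * y) = complex_of_real ?\<sigma> * (complex_of_real (inverse (sqrt (4 * pi * t)) * exp (- (y\<^sup>2 / (4 * t)))) * exp (- (2 * pi * \<i> * complex_of_real (y * a))))" for y
  proof -
    have 1: "std_normal_density (inverse ?\<sigma> * y) = ?\<sigma> * (inverse (sqrt (4 * pi * t)) * exp (- (y\<^sup>2 / (4 * t))))"
    proof -
      have "(inverse ?\<sigma> * y)\<^sup>2 = y\<^sup>2 / (2 * t)"
        using assms by (simp add: power_mult_distrib power_inverse field_simps)
      moreover have "sqrt (4 * pi * t) = ?\<sigma> * sqrt (2 * pi)"
        by (simp add: real_sqrt_mult[symmetric] algebra_simps)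
      ultimately show ?thesis
        using \<sigma> by (simp add: std_normal_density_def field_simps)
    qed
    have 2: "iexp (?b * (inverse ?\<sigma> * y)) = exp (- (2 * pi * \<i> * complex_of_real (y * a)))"
      using \<sigma> assms by (simp add: field_simps flip: of_real_mult)
    show ?thesis using 1 2 by (simp add: algebra_simps)
  qed
  have i0: "integrable lborel (\<lambda>y. ?h (0 + inverse ?\<sigma> * y))"
    using \<sigma> by (intro lborel_integrable_real_affine h) auto
  then show int: "integrable lborel (\<lambda>y. complex_of_real (inverse (sqrt (4 * pi * t)) * exp (- (y\<^sup>2 / (4 * t)))) * exp (- (2 * pi * \<i> * complex_of_real (y * a))))"
    using integrable_mult_right[OF i0, of "inverse (complex_of_real ?\<sigma>)"] \<sigma>
    unfolding eq by (simp add: mult.assoc[symmetric] del: of_real_mult of_real_inverse)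
  have "(LBINT x. ?h x) = \<bar>inverse ?\<sigma>\<bar> *\<^sub>R (LBINT y. ?h (0 + inverse ?\<sigma> * y))"
    using \<sigma> by (intro lborel_integral_real_affine) auto
  also have "\<dots> = (LBINT y. complex_of_real (inverse (sqrt (4 * pi * t)) * exp (- (y\<^sup>2 / (4 * t)))) * exp (- (2 * pi * \<i> * complex_of_real (y * a))))"
    unfolding eq using \<sigma> by (simp add: scaleR_conv_of_real)
  finally show "(LBINT y. complex_of_real (inverse (sqrt (4 * pi * t)) * exp (- (y\<^sup>2 / (4 * t)))) * exp (- (2 * pi * \<i> * complex_of_real (y * a))))
       = complex_of_real (exp (- (4 * pi\<^sup>2 * t * a\<^sup>2)))"
    using hv assms by (simp add: power_mult_distrib exp_of_real algebra_simps flip: exp_of_real)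
qed

lemma norm_power2_sum_Basis: "(norm (x::'a::euclidean_space))\<^sup>2 = (\<Sum>b\<in>Basis. (x \<bullet> b)\<^sup>2)"
  unfolding power2_norm_eq_inner by (subst euclidean_inner) (simp add: power2_eq_square)

lemma powr_neg_half_nat: "0 < c \<Longrightarrow> c powr (- (real n / 2)) = inverse (sqrt c) ^ n"
  by (simp add: powr_half_sqrt[symmetric] powr_minus[symmetric] powr_realpow[symmetric] powr_powr)

lemma
  fixes \<xi> :: "'a::euclidean_space"
  assumes t: "0 < t"
  shows integrable_heat_kernel_exp: "integrable lborel (\<lambda>x. complex_of_real (heat_kernel t x) * char_neg x \<xi>)"
    and integral_heat_kernel_exp: "(LBINT x. complex_of_real (heat_kernel t x) * char_neg x \<xi>)
       = complex_of_real (exp (- (4 * pi\<^sup>2 * t * (norm \<xi>)\<^sup>2)))"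
proof -
  let ?f = "\<lambda>b y. complex_of_real (inverse (sqrt (4 * pi * t)) * exp (- (y\<^sup>2 / (4 * t)))) * exp (- (2 * pi * \<i> * complex_of_real (y * (\<xi> \<bullet> b))))"
  have eq: "complex_of_real (heat_kernel t x) * char_neg x \<xi> = (\<Prod>b\<in>Basis. ?f b (x \<bullet> b))" for x :: 'a
  proof -
    have 1: "heat_kernel t x = (\<Prod>b\<in>Basis. inverse (sqrt (4 * pi * t)) * exp (- ((x \<bullet> b)\<^sup>2 / (4 * t))))"
      using t by (simp add: heat_kernel_def powr_neg_half_nat prod.distrib norm_power2_sum_Basis sum_negf sum_divide_distrib flip: exp_sum)
    have 2: "char_neg x \<xi> = (\<Prod>b\<in>Basis. exp (- (2 * pi * \<i> * complex_of_real ((x \<bullet> b) * (\<xi> \<bullet> b)))))"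
      by (simp add: sum_negf sum_distrib_left euclidean_inner[of x \<xi>] flip: exp_sum)
    show ?thesis unfolding 1 2 by (simp add: prod.distrib)
  qed
  show "integrable lborel (\<lambda>x. complex_of_real (heat_kernel t x) * char_neg x \<xi>)"
    unfolding eq by (rule integrable_prod_Basis) (rule gaussian_fourier_real[OF t])
  show "(LBINT x. complex_of_real (heat_kernel t x) * char_neg x \<xi>)
       = complex_of_real (exp (- (4 * pi\<^sup>2 * t * (norm \<xi>)\<^sup>2)))"
    unfolding eq
    by (subst integral_prod_Basis, rule gaussian_fourier_real[OF t], subst gaussian_fourier_real[OF t])
       (simp add: norm_power2_sum_Basis sum_distrib_left sum_negf flip: exp_sum of_real_prod)
qed

lemma integrable_heat_kernel: "0 < t \<Longrightarrow> integrable lborel (heat_kernel t :: 'a::euclidean_space \<Rightarrow> real)"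
  using integrable_heat_kernel_exp[of t "0::'a"] by (simp add: complex_of_real_integrable_eq)

lemma integral_heat_kernel: "0 < t \<Longrightarrow> (LBINT x. heat_kernel t (x::'a::euclidean_space)) = 1"
  using integral_heat_kernel_exp[of t "0::'a"] by (simp del: of_real_mult)

text \<open>The definitions integrate over \<open>lebesgue\<close>. For Borel functions one may pass
  to \<open>lborel\<close>, where product measures and Fubini's theorem are available.\<close>

lemma fourier_borel:
  assumes "f \<in> borel_measurable borel"
  shows "fourier f \<xi> = (LBINT x. complex_of_real (f x) * char_neg x \<xi>)"
  unfolding fourier_def using assms by (intro integral_completion) simp

lemma conv_borel:
  assumes [measurable]: "f \<in> borel_measurable borel" "g \<in> borel_measurable borel"
  shows "conv f g x = (LBINT y. f (x - y) * g y)"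
  unfolding conv_def by (intro integral_completion) simp

lemma borel_measurable_conv [measurable]:
  assumes [measurable]: "f \<in> borel_measurable borel" "g \<in> borel_measurable borel"
  shows "conv f g \<in> borel_measurable borel"
proof -
  have "(\<lambda>x. \<integral>y. f (x - y) * g y \<partial>lborel) \<in> borel_measurable borel"
    by measurable
  moreover have "conv f g = (\<lambda>x. \<integral>y. f (x - y) * g y \<partial>lborel)"
    by (intro ext conv_borel) simp_all
  ultimately show ?thesis by simp
qed

lemma fourier_heat_kernel:
  "0 < t \<Longrightarrow> fourier (heat_kernel t) \<xi> = complex_of_real (exp (- (4 * pi\<^sup>2 * t * (norm \<xi>)\<^sup>2)))"
  by (subst fourier_borel) (simp, rule integral_heat_kernel_exp)

lemma integrable_conv_pair:
  fixes f g :: "'a::euclidean_space \<Rightarrow> real"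
  assumes f: "integrable lborel f" and g: "integrable lborel g"
  shows "integrable (lborel \<Otimes>\<^sub>M lborel) (\<lambda>(x, y). f (x - y) * g y)"
proof (rule integrableI_bounded)
  note [measurable] = f g
  show "(\<lambda>(x, y). f (x - y) * g y) \<in> borel_measurable (lborel \<Otimes>\<^sub>M lborel)"
    by measurable
  have "(\<integral>\<^sup>+z. norm (case z of (x, y) \<Rightarrow> f (x - y) * g y) \<partial>(lborel \<Otimes>\<^sub>M lborel))
      = (\<integral>\<^sup>+y. (\<integral>\<^sup>+x. ennreal (norm (f (x - y))) * ennreal (norm (g y)) \<partial>lborel) \<partial>lborel)"
    by (subst lborel_pair.nn_integral_snd[symmetric]) (simp_all add: ennreal_mult abs_mult)
  also have "\<dots> = (\<integral>\<^sup>+y. (\<integral>\<^sup>+x. ennreal (norm (f x)) \<partial>lborel) * ennreal (norm (g y)) \<partial>lborel)"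
    using nn_integral_lborel_translate[of "\<lambda>x. ennreal (norm (f x))" "- y" for y]
    by (intro nn_integral_cong) (simp add: nn_integral_multc)
  also have "\<dots> = (\<integral>\<^sup>+x. ennreal (norm (f x)) \<partial>lborel) * (\<integral>\<^sup>+x. ennreal (norm (g x)) \<partial>lborel)"
    by (rule nn_integral_cmult) simp
  also have "\<dots> < \<infinity>"
    using f g by (simp add: integrable_iff_bounded ennreal_mult_less_top)
  finally show "(\<integral>\<^sup>+z. norm (case z of (x, y) \<Rightarrow> f (x - y) * g y) \<partial>(lborel \<Otimes>\<^sub>M lborel)) < \<infinity>" .
qed

lemma
  fixes f g :: "'a::euclidean_space \<Rightarrow> real"
  assumes f: "integrable lborel f" and g: "integrable lborel g"
  shows integrable_conv: "integrable lborel (conv f g)"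
    and AE_integrable_conv: "AE x in lborel. integrable lborel (\<lambda>y. f (x - y) * g y)"
    and integral_conv: "(LBINT x. conv f g x) = (LBINT x. f x) * (LBINT x. g x)"
proof -
  note [measurable] = f g
  have eq: "conv f g = (\<lambda>x. \<integral>y. f (x - y) * g y \<partial>lborel)"
    by (intro ext conv_borel) simp_all
  note p = integrable_conv_pair[OF f g]
  show "integrable lborel (conv f g)"
    unfolding eq by (rule lborel_pair.integrable_fst[OF p])
  show "AE x in lborel. integrable lborel (\<lambda>y. f (x - y) * g y)"
    by (rule lborel_pair.AE_integrable_fst[OF p])
  have "(LBINT x. conv f g x) = (LBINT y. (LBINT x. f (x - y) * g y))"
    unfolding eq by (rule lborel_pair.Fubini_integral[OF p, symmetric])
  also have "\<dots> = (LBINT y. (LBINT x. f x) * g y)"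
    using integral_lborel_translate[of f "- y" for y] by simp
  finally show "(LBINT x. conv f g x) = (LBINT x. f x) * (LBINT x. g x)"
    by simp
qed

lemma norm_exp_i_real [simp]: 
  "norm (exp (2 * pi * \<i> * complex_of_real a)) = 1" "norm (exp (- (2 * pi * \<i> * complex_of_real a))) = 1"
  by (simp_all add: norm_exp_eq_Re)

lemma integrable_fourier:
  fixes f :: "'a::euclidean_space \<Rightarrow> real"
  assumes f: "integrable lborel f"
  shows "integrable lborel (\<lambda>x. complex_of_real (f x) * char_neg x \<xi>)"
  using f by (rule Bochner_Integration.integrable_bound) (use f in \<open>auto simp: norm_mult\<close>)

lemma fourier_conv:
  fixes f g :: "'a::euclidean_space \<Rightarrow> real"
  assumes f: "integrable lborel f" and g: "integrable lborel g"
  shows "fourier (conv f g) \<xi> = fourier f \<xi> * fourier g \<xi>"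
proof -
  note [measurable] = f g
  let ?e = "\<lambda>x. char_neg x \<xi>"
  have p: "integrable (lborel \<Otimes>\<^sub>M lborel) (\<lambda>(x, y). complex_of_real (f (x - y) * g y) * ?e x)"
    using integrable_conv_pair[OF f g]
    by (rule Bochner_Integration.integrable_bound) (auto simp: norm_mult)
  have "fourier (conv f g) \<xi> = (LBINT x. complex_of_real (LBINT y. f (x - y) * g y) * ?e x)"
    by (subst fourier_borel) (simp_all add: conv_borel)
  also have "\<dots> = (LBINT x. (LBINT y. complex_of_real (f (x - y) * g y) * ?e x))"
    by (subst integral_mult_left_zero, subst integral_complex_of_real) (rule refl)
  also have "\<dots> = (LBINT y. (LBINT x. complex_of_real (f (x - y) * g y) * ?e x))"
    by (rule lborel_pair.Fubini_integral[OF p, symmetric])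
  also have "\<dots> = (LBINT y. fourier f \<xi> * (complex_of_real (g y) * ?e y))"
  proof (rule Bochner_Integration.integral_cong[OF refl])
    fix y
    have "(LBINT x. complex_of_real (f (x - y) * g y) * ?e x)
        = (LBINT x. (complex_of_real (f (x - y)) * ?e (x - y)) * (complex_of_real (g y) * ?e y))"
    proof (intro Bochner_Integration.integral_cong refl)
      fix x
      have "?e x = ?e (x - y) * ?e y"
        unfolding exp_add[symmetric] by (simp add: inner_diff_left algebra_simps)
      then show "complex_of_real (f (x - y) * g y) * ?e x = (complex_of_real (f (x - y)) * ?e (x - y)) * (complex_of_real (g y) * ?e y)"
        by (simp only: of_real_mult mult_ac)
    qed
    also have "\<dots> = fourier f \<xi> * (complex_of_real (g y) * ?e y)"
      using integral_lborel_translate[of "\<lambda>x. complex_of_real (f x) * ?e x" "- y"]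
      by (subst integral_mult_left_zero) (simp add: fourier_borel)
    finally show "(LBINT x. complex_of_real (f (x - y) * g y) * ?e x) = \<dots>" .
  qed
  also have "\<dots> = fourier f \<xi> * fourier g \<xi>"
    by (subst integral_mult_right_zero, subst (2) fourier_borel) simp_all
  finally show ?thesis .
qed

lemma
  fixes f g :: "'a::euclidean_space \<Rightarrow> real"
  assumes f: "integrable lborel f" and g: "integrable lborel g"
  shows fourier_add: "fourier (\<lambda>x. f x + g x) \<xi> = fourier f \<xi> + fourier g \<xi>"
    and fourier_diff: "fourier (\<lambda>x. f x - g x) \<xi> = fourier f \<xi> - fourier g \<xi>"
proof -
  note [measurable] = f g
  show "fourier (\<lambda>x. f x + g x) \<xi> = fourier f \<xi> + fourier g \<xi>"
    using integrable_fourier[OF f, of \<xi>] integrable_fourier[OF g, of \<xi>]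
    by (simp add: fourier_borel distrib_right)
  show "fourier (\<lambda>x. f x - g x) \<xi> = fourier f \<xi> - fourier g \<xi>"
    using integrable_fourier[OF f, of \<xi>] integrable_fourier[OF g, of \<xi>]
    by (simp add: fourier_borel left_diff_distrib)
qed

lemma fourier_reflect:
  fixes f :: "'a::euclidean_space \<Rightarrow> real"
  assumes [measurable]: "f \<in> borel_measurable borel"
  shows "fourier (\<lambda>x. f (- x)) \<xi> = fourier f (- \<xi>)"
  using integral_lborel_reflect[of "\<lambda>x. complex_of_real (f x) * char_neg x (- \<xi>)" 0]
  by (simp add: fourier_borel)

lemma norm_fourier_le:
  fixes f :: "'a::euclidean_space \<Rightarrow> real"
  assumes f: "integrable lborel f"
  shows "norm (fourier f \<xi>) \<le> (LBINT x. \<bar>f x\<bar>)"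
proof -
  note [measurable] = f
  have "norm (fourier f \<xi>) \<le> (LBINT x. norm (complex_of_real (f x) * char_neg x \<xi>))"
    by (simp add: fourier_borel integral_norm_bound)
  then show ?thesis by (simp add: norm_mult)
qed

lemma borel_measurable_fourier [measurable]:
  fixes f :: "'a::euclidean_space \<Rightarrow> real"
  assumes [measurable]: "f \<in> borel_measurable borel"
  shows "fourier f \<in> borel_measurable borel"
proof -
  have "(\<lambda>\<xi>. \<integral>x. complex_of_real (f x) * char_neg x \<xi> \<partial>lborel) \<in> borel_measurable borel"
    by measurable
  moreover have "fourier f = (\<lambda>\<xi>. \<integral>x. complex_of_real (f x) * char_neg x \<xi> \<partial>lborel)"
    by (intro ext fourier_borel) simp
  ultimately show ?thesis by simp
qed

section \<open>Jensen's inequality, \<open>L^p\<close> functions and Young's convolution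
  inequality\<close>

lemma powr_le_imp_base_le:
  fixes a b p :: real
  assumes "a powr p \<le> b powr p" "0 < p" "0 \<le> b"
  shows "a \<le> b"
  using powr_less_mono2[of p b a] assms by linarith

text \<open>Tangent line of the concave function \<open>x powr (1 / p)\<close> at
  \<open>x = l powr p\<close>, evaluated at \<open>x = a powr p\<close>. The free parameter
  \<open>l\<close> can be optimised after integration.\<close>

lemma powr_tangent_le:
  fixes a l p :: real
  assumes "1 < p" "0 \<le> a" "0 < l"
  shows "a \<le> l powr (1 - p) * a powr p / p + (1 - 1 / p) * l"
proof -
  let ?q = "p / (p - 1)"
  have "a * l powr (p - 1) \<le> a powr p / p + (l powr (p - 1)) powr ?q / ?q"
    using assms by (intro Youngs_inequality) (auto simp: field_simps)
  also have "(l powr (p - 1)) powr ?q = l powr p"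
    using assms by (simp add: powr_powr)
  also have "l powr p / ?q = (1 - 1 / p) * l powr p"
    using assms by (simp add: field_simps)
  finally have "(a * l powr (p - 1)) * l powr (1 - p) \<le> (a powr p / p + (1 - 1 / p) * l powr p) * l powr (1 - p)"
    by (rule mult_right_mono) simp
  moreover have "l powr (p - 1) * l powr (1 - p) = 1" "l powr p * l powr (1 - p) = l"
    using assms by (simp_all flip: powr_add)
  ultimately show ?thesis
    by (simp add: algebra_simps)
qed

text \<open>Integrating the tangent inequality against \<open>k\<close> and then choosing
  \<open>l\<close> gives Jensen's inequality for a weight of arbitrary finite mass, without
  normalising it to a probability measure. The choice \<open>l = 1\<close> already yields
  integrability of the product.\<close>

lemma
  fixes k w :: "'b \<Rightarrow> real"
  assumes p: "1 < p" and k: "integrable M k" and [measurable]: "w \<in> borel_measurable M"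
    and nn: "\<And>x. 0 \<le> k x" "\<And>x. 0 \<le> w x"
    and kw: "integrable M (\<lambda>x. k x * w x powr p)"
  shows integrable_jensen_powr: "integrable M (\<lambda>x. k x * w x)"
    and jensen_powr: "(\<integral>x. k x * w x \<partial>M) powr p \<le> (\<integral>x. k x \<partial>M) powr (p - 1) * (\<integral>x. k x * w x powr p \<partial>M)"
proof -
  have [measurable]: "k \<in> borel_measurable M" using k by auto
  have bd: "k x * w x \<le> l powr (1 - p) / p * (k x * w x powr p) + (1 - 1 / p) * l * k x" if "0 < l" for l x
    using mult_left_mono[OF powr_tangent_le[OF p nn(2)[of x] that] nn(1)[of x]]
    by (simp add: algebra_simps)
  have int: "integrable M (\<lambda>x. l powr (1 - p) / p * (k x * w x powr p) + (1 - 1 / p) * l * k x)" for l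
    using k kw by auto
  show i: "integrable M (\<lambda>x. k x * w x)"
    by (rule Bochner_Integration.integrable_bound[OF int[of 1]])
       (use bd[of 1] nn p in \<open>auto simp: mult_nonneg_nonneg intro!: AE_I2 order_trans[OF bd[of 1]]\<close>)
  let ?A = "\<integral>x. k x \<partial>M" and ?I = "\<integral>x. k x * w x powr p \<partial>M"
  have A0: "0 \<le> ?A" "0 \<le> ?I" using nn by (auto intro!: integral_nonneg_AE)
  show "(\<integral>x. k x * w x \<partial>M) powr p \<le> ?A powr (p - 1) * ?I"
  proof (cases "?A = 0 \<or> ?I = 0")
    \<comment> \<open>The optimal \<open>l\<close> would be zero or a quotient by zero here. In both
      cases the product of \<open>k\<close> and \<open>w\<close> vanishes almost everywhere.\<close>
    case True
    then have "AE x in M. k x * w x = 0"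
    proof
      assume "?A = 0"
      then have "AE x in M. k x = 0" using nn k by (simp add: integral_nonneg_eq_0_iff_AE)
      then show ?thesis by auto
    next
      assume "?I = 0"
      then have "AE x in M. k x * w x powr p = 0" using nn kw by (simp add: integral_nonneg_eq_0_iff_AE)
      then show ?thesis by auto
    qed
    then have "(\<integral>x. k x * w x \<partial>M) = 0" by (rule integral_eq_zero_AE)
    then show ?thesis using A0 by simp
  next
    case False
    with A0 have pos: "0 < ?A" "0 < ?I" by auto
    \<comment> \<open>\<open>l powr p\<close> is the \<open>k\<close>-average of
      \<open>w powr p\<close>; with this choice the two terms of the tangent bound add up to
      \<open>l * ?A\<close>.\<close>
    define l where "l = (?I / ?A) powr (1 / p)"
    have l: "0 < l" using pos by (simp add: l_def)
    have lp: "l powr p = ?I / ?A" using pos p by (simp add: l_def powr_powr)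
    have "(\<integral>x. k x * w x \<partial>M) \<le> (\<integral>x. l powr (1 - p) / p * (k x * w x powr p) + (1 - 1 / p) * l * k x \<partial>M)"
      by (rule integral_mono[OF i int bd[OF l]])
    also have "\<dots> = l powr (1 - p) / p * ?I + (1 - 1 / p) * l * ?A"
      using k kw by simp
    also have "?I = l powr p * ?A" using lp pos by simp
    also have "l powr (1 - p) / p * (l powr p * ?A) = l * ?A / p"
      using l by (simp add: mult.assoc[symmetric] flip: powr_add)
    also have "l * ?A / p + (1 - 1 / p) * l * ?A = l * ?A" by (simp add: field_simps)
    finally have "(\<integral>x. k x * w x \<partial>M) powr p \<le> (l * ?A) powr p"
      using nn p by (intro powr_mono2) (auto intro!: integral_nonneg_AE)
    also have "\<dots> = ?I / ?A * ?A powr p" using l pos by (simp add: powr_mult lp)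
    also have "\<dots> = ?A powr (p - 1) * ?I" using pos by (simp add: powr_diff)
    finally show ?thesis .
  qed
qed

lemma Lp_memD [measurable_dest]: "Lp_mem p M f \<Longrightarrow> f \<in> borel_measurable M"
  by (simp add: Lp_mem_def)

lemma Lp_norm_nonneg [simp]: "0 \<le> Lp_norm p M f"
  by (simp add: Lp_norm_def)

lemma Lp_norm_powr: "0 < p \<Longrightarrow> Lp_norm p M f powr p = (\<integral>x. \<bar>f x\<bar> powr p \<partial>M)"
  by (simp add: Lp_norm_def powr_powr integral_nonneg_AE)

text \<open>Jensen with the weight \<open>\<bar>K (x - y)\<bar>\<close> in \<open>y\<close> bounds
  the \<open>p\<close>-th power of the convolution pointwise by a convolution of two integrable
  functions, whose integral is a product.\<close>

lemma
  fixes K w :: "'a::euclidean_space \<Rightarrow> real"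
  assumes p: "1 < p" and K: "integrable lborel K" and w: "Lp_mem p lborel w"
  shows AE_integrable_conv_Lp: "AE x in lborel. integrable lborel (\<lambda>y. K (x - y) * w y)"
    and Lp_mem_conv: "Lp_mem p lborel (conv K w)"
    and Lp_norm_conv_le: "Lp_norm p lborel (conv K w) \<le> (LBINT x. \<bar>K x\<bar>) * Lp_norm p lborel w"
proof -
  have [measurable]: "K \<in> borel_measurable borel" "w \<in> borel_measurable borel"
    using K Lp_memD[OF w] by auto
  define A where "A = (LBINT x. \<bar>K x\<bar>)"
  define I where "I = conv (\<lambda>x. \<bar>K x\<bar>) (\<lambda>x. \<bar>w x\<bar> powr p)"
  have K': "integrable lborel (\<lambda>x. \<bar>K x\<bar>)" using K by simp
  have w': "integrable lborel (\<lambda>x. \<bar>w x\<bar> powr p)" using w by (simp add: Lp_mem_def)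
  have KA: "(LBINT y. \<bar>K (x - y)\<bar>) = A" for x
    using integral_lborel_reflect[of "\<lambda>x. \<bar>K x\<bar>" x] by (simp add: A_def)
  have KI: "integrable lborel (\<lambda>y. \<bar>K (x - y)\<bar>)" for x
    using integrable_lborel_reflect[of "\<lambda>x. \<bar>K x\<bar>" x] K' by simp
  have main: "AE x in lborel. integrable lborel (\<lambda>y. K (x - y) * w y) \<and> \<bar>conv K w x\<bar> powr p \<le> A powr (p - 1) * I x"
    using AE_integrable_conv[OF K' w']
  proof eventually_elim
    case (elim x)
    have 1: "integrable lborel (\<lambda>y. \<bar>K (x - y)\<bar> * \<bar>w y\<bar>)"
      by (rule integrable_jensen_powr[OF p KI]) (use elim in auto)
    then have 2: "integrable lborel (\<lambda>y. K (x - y) * w y)"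
      by (rule Bochner_Integration.integrable_bound) (auto simp: abs_mult)
    have "\<bar>conv K w x\<bar> \<le> (LBINT y. \<bar>K (x - y)\<bar> * \<bar>w y\<bar>)"
      using integral_norm_bound[of lborel "\<lambda>y. K (x - y) * w y"] by (simp add: conv_borel abs_mult)
    then have "\<bar>conv K w x\<bar> powr p \<le> (LBINT y. \<bar>K (x - y)\<bar> * \<bar>w y\<bar>) powr p"
      using p by (intro powr_mono2) auto
    also have "\<dots> \<le> A powr (p - 1) * I x"
      using jensen_powr[OF p KI[of x], of "\<lambda>y. \<bar>w y\<bar>"] elim by (simp add: KA I_def conv_borel)
    finally show ?case using 2 by simp
  qed
  then show "AE x in lborel. integrable lborel (\<lambda>y. K (x - y) * w y)" by auto
  have I: "integrable lborel (\<lambda>x. A powr (p - 1) * I x)"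
    unfolding I_def by (intro integrable_mult_right integrable_conv K' w')
  have int: "integrable lborel (\<lambda>x. \<bar>conv K w x\<bar> powr p)"
  proof (rule Bochner_Integration.integrable_bound[OF I])
    show "AE x in lborel. norm (\<bar>conv K w x\<bar> powr p) \<le> norm (A powr (p - 1) * I x)"
      using main by eventually_elim (auto intro: order_trans[OF _ abs_ge_self])
  qed simp
  then show "Lp_mem p lborel (conv K w)" by (simp add: Lp_mem_def)
  have A0: "0 \<le> A" by (simp add: A_def)
  have "Lp_norm p lborel (conv K w) powr p \<le> A powr (p - 1) * (LBINT x. I x)"
    using p integral_mono_AE[OF int I] main by (auto simp: Lp_norm_powr elim!: eventually_mono)
  also have "(LBINT x. I x) = A * Lp_norm p lborel w powr p"
    using p unfolding I_def A_def by (subst integral_conv[OF K' w']) (simp add: Lp_norm_powr)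
  also have "A powr (p - 1) * (A * Lp_norm p lborel w powr p) = (A * Lp_norm p lborel w) powr p"
    using A0 p by (cases "A = 0") (simp_all add: powr_mult powr_diff)
  finally show "Lp_norm p lborel (conv K w) \<le> A * Lp_norm p lborel w"
    by (rule powr_le_imp_base_le) (use A0 p in auto)
qed

lemma Lp_mem_abs: "Lp_mem p M f \<Longrightarrow> Lp_mem p M (\<lambda>x. \<bar>f x\<bar>)"
  by (auto simp: Lp_mem_def)

lemma abs_add_powr_le:
  fixes a b p :: real
  assumes "0 < p"
  shows "\<bar>a + b\<bar> powr p \<le> 2 powr p * (\<bar>a\<bar> powr p + \<bar>b\<bar> powr p)"
proof -
  have "\<bar>a + b\<bar> powr p \<le> (2 * max \<bar>a\<bar> \<bar>b\<bar>) powr p"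
    using assms by (intro powr_mono2) auto
  also have "\<dots> \<le> 2 powr p * (\<bar>a\<bar> powr p + \<bar>b\<bar> powr p)"
    by (auto simp: powr_mult max_def)
  finally show ?thesis .
qed

text \<open>In the crude constant 4, one factor 2 comes from \<open>abs_add_powr_le\<close> and one
  from \<open>2 \<le> 2 powr p\<close>. It only enters the constant of the final estimate.\<close>

lemma
  fixes f g :: "'b \<Rightarrow> real"
  assumes p: "1 \<le> p" and f: "Lp_mem p M f" and g: "Lp_mem p M g"
  shows Lp_mem_add: "Lp_mem p M (\<lambda>x. f x + g x)"
    and Lp_norm_add_le: "Lp_norm p M (\<lambda>x. f x + g x) \<le> 4 * (Lp_norm p M f + Lp_norm p M g)"
proof -
  have [measurable]: "f \<in> borel_measurable M" "g \<in> borel_measurable M"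
    using f g by (auto simp: Lp_mem_def)
  have int: "integrable M (\<lambda>x. 2 powr p * (\<bar>f x\<bar> powr p + \<bar>g x\<bar> powr p))"
    using f g by (auto simp: Lp_mem_def)
  then have i: "integrable M (\<lambda>x. \<bar>f x + g x\<bar> powr p)"
    by (rule Bochner_Integration.integrable_bound) (use abs_add_powr_le[of p] p in auto)
  then show "Lp_mem p M (\<lambda>x. f x + g x)" by (simp add: Lp_mem_def)
  have p': "0 < p" using p by simp
  let ?F = "Lp_norm p M f" and ?G = "Lp_norm p M g"
  have "Lp_norm p M (\<lambda>x. f x + g x) powr p \<le> (\<integral>x. 2 powr p * (\<bar>f x\<bar> powr p + \<bar>g x\<bar> powr p) \<partial>M)"
    unfolding Lp_norm_powr[OF p'] by (rule integral_mono[OF i int]) (rule abs_add_powr_le[OF p'])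
  also have "\<dots> = 2 powr p * (?F powr p + ?G powr p)"
    using f g p by (simp add: Lp_norm_powr Lp_mem_def)
  also have "\<dots> \<le> 2 powr p * ((?F + ?G) powr p + (?F + ?G) powr p)"
    using p by (intro mult_left_mono add_mono powr_mono2) auto
  also have "\<dots> \<le> 2 powr p * (2 powr p * (?F + ?G) powr p)"
    using powr_mono[of 1 p 2] p by (simp add: mult_right_mono flip: mult_2)
  also have "\<dots> = ((2 * 2) * (?F + ?G)) powr p"
    by (simp only: powr_mult mult.assoc)
  also have "(2::real) * 2 = 4" by simp
  finally show "Lp_norm p M (\<lambda>x. f x + g x) \<le> 4 * (?F + ?G)"
    by (rule powr_le_imp_base_le) (use p in auto)
qed

lemma Lp_mem_cmult: "Lp_mem p M f \<Longrightarrow> Lp_mem p M (\<lambda>x. c * f x)"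
  by (auto simp: Lp_mem_def abs_mult powr_mult)

text \<open>Young's inequality for the absolute values makes the iterated convolution finite almost
  everywhere, and at each such point Fubini's theorem interchanges the two integrations.\<close>

lemma AE_conv_assoc:
  fixes f g w :: "'a::euclidean_space \<Rightarrow> real"
  assumes p: "1 < p" and f: "integrable lborel f" and g: "integrable lborel g" and w: "Lp_mem p lborel w"
  shows "AE x in lborel. conv f (conv g w) x = conv (conv f g) w x"
proof -
  have [measurable]: "f \<in> borel_measurable borel" "g \<in> borel_measurable borel" "w \<in> borel_measurable borel"
    using f g Lp_memD[OF w] by auto
  define v where "v = conv (\<lambda>x. \<bar>g x\<bar>) (\<lambda>x. \<bar>w x\<bar>)"
  have [measurable]: "v \<in> borel_measurable borel" unfolding v_def by measurable
  have f': "integrable lborel (\<lambda>x. \<bar>f x\<bar>)" and g': "integrable lborel (\<lambda>x. \<bar>g x\<bar>)"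
    and w': "Lp_mem p lborel (\<lambda>x. \<bar>w x\<bar>)"
    using f g w by (auto intro: Lp_mem_abs)
  have v: "Lp_mem p lborel v" unfolding v_def by (rule Lp_mem_conv[OF p g' w'])
  have gw: "AE y in lborel. integrable lborel (\<lambda>z. \<bar>g (y - z)\<bar> * \<bar>w z\<bar>)"
    by (rule AE_integrable_conv_Lp[OF p g' w'])
  show ?thesis
    using AE_integrable_conv_Lp[OF p f' v]
  proof eventually_elim
    case (elim x)
    have F: "integrable (lborel \<Otimes>\<^sub>M lborel) (\<lambda>(y, z). f (x - y) * (g (y - z) * w z))"
    proof (rule lborel_pair.Fubini_integrable)
      show "(\<lambda>(y, z). f (x - y) * (g (y - z) * w z)) \<in> borel_measurable (lborel \<Otimes>\<^sub>M lborel)"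
        by measurable
      have "(\<lambda>y. \<integral>z. norm (case (y, z) of (y, z) \<Rightarrow> f (x - y) * (g (y - z) * w z)) \<partial>lborel)
          = (\<lambda>y. \<bar>f (x - y)\<bar> * v y)"
        by (simp add: abs_mult v_def conv_borel)
      then show "integrable lborel (\<lambda>y. \<integral>z. norm (case (y, z) of (y, z) \<Rightarrow> f (x - y) * (g (y - z) * w z)) \<partial>lborel)"
        using elim by simp
      show "AE y in lborel. integrable lborel (\<lambda>z. case (y, z) of (y, z) \<Rightarrow> f (x - y) * (g (y - z) * w z))"
        using gw
      proof eventually_elim
        case (elim y)
        then have "integrable lborel (\<lambda>z. g (y - z) * w z)"
          by (rule Bochner_Integration.integrable_bound) (auto simp: abs_mult)
        then show ?case by simp
      qed
    qed
    have "conv f (conv g w) x = (LBINT y. (LBINT z. f (x - y) * (g (y - z) * w z)))"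
      by (simp add: conv_borel)
    also have "\<dots> = (LBINT z. (LBINT y. f (x - y) * (g (y - z) * w z)))"
      by (rule lborel_pair.Fubini_integral[OF F, symmetric])
    also have "\<dots> = (LBINT z. conv f g (x - z) * w z)"
    proof (rule Bochner_Integration.integral_cong[OF refl])
      fix z
      have "(LBINT y. f (x - y) * (g (y - z) * w z)) = (LBINT y. f (x - y) * g (y - z)) * w z"
        by (simp only: mult.assoc[symmetric] integral_mult_left_zero)
      also have "(LBINT y. f (x - y) * g (y - z)) = conv f g (x - z)"
        using integral_lborel_translate[of "\<lambda>y. f (x - y) * g (y - z)" z]
        by (simp add: conv_borel algebra_simps)
      finally show "(LBINT y. f (x - y) * (g (y - z) * w z)) = conv f g (x - z) * w z" .
    qed
    also have "\<dots> = conv (conv f g) w x" by (simp add: conv_borel)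
    finally show ?case .
  qed
qed

lemma conv_cong_AE:
  fixes f g w :: "'a::euclidean_space \<Rightarrow> real"
  assumes [measurable]: "f \<in> borel_measurable borel" "g \<in> borel_measurable borel" "w \<in> borel_measurable borel"
    and ae: "AE x in lborel. f x = g x"
  shows "conv f w x = conv g w x"
proof -
  have "AE y in lborel. f (x - y) * w y = g (x - y) * w y"
    using AE_lborel_reflect[OF ae, of x] by eventually_elim simp
  then show ?thesis
    by (simp only: conv_borel assms(1-3)) (rule integral_cong_AE; measurable)
qed

text \<open>Jensen with the indicator of the ball as weight: its mass is finite.\<close>

lemma integrable_on_bounded_Lp:
  fixes w :: "'a::euclidean_space \<Rightarrow> real"
  assumes p: "1 < p" and w: "Lp_mem p lborel w"
  shows "integrable lborel (\<lambda>x. indicator (cball c r) x * w x)"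
proof -
  have [measurable]: "w \<in> borel_measurable borel"
    using Lp_memD[OF w] by auto
  have [measurable]: "cball c r \<in> sets borel" by simp
  have k: "integrable lborel (indicat_real (cball c r))"
    by (rule integrable_real_indicator) (use emeasure_lborel_cball_finite[of c r] in auto)
  have "integrable lborel (\<lambda>x. indicator (cball c r) x * \<bar>w x\<bar> powr p)"
    using integrable_mult_indicator[of "cball c r" lborel "\<lambda>x. \<bar>w x\<bar> powr p"] w by (simp add: Lp_mem_def)
  then have "integrable lborel (\<lambda>x. indicator (cball c r) x * \<bar>w x\<bar>)"
    by (intro integrable_jensen_powr[OF p k, of "\<lambda>x. \<bar>w x\<bar>"]) simp_all
  then show ?thesis
    by (rule Bochner_Integration.integrable_bound) (auto simp: abs_mult)
qed

section \<open>Superpositions of heat kernels\<close>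

lemma
  fixes F :: "real \<Rightarrow> 'a::euclidean_space \<Rightarrow> real"
  assumes F: "integrable (lborel \<Otimes>\<^sub>M lborel) (\<lambda>(t, x). F t x)"
  shows integrable_superposition: "integrable lborel (\<lambda>x. \<integral>t. F t x \<partial>lborel)"
    and fourier_superposition: "fourier (\<lambda>x. \<integral>t. F t x \<partial>lborel) \<xi> = (LBINT t. fourier (F t) \<xi>)"
proof -
  have [measurable]: "(\<lambda>(t, x). F t x) \<in> borel_measurable (lborel \<Otimes>\<^sub>M lborel)"
    using F by auto
  show 1: "integrable lborel (\<lambda>x. \<integral>t. F t x \<partial>lborel)"
    using F by (rule lborel_pair.integrable_snd)
  then have [measurable]: "(\<lambda>x. \<integral>t. F t x \<partial>lborel) \<in> borel_measurable borel" by auto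
  let ?e = "\<lambda>x. char_neg x \<xi>"
  have p: "integrable (lborel \<Otimes>\<^sub>M lborel) (\<lambda>(t, x). complex_of_real (F t x) * ?e x)"
    using F by (rule Bochner_Integration.integrable_bound) (auto simp: norm_mult)
  have meas: "F t \<in> borel_measurable borel" for t
    using measurable_Pair2[of "\<lambda>(t, x). F t x" lborel lborel borel t] by simp
  have eq: "fourier (F t) \<xi> = (LBINT x. complex_of_real (F t x) * ?e x)" for t
    by (rule fourier_borel[OF meas])
  have "fourier (\<lambda>x. \<integral>t. F t x \<partial>lborel) \<xi> = (LBINT x. complex_of_real (LBINT t. F t x) * ?e x)"
    by (rule fourier_borel) simp
  also have "\<dots> = (LBINT x. (LBINT t. complex_of_real (F t x) * ?e x))"
    by (subst integral_mult_left_zero, subst integral_complex_of_real) (rule refl)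
  also have "\<dots> = (LBINT t. (LBINT x. complex_of_real (F t x) * ?e x))"
    by (rule lborel_pair.Fubini_integral[OF p])
  finally show "fourier (\<lambda>x. \<integral>t. F t x \<partial>lborel) \<xi> = (LBINT t. fourier (F t) \<xi>)"
    by (simp add: eq)
qed

text \<open>A heat kernel has mass one at every positive time, so integrating in \<open>x\<close>
  first leaves at most the integral of \<open>\<bar>W\<bar>\<close>. The dilation \<open>c\<close>
  is there because Gaussian moment bounds double the time.\<close>

lemma integrable_heat_dominated:
  fixes F :: "real \<Rightarrow> 'a::euclidean_space \<Rightarrow> real"
  assumes [measurable]: "(\<lambda>(t, x). F t x) \<in> borel_measurable (lborel \<Otimes>\<^sub>M lborel)"
    and W: "integrable lborel W" and c: "0 < c"
    and bd: "\<And>t x. 0 < t \<Longrightarrow> \<bar>F t x\<bar> \<le> W t * heat_kernel (c * t) x"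
    and z: "\<And>t x. t \<le> 0 \<Longrightarrow> F t x = 0"
  shows "integrable (lborel \<Otimes>\<^sub>M lborel) (\<lambda>(t, x). F t x)"
proof (rule integrableI_bounded)
  note [measurable] = W
  show "(\<lambda>(t, x). F t x) \<in> borel_measurable (lborel \<Otimes>\<^sub>M lborel)" by measurable
  have heat: "(\<integral>\<^sup>+x. ennreal (heat_kernel (c * t) x) \<partial>(lborel :: 'a measure)) = 1" if "0 < t" for t
    using that c by (subst nn_integral_eq_integral) (simp_all add: integrable_heat_kernel integral_heat_kernel)
  have "(\<integral>\<^sup>+z. norm (case z of (t, x) \<Rightarrow> F t x) \<partial>(lborel \<Otimes>\<^sub>M lborel))
      = (\<integral>\<^sup>+t. (\<integral>\<^sup>+x. ennreal \<bar>F t x\<bar> \<partial>lborel) \<partial>lborel)"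
    by (subst lborel.nn_integral_fst[symmetric]) simp_all
  also have "\<dots> \<le> (\<integral>\<^sup>+t. ennreal \<bar>W t\<bar> \<partial>lborel)"
  proof (rule nn_integral_mono)
    fix t :: real
    show "(\<integral>\<^sup>+x. ennreal \<bar>F t x\<bar> \<partial>lborel) \<le> ennreal \<bar>W t\<bar>"
    proof (cases "0 < t")
      case True
      have "(\<integral>\<^sup>+x. ennreal \<bar>F t x\<bar> \<partial>lborel) \<le> (\<integral>\<^sup>+x. ennreal \<bar>W t\<bar> * ennreal (heat_kernel (c * t) x) \<partial>(lborel :: 'a measure))"
        using order_trans[OF bd[OF True] mult_right_mono[OF abs_ge_self heat_kernel_nonneg]]
        by (intro nn_integral_mono) (simp flip: ennreal_mult)
      also have "\<dots> = ennreal \<bar>W t\<bar>"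
        by (subst nn_integral_cmult) (simp_all add: heat[OF True])
      finally show ?thesis .
    qed (simp add: z)
  qed
  also have "\<dots> < \<infinity>" using W by (simp add: integrable_iff_bounded)
  finally show "(\<integral>\<^sup>+z. norm (case z of (t, x) \<Rightarrow> F t x) \<partial>(lborel \<Otimes>\<^sub>M lborel)) < \<infinity>" .
qed

text \<open>Bochner subordination: on the Fourier side the heat kernels become exponentials in
  \<open>t\<close>, and the transform is the Laplace transform of \<open>W\<close> at
  \<open>4 * pi\<^sup>2 * (norm \<xi>)\<^sup>2\<close>.\<close>

definition subordinate :: "(real \<Rightarrow> real) \<Rightarrow> 'a::euclidean_space \<Rightarrow> real" where
  "subordinate W x = (LBINT t. W t * heat_kernel t x)"

lemma
  assumes W: "integrable lborel W" and nn: "\<And>t. 0 \<le> W t" and z: "\<And>t. t \<le> 0 \<Longrightarrow> W t = 0"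
  shows integrable_subordinate: "integrable lborel (subordinate W :: 'a::euclidean_space \<Rightarrow> real)"
    and fourier_subordinate: "fourier (subordinate W) (\<xi>::'a) = complex_of_real (LBINT t. W t * exp (- (4 * pi\<^sup>2 * (norm \<xi>)\<^sup>2) * t))"
proof -
  note [measurable] = W
  have p: "integrable (lborel \<Otimes>\<^sub>M lborel) (\<lambda>(t, x::'a). W t * heat_kernel t x)"
    by (rule integrable_heat_dominated[where W = W and c = 1]) (use W nn z in \<open>auto simp: abs_mult\<close>)
  have eq: "subordinate W = (\<lambda>x::'a. \<integral>t. W t * heat_kernel t x \<partial>lborel)"
    by (intro ext) (simp add: subordinate_def)
  show "integrable lborel (subordinate W :: 'a \<Rightarrow> real)"
    unfolding eq by (rule integrable_superposition[OF p])
  have "fourier (subordinate W) \<xi> = (LBINT t. fourier (\<lambda>x. W t * heat_kernel t x) \<xi>)"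
    unfolding eq by (rule fourier_superposition[OF p])
  also have "\<dots> = (LBINT t. complex_of_real (W t * exp (- (4 * pi\<^sup>2 * (norm \<xi>)\<^sup>2) * t)))"
  proof (rule Bochner_Integration.integral_cong[OF refl])
    fix t
    show "fourier (\<lambda>x. W t * heat_kernel t x) \<xi> = complex_of_real (W t * exp (- (4 * pi\<^sup>2 * (norm \<xi>)\<^sup>2) * t))"
    proof (cases "0 < t")
      case True
      have "fourier (\<lambda>x. W t * heat_kernel t x) \<xi> = complex_of_real (W t) * fourier (heat_kernel t) \<xi>"
        by (subst (1 2) fourier_borel) (simp_all add: mult.assoc)
      then show ?thesis using True by (simp add: fourier_heat_kernel mult_ac del: of_real_exp)
    qed (simp add: z fourier_def)
  qed
  finally show "fourier (subordinate W) \<xi> = complex_of_real (LBINT t. W t * exp (- (4 * pi\<^sup>2 * (norm \<xi>)\<^sup>2) * t))"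
    by (simp only: integral_complex_of_real)
qed

lemma has_bochner_integral_Gamma:
  fixes a c :: real
  assumes a: "0 < a" and c: "0 < c"
  shows "has_bochner_integral lborel (\<lambda>t. indicator {0<..} t * (t powr (a - 1) * exp (- c * t))) (Gamma a * c powr - a)"
proof -
  have "has_bochner_integral lborel (\<lambda>t::real. indicator {0..} t * t powr (a - 1) / exp t) (Gamma a)"
    by (rule has_bochner_integral_nn_integral)
       (use a in \<open>auto simp: Gamma_conv_nn_integral_real Gamma_real_pos less_imp_le\<close>)
  then have "has_bochner_integral lborel (\<lambda>t::real. indicator {0..} (0 + c * t) * (0 + c * t) powr (a - 1) / exp (0 + c * t)) (Gamma a /\<^sub>R \<bar>c\<bar>)"
    by (subst (asm) lborel_has_bochner_integral_real_affine_iff[where c = c and t = 0]) (use c in auto)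
  then have "has_bochner_integral lborel (\<lambda>t::real. c powr (1 - a) * (indicator {0..} (0 + c * t) * (0 + c * t) powr (a - 1) / exp (0 + c * t))) (c powr (1 - a) * (Gamma a /\<^sub>R \<bar>c\<bar>))"
    by (intro has_bochner_integral_mult_right) auto
  moreover have "c powr (1 - a) * (indicator {0..} (0 + c * t) * (0 + c * t) powr (a - 1) / exp (0 + c * t))
      = indicator {0<..} t * (t powr (a - 1) * exp (- c * t))" for t
  proof (cases "0 < t")
    case True
    have "c powr (1 - a) * c powr (a - 1) = 1" using c by (simp flip: powr_add)
    with True c show ?thesis by (simp add: powr_mult exp_minus field_simps)
  next
    case False
    \<comment> \<open>The two indicators differ at \<open>t = 0\<close>, but there both sides vanish
      because \<open>0 powr x = 0\<close>.\<close>
    then show ?thesis using c by (cases "t = 0") (auto simp: indicator_def zero_le_mult_iff)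
  qed
  moreover have "c powr (1 - a) * (Gamma a /\<^sub>R \<bar>c\<bar>) = Gamma a * c powr - a"
    using c by (simp add: powr_diff powr_minus field_simps)
  ultimately show ?thesis by (simp only:)
qed

text \<open>The Bessel kernel of order \<open>2 * a\<close>, from the Gamma integral that expresses
  \<open>L powr (- a)\<close> through \<open>exp (- L * t)\<close>. The factor
  \<open>exp (- t)\<close> of the weight is the summand 1 in \<open>L\<close>.\<close>

definition bessel_potential :: "real \<Rightarrow> 'a::euclidean_space \<Rightarrow> real" where
  "bessel_potential a = subordinate (\<lambda>t. indicator {0<..} t * (t powr (a - 1) * exp (- t)) / Gamma a)"

lemma
  assumes a: "0 < a"
  shows integrable_bessel_potential: "integrable lborel (bessel_potential a :: 'a::euclidean_space \<Rightarrow> real)"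
    and fourier_bessel_potential: "fourier (bessel_potential a) (\<xi>::'a) = complex_of_real ((1 + 4 * pi\<^sup>2 * (norm \<xi>)\<^sup>2) powr - a)"
proof -
  let ?W = "\<lambda>t. indicator {0<..} t * (t powr (a - 1) * exp (- t)) / Gamma a"
  have G: "0 < Gamma a" using a by (rule Gamma_real_pos)
  have W: "integrable lborel ?W"
    using has_bochner_integral_Gamma[OF a, of 1] by (auto simp: has_bochner_integral_iff)
  show "integrable lborel (bessel_potential a :: 'a \<Rightarrow> real)"
    unfolding bessel_potential_def by (rule integrable_subordinate[OF W]) (use G in auto)
  have pos: "0 < 1 + 4 * pi\<^sup>2 * (norm \<xi>)\<^sup>2" by (intro add_pos_nonneg) auto
  have "fourier (bessel_potential a) \<xi> = complex_of_real (LBINT t. ?W t * exp (- (4 * pi\<^sup>2 * (norm \<xi>)\<^sup>2) * t))"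
    unfolding bessel_potential_def by (rule fourier_subordinate[OF W]) (use G in auto)
  also have "(\<lambda>t. ?W t * exp (- (4 * pi\<^sup>2 * (norm \<xi>)\<^sup>2) * t))
      = (\<lambda>t. inverse (Gamma a) * (indicator {0<..} t * (t powr (a - 1) * exp (- (1 + 4 * pi\<^sup>2 * (norm \<xi>)\<^sup>2) * t))))"
    by (intro ext) (simp add: field_simps exp_minus exp_add exp_diff)
  also have "(LBINT t. inverse (Gamma a) * (indicator {0<..} t * (t powr (a - 1) * exp (- (1 + 4 * pi\<^sup>2 * (norm \<xi>)\<^sup>2) * t))))
      = inverse (Gamma a) * (Gamma a * (1 + 4 * pi\<^sup>2 * (norm \<xi>)\<^sup>2) powr - a)"
    using has_bochner_integral_Gamma[OF a pos] by (simp only: integral_mult_right_zero has_bochner_integral_iff)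
  finally show "fourier (bessel_potential a) \<xi> = complex_of_real ((1 + 4 * pi\<^sup>2 * (norm \<xi>)\<^sup>2) powr - a)"
    using G by simp
qed

lemma nn_integral_powr_Icc:
  fixes s A :: real
  assumes s: "0 < s" and A: "0 \<le> A"
  shows "(\<integral>\<^sup>+y\<in>{0..1}. ennreal ((A + y) powr (s - 1)) \<partial>lborel) = ennreal (((1 + A) powr s - A powr s) / s)"
proof -
  have "((\<lambda>y. (A + y) powr (s - 1)) has_integral (A + 1) powr s / s - (A + 0) powr s / s) {0..1}"
  \<comment> \<open>For \<open>A = 0\<close> the integrand may be singular at the left endpoint, so
    the derivative is taken in the interior only.\<close>
  proof (rule fundamental_theorem_of_calculus_interior)
    show "continuous_on {0..1} (\<lambda>y. (A + y) powr s / s)"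
      using s A by (intro continuous_intros continuous_on_powr') auto
    fix y :: real assume "y \<in> {0<..<1}"
    then have "((\<lambda>y. (A + y) powr s / s) has_real_derivative (A + y) powr (s - 1)) (at y)"
      using s A by (auto intro!: derivative_eq_intros)
    then show "((\<lambda>y. (A + y) powr s / s) has_vector_derivative (A + y) powr (s - 1)) (at y)"
      by (simp add: has_real_derivative_iff_has_vector_derivative)
  qed simp
  then have "(\<integral>\<^sup>+y\<in>{0..1}. ennreal ((A + y) powr (s - 1)) \<partial>lborel) = ennreal ((A + 1) powr s / s - (A + 0) powr s / s)"
    by (intro nn_integral_has_integral_lebesgue') auto
  then show ?thesis by (simp add: diff_divide_distrib add.commute)
qed

text \<open>The quotient \<open>(1 - exp (- t)) / t\<close> is the integral of
  \<open>exp (- y * t)\<close> over \<open>y\<close> in \<open>{0..1}\<close>. After Tonelli's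
  theorem the inner integral is a Gamma integral with value
  \<open>Gamma (1 - s) * (A + y) powr (s - 1)\<close>, and integrating in \<open>y\<close> produces
  the difference of powers.\<close>

lemma has_bochner_integral_powr_diff:
  fixes s A :: real
  assumes s: "0 < s" "s < 1" and A: "0 \<le> A"
  shows "has_bochner_integral lborel (\<lambda>t. indicator {0<..} t * (t powr (- s - 1) * (1 - exp (- t))) * exp (- A * t))
    (Gamma (1 - s) / s * ((1 + A) powr s - A powr s))"
proof (rule has_bochner_integral_nn_integral)
  let ?f = "\<lambda>t. indicator {0<..} t * (t powr (- s - 1) * (1 - exp (- t))) * exp (- A * t) :: real"
  show "AE t in lborel. 0 \<le> ?f t" by (auto simp: indicator_def)
  show "0 \<le> Gamma (1 - s) / s * ((1 + A) powr s - A powr s)"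
    using s A powr_mono2[of s A "1 + A"] Gamma_real_pos[of "1 - s"]
    by (auto intro!: mult_nonneg_nonneg divide_nonneg_nonneg)
  have inner: "ennreal (?f t) = (\<integral>\<^sup>+y. indicator {0..1} y * ennreal (indicator {0<..} t * (t powr ((1 - s) - 1) * exp (- (A + y) * t))) \<partial>lborel)" for t
  proof (cases "0 < t")
    case True
    have "((\<lambda>y. exp (- (A + y) * t)) has_integral (- exp (- (A + 1) * t) / t - (- exp (- (A + 0) * t) / t))) {0..1}"
      using True by (intro fundamental_theorem_of_calculus)
        (auto intro!: derivative_eq_intros simp flip: has_real_derivative_iff_has_vector_derivative)
    then have "(\<integral>\<^sup>+y. ennreal (exp (- (A + y) * t)) * indicator {0..1} y \<partial>lborel) = ennreal (- exp (- (A + 1) * t) / t - (- exp (- (A + 0) * t) / t))"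
      by (intro nn_integral_has_integral_lebesgue') auto
    then have "(\<integral>\<^sup>+y. ennreal (t powr (- s)) * (ennreal (exp (- (A + y) * t)) * indicator {0..1} y) \<partial>lborel) = ennreal (t powr (- s)) * ennreal (- exp (- (A + 1) * t) / t - (- exp (- (A + 0) * t) / t))"
      by (subst nn_integral_cmult) auto
    also have "\<dots> = ennreal (?f t)"
    proof -
      have "- exp (- (A + 1) * t) / t - (- exp (- (A + 0) * t) / t) = (1 - exp (- t)) * exp (- A * t) / t"
        using True by (simp add: field_simps exp_diff exp_minus exp_add)
      moreover have "t powr (- s - 1) = t powr (- s) / t" using True by (simp add: powr_diff)
      ultimately show ?thesis using True by (subst ennreal_mult'[symmetric]) auto
    qed
    finally show ?thesis using True by (simp add: ennreal_mult' mult_ac)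
  qed simp
  have "(\<integral>\<^sup>+t. ennreal (?f t) \<partial>lborel) = (\<integral>\<^sup>+y. (\<integral>\<^sup>+t. indicator {0..1} y * ennreal (indicator {0<..} t * (t powr ((1 - s) - 1) * exp (- (A + y) * t))) \<partial>lborel) \<partial>lborel)"
    unfolding inner by (rule lborel_pair.Fubini') measurable
  also have "\<dots> = (\<integral>\<^sup>+y. ennreal (Gamma (1 - s)) * (ennreal ((A + y) powr (s - 1)) * indicator {0..1} y) \<partial>lborel)"
  proof (rule nn_integral_cong_AE)
    show "AE y in lborel. (\<integral>\<^sup>+t. indicator {0..1} y * ennreal (indicator {0<..} t * (t powr ((1 - s) - 1) * exp (- (A + y) * t))) \<partial>lborel)
      = ennreal (Gamma (1 - s)) * (ennreal ((A + y) powr (s - 1)) * indicator {0..1} y)"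
      \<comment> \<open>The point \<open>y = 0\<close> is discarded since \<open>A + y\<close> must
        be positive for the Gamma integral and \<open>A\<close> may be zero.\<close>
      using AE_lborel_singleton[of "0::real"]
    proof eventually_elim
      case (elim y)
      show ?case
      proof (cases "y \<in> {0..1}")
        case True
        with elim A have pos: "0 < A + y" by auto
        have h: "has_bochner_integral lborel (\<lambda>t. indicator {0<..} t * (t powr ((1 - s) - 1) * exp (- (A + y) * t))) (Gamma (1 - s) * (A + y) powr - (1 - s))"
          using s by (intro has_bochner_integral_Gamma pos) auto
        have "(\<integral>\<^sup>+t. ennreal (indicator {0<..} t * (t powr ((1 - s) - 1) * exp (- (A + y) * t))) \<partial>lborel) = ennreal (Gamma (1 - s) * (A + y) powr - (1 - s))"
          using h by (subst nn_integral_eq_integral) (auto simp: has_bochner_integral_iff)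
        then show ?thesis using True s by (simp add: ennreal_mult' less_imp_le[OF Gamma_real_pos])
      qed auto
    qed
  qed
  also have "\<dots> = ennreal (Gamma (1 - s)) * ennreal (((1 + A) powr s - A powr s) / s)"
    using nn_integral_powr_Icc[OF s(1) A] by (subst nn_integral_cmult) auto
  also have "\<dots> = ennreal (Gamma (1 - s) / s * ((1 + A) powr s - A powr s))"
    using s by (subst ennreal_mult'[symmetric]) (auto simp: less_imp_le[OF Gamma_real_pos])
  finally show "(\<integral>\<^sup>+t. ennreal (?f t) \<partial>lborel) = ennreal (Gamma (1 - s) / s * ((1 + A) powr s - A powr s))" .
qed measurable

text \<open>Neither \<open>L powr s\<close> nor \<open>(L - 1) powr s\<close> is bounded, but their
  difference is the Laplace transform of this positive weight. The weight behaves like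
  \<open>t powr (- s)\<close> at zero and \<open>t powr (- s - 1)\<close> at infinity, hence is
  integrable exactly because \<open>0 < s < 1\<close>.\<close>

definition powr_diff_kernel :: "real \<Rightarrow> 'a::euclidean_space \<Rightarrow> real" where
  "powr_diff_kernel s = subordinate (\<lambda>t. s / Gamma (1 - s) * (indicator {0<..} t * (t powr (- s - 1) * (1 - exp (- t)))))"

lemma
  assumes s: "0 < s" "s < 1"
  shows integrable_powr_diff_kernel: "integrable lborel (powr_diff_kernel s :: 'a::euclidean_space \<Rightarrow> real)"
    and fourier_powr_diff_kernel: "fourier (powr_diff_kernel s) (\<xi>::'a)
      = complex_of_real ((1 + 4 * pi\<^sup>2 * (norm \<xi>)\<^sup>2) powr s - (4 * pi\<^sup>2 * (norm \<xi>)\<^sup>2) powr s)"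
proof -
  let ?w = "\<lambda>t. indicator {0<..} t * (t powr (- s - 1) * (1 - exp (- t))) :: real"
  let ?W = "\<lambda>t. s / Gamma (1 - s) * ?w t"
  have G: "0 < Gamma (1 - s)" using s by (intro Gamma_real_pos) auto
  have W: "integrable lborel ?W"
    using has_bochner_integral_powr_diff[OF s, of 0] by (auto simp: has_bochner_integral_iff)
  have nn: "0 \<le> ?W t" "t \<le> 0 \<Longrightarrow> ?W t = 0" for t using G s by (auto simp: indicator_def)
  show "integrable lborel (powr_diff_kernel s :: 'a \<Rightarrow> real)"
    unfolding powr_diff_kernel_def by (rule integrable_subordinate[OF W nn])
  let ?A = "4 * pi\<^sup>2 * (norm \<xi>)\<^sup>2"
  have "fourier (powr_diff_kernel s) \<xi> = complex_of_real (LBINT t. ?W t * exp (- ?A * t))"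
    unfolding powr_diff_kernel_def by (rule fourier_subordinate[OF W nn])
  also have "(LBINT t. ?W t * exp (- ?A * t)) = s / Gamma (1 - s) * (LBINT t. ?w t * exp (- ?A * t))"
    by (simp only: integral_mult_right_zero mult.assoc)
  also have "(LBINT t. ?w t * exp (- ?A * t)) = Gamma (1 - s) / s * ((1 + ?A) powr s - ?A powr s)"
    using has_bochner_integral_powr_diff[OF s, of ?A] by (simp add: has_bochner_integral_iff)
  finally show "fourier (powr_diff_kernel s) \<xi> = complex_of_real ((1 + ?A) powr s - ?A powr s)"
    using G s by simp
qed

section \<open>Smooth functions\<close>

text \<open>The index \<open>k\<close> closes the family under differentiation: the derivative is a
  combination of the members \<open>k + 1\<close> and \<open>k + 2\<close>, so no separate treatment
  of higher derivatives at the origin is required.\<close>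

definition exp_recip :: "nat \<Rightarrow> real \<Rightarrow> real" where
  "exp_recip k t = (if 0 < t then exp (- 1 / t) / t ^ k else 0)"

lemma power_le_fact_exp:
  fixes y :: real
  assumes "0 \<le> y"
  shows "y ^ k \<le> fact k * exp y"
proof -
  have "y ^ k /\<^sub>R fact k \<le> exp y"
    unfolding exp_def
    using sum_le_suminf[OF summable_exp_generic[of y], of "{k}"] assms by simp
  then show ?thesis by (simp add: field_simps)
qed

lemma exp_recip_nonneg [simp]: "0 \<le> exp_recip k t"
  by (simp add: exp_recip_def)

lemma exp_recip_le: "exp_recip k t \<le> fact k"
proof (cases "0 < t")
  case True
  then have "(1 / t) ^ k \<le> fact k * exp (1 / t)" by (intro power_le_fact_exp) auto
  then show ?thesis using True by (simp add: exp_recip_def exp_minus field_simps)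
qed (simp add: exp_recip_def)

lemma has_real_derivative_exp_recip:
  "(exp_recip k has_real_derivative (- real k * exp_recip (Suc k) t + exp_recip (Suc (Suc k)) t)) (at t)"
proof -
  let ?D = "- real k * exp_recip (Suc k) t + exp_recip (Suc (Suc k)) t"
  consider "0 < t" | "t < 0" | "t = 0" by linarith
  then show ?thesis
  proof cases
    case 1
    have a: "((\<lambda>t. exp (- 1 / t)) has_real_derivative exp (- 1 / t) * (1 / t\<^sup>2)) (at t)"
      and b: "((\<lambda>t. 1 / t) has_real_derivative - 1 / t\<^sup>2) (at t)"
      using 1 by (auto intro!: derivative_eq_intros simp: power2_eq_square)
    note DERIV_mult[OF a DERIV_power[OF b, of k]]
    moreover have "exp (- 1 / t) * (1 / t\<^sup>2) * (1 / t) ^ k + real k * (- 1 / t\<^sup>2 * (1 / t) ^ (k - Suc 0)) * exp (- 1 / t) = ?D"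
      using 1 by (cases k) (simp_all add: exp_recip_def power_divide field_simps power2_eq_square)
    ultimately have "((\<lambda>t. exp (- 1 / t) * (1 / t) ^ k) has_real_derivative ?D) (at t)" by simp
    then show ?thesis
      by (rule has_field_derivative_transform_within_open[where S = "{0<..}"])
         (use 1 in \<open>auto simp: exp_recip_def power_divide\<close>)
  next
    case 2
    have "((\<lambda>_. 0) has_real_derivative ?D) (at t)" using 2 by (simp add: exp_recip_def)
    then show ?thesis
      by (rule has_field_derivative_transform_within_open[where S = "{..<0}"])
         (use 2 in \<open>auto simp: exp_recip_def\<close>)
  next
    case 3
    \<comment> \<open>For \<open>h > 0\<close> the difference quotient at the origin is
      \<open>h\<close> times the member \<open>k + 2\<close> of the family, and all members are
      bounded.\<close>
    have bd: "\<bar>exp_recip k h / h\<bar> \<le> fact (Suc (Suc k)) * \<bar>h\<bar>" for h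
    proof (cases "0 < h")
      case True
      have "exp_recip k h / h = h * exp_recip (Suc (Suc k)) h"
        using True by (simp add: exp_recip_def field_simps)
      also have "\<dots> \<le> h * fact (Suc (Suc k))"
        using True by (intro mult_left_mono exp_recip_le) auto
      finally show ?thesis using True by (simp add: mult.commute del: fact_Suc)
    next
      case False
      then have "exp_recip k h / h = 0" by (simp add: exp_recip_def)
      moreover have "(0::real) \<le> fact (Suc (Suc k)) * \<bar>h\<bar>" by (intro mult_nonneg_nonneg fact_ge_zero abs_ge_zero)
      ultimately show ?thesis by (simp only: abs_zero)
    qed
    define c :: real where "c = fact (Suc (Suc k))"
    have "((\<lambda>h. exp_recip k h / h) \<longlongrightarrow> 0) (at 0)"
    proof (rule Lim_null_comparison)
      show "\<forall>\<^sub>F h in at 0. norm (exp_recip k h / h) \<le> c * \<bar>h\<bar>"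
        using bd by (intro always_eventually allI) (simp only: real_norm_def c_def)
      have "((\<lambda>h. c * \<bar>h\<bar>) \<longlongrightarrow> c * \<bar>0\<bar>) (at 0)" by (intro tendsto_intros)
      then show "((\<lambda>h. c * \<bar>h\<bar>) \<longlongrightarrow> 0) (at 0)" by simp
    qed
    then show ?thesis using 3 by (simp add: DERIV_def exp_recip_def)
  qed
qed

text \<open>The Gaussian is split into two equal factors \<open>exp (- y)\<close> with
  \<open>y = (norm x)\<^sup>2 / (8 * t)\<close>. One absorbs \<open>y ^ M\<close> at the cost of
  \<open>fact M\<close>, the other is the Gaussian at time \<open>2 * t\<close>; the power of 2
  compares the normalisations.\<close>

lemma heat_kernel_moment:
  fixes x :: "'a::euclidean_space"
  assumes t: "0 < t"
  shows "((norm x)\<^sup>2) ^ M * heat_kernel t x \<le> (8 ^ M * fact M * 2 powr (DIM('a) / 2)) * t ^ M * heat_kernel (2 * t) x"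
proof -
  define y where "y = (norm x)\<^sup>2 / (8 * t)"
  have y: "0 \<le> y" using t by (simp add: y_def)
  have x: "(norm x)\<^sup>2 = 8 * t * y" using t by (simp add: y_def)
  let ?d = "DIM('a) / 2"
  have 1: "heat_kernel t x = (4 * pi * t) powr (- ?d) * exp (- y) * exp (- y)"
    using t by (simp add: heat_kernel_def x mult_exp_exp)
  have 2: "heat_kernel (2 * t) x = (8 * pi * t) powr (- ?d) * exp (- y)"
  proof -
    have "4 * pi * (2 * t) = 8 * pi * t" by simp
    then show ?thesis using t unfolding heat_kernel_def x by (simp only:) simp
  qed
  have "(8 * pi * t) powr (- ?d) = 2 powr (- ?d) * (4 * pi * t) powr (- ?d)"
  proof -
    have "8 * pi * t = 2 * (4 * pi * t)" by simp
    then show ?thesis using t by (simp only: powr_mult)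
  qed
  moreover have "2 powr ?d * 2 powr (- ?d) = (1::real)" by (simp flip: powr_add)
  ultimately have 3: "2 powr ?d * (8 * pi * t) powr (- ?d) = (4 * pi * t) powr (- ?d)" 
    by (simp add: mult.assoc[symmetric])
  have 4: "y ^ M * exp (- y) \<le> fact M"
    using power_le_fact_exp[OF y, of M] by (simp add: exp_minus field_simps)
  have "((norm x)\<^sup>2) ^ M * heat_kernel t x = (8 ^ M * t ^ M * (4 * pi * t) powr (- ?d) * exp (- y)) * (y ^ M * exp (- y))"
    unfolding 1 x by (simp add: power_mult_distrib)
  also have "\<dots> \<le> (8 ^ M * t ^ M * (4 * pi * t) powr (- ?d) * exp (- y)) * fact M"
    using t by (intro mult_left_mono[OF 4]) auto
  also have "\<dots> = (8 ^ M * fact M * 2 powr ?d) * t ^ M * heat_kernel (2 * t) x"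
    unfolding 2 3[symmetric] by (simp add: mult_ac)
  finally show ?thesis .
qed

text \<open>A syntactic class of smooth functions: coordinates, constants, sums, products and
  composition with \<open>exp_recip\<close>. Smoothness of every cutoff used below then follows by
  induction instead of from a calculus of smooth functions.\<close>

inductive bump_alg :: "('a::euclidean_space \<Rightarrow> real) \<Rightarrow> bool" where
  const: "bump_alg (\<lambda>_. c)"
| inner: "bump_alg (\<lambda>x. x \<bullet> v)"
| add: "bump_alg f \<Longrightarrow> bump_alg g \<Longrightarrow> bump_alg (\<lambda>x. f x + g x)"
| mult: "bump_alg f \<Longrightarrow> bump_alg g \<Longrightarrow> bump_alg (\<lambda>x. f x * g x)"
| exp_recip: "bump_alg f \<Longrightarrow> bump_alg (\<lambda>x. exp_recip k (f x))"

lemma bump_alg_diff: "bump_alg f \<Longrightarrow> bump_alg g \<Longrightarrow> bump_alg (\<lambda>x. f x - g x)"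
  using bump_alg.add[OF _ bump_alg.mult[OF bump_alg.const[of "-1"]], of f g] by simp

lemma bump_alg_sum: "finite A \<Longrightarrow> (\<And>i. i \<in> A \<Longrightarrow> bump_alg (f i)) \<Longrightarrow> bump_alg (\<lambda>x. \<Sum>i\<in>A. f i x)"
  by (induction A rule: finite_induct) (auto intro: bump_alg.intros)

lemma bump_alg_norm_power2: "bump_alg (\<lambda>x. (norm x)\<^sup>2)"
  unfolding norm_power2_sum_Basis unfolding power2_eq_square
  by (intro bump_alg_sum bump_alg.intros) auto

text \<open>The witness \<open>D\<close> is indexed by the direction first, so that each directional
  derivative is again in the class as a function of the base point. This is what permits
  iteration.\<close>

lemma bump_alg_has_derivative:
  assumes "bump_alg f"
  shows "\<exists>D. (\<forall>v. bump_alg (D v)) \<and> (\<forall>x. (f has_derivative (\<lambda>v. D v x)) (at x))"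
  using assms
proof induction
  case (const c)
  then show ?case by (intro exI[of _ "\<lambda>v x. 0"]) (auto intro: bump_alg.intros)
next
  case (inner w)
  then show ?case
    by (intro exI[of _ "\<lambda>v x. v \<bullet> w"]) (auto intro: bump_alg.intros intro!: derivative_eq_intros)
next
  case (add f g)
  then obtain D E where D: "\<And>v. bump_alg (D v)" "\<And>x. (f has_derivative (\<lambda>v. D v x)) (at x)"
    and E: "\<And>v. bump_alg (E v)" "\<And>x. (g has_derivative (\<lambda>v. E v x)) (at x)" by auto
  show ?case
    by (intro exI[of _ "\<lambda>v x. D v x + E v x"]) (auto intro!: bump_alg.add D E has_derivative_add)
next
  case (mult f g)
  then obtain D E where D: "\<And>v. bump_alg (D v)" "\<And>x. (f has_derivative (\<lambda>v. D v x)) (at x)"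
    and E: "\<And>v. bump_alg (E v)" "\<And>x. (g has_derivative (\<lambda>v. E v x)) (at x)" by auto
  show ?case
    by (intro exI[of _ "\<lambda>v x. f x * E v x + D v x * g x"])
       (auto intro!: bump_alg.add bump_alg.mult D E has_derivative_mult mult.hyps)
next
  case (exp_recip f k)
  then obtain D where D: "\<And>v. bump_alg (D v)" "\<And>x. (f has_derivative (\<lambda>v. D v x)) (at x)" by auto
  have "((\<lambda>x. exp_recip k (f x)) has_derivative (\<lambda>v. (- real k * exp_recip (Suc k) (f x) + exp_recip (Suc (Suc k)) (f x)) * D v x)) (at x)" for x
    using has_derivative_compose[OF D(2)[of x] has_real_derivative_exp_recip[of k "f x", unfolded has_field_derivative_def]]
    by (simp only: mult.commute)
  moreover have "bump_alg (\<lambda>x. (- real k * exp_recip (Suc k) (f x) + exp_recip (Suc (Suc k)) (f x)) * D v x)" for v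
    by (rule bump_alg.mult[OF bump_alg.add[OF bump_alg.mult[OF bump_alg.const bump_alg.exp_recip[OF exp_recip.hyps]]
          bump_alg.exp_recip[OF exp_recip.hyps]] D(1)])
  ultimately show ?case
    by (intro exI[of _ "\<lambda>v x. (- real k * exp_recip (Suc k) (f x) + exp_recip (Suc (Suc k)) (f x)) * D v x"]) blast
qed

lemma bump_alg_continuous_on: "bump_alg f \<Longrightarrow> continuous_on A f"
  using bump_alg_has_derivative[of f]
  by (metis continuous_at_imp_continuous_on has_derivative_continuous)

lemma borel_measurable_bump_alg: "bump_alg f \<Longrightarrow> f \<in> borel_measurable borel"
  by (intro borel_measurable_continuous_onI bump_alg_continuous_on)

text \<open>Composition cannot spoil the growth because \<open>exp_recip\<close> is bounded. The
  bound is later beaten by Gaussian decay.\<close>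

lemma bump_alg_poly_bounded:
  assumes "bump_alg (f :: 'a::euclidean_space \<Rightarrow> real)"
  shows "\<exists>C N. 0 \<le> C \<and> (\<forall>x. \<bar>f x\<bar> \<le> C * (1 + (norm x)\<^sup>2) ^ N)"
  using assms
proof induction
  case (const c)
  then show ?case by (intro exI[of _ "\<bar>c\<bar>"] exI[of _ 0]) auto
next
  case (inner w)
  have "\<bar>x \<bullet> w\<bar> \<le> norm w * (1 + (norm x)\<^sup>2)" for x :: 'a
  proof -
    have "\<bar>x \<bullet> w\<bar> \<le> norm w * norm x" using Cauchy_Schwarz_ineq2[of x w] by (simp add: mult.commute)
    also have "norm x \<le> 1 + (norm x)\<^sup>2" using zero_le_power2[of "norm x - 1"] by (simp add: power2_diff) (smt (verit) norm_ge_zero)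
    finally show ?thesis by (simp add: mult_left_mono)
  qed
  then show ?case by (intro exI[of _ "norm w"] exI[of _ 1]) auto
next
  case (add f g)
  then obtain C N C' N' where b: "0 \<le> C" "\<And>x. \<bar>f x\<bar> \<le> C * (1 + (norm x)\<^sup>2) ^ N"
    "0 \<le> C'" "\<And>x. \<bar>g x\<bar> \<le> C' * (1 + (norm x)\<^sup>2) ^ N'" by auto
  have "\<bar>f x + g x\<bar> \<le> (C + C') * (1 + (norm x)\<^sup>2) ^ (N + N')" for x
  proof -
    have "C * (1 + (norm x)\<^sup>2) ^ N \<le> C * (1 + (norm x)\<^sup>2) ^ (N + N')"
      "C' * (1 + (norm x)\<^sup>2) ^ N' \<le> C' * (1 + (norm x)\<^sup>2) ^ (N + N')"
      using b by (auto intro!: mult_left_mono power_increasing)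
    then show ?thesis using b(2)[of x] b(4)[of x] by (simp add: distrib_right)
  qed
  then show ?case using b by (intro exI[of _ "C + C'"] exI[of _ "N + N'"]) auto
next
  case (mult f g)
  then obtain C N C' N' where b: "0 \<le> C" "\<And>x. \<bar>f x\<bar> \<le> C * (1 + (norm x)\<^sup>2) ^ N"
    "0 \<le> C'" "\<And>x. \<bar>g x\<bar> \<le> C' * (1 + (norm x)\<^sup>2) ^ N'" by auto
  have "\<bar>f x * g x\<bar> \<le> (C * C') * (1 + (norm x)\<^sup>2) ^ (N + N')" for x
    using mult_mono[OF b(2)[of x] b(4)[of x]] b by (simp add: abs_mult power_add mult_ac)
  then show ?case using b by (intro exI[of _ "C * C'"] exI[of _ "N + N'"]) auto
next
  case (exp_recip f k)
  show ?case by (intro exI[of _ "fact k"] exI[of _ 0]) (auto simp: exp_recip_le)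
qed

lemma bump_alg_dderiv:
  assumes "bump_alg f"
  shows "bump_alg (dderiv vs f)"
proof (induction vs)
  case (Cons v vs)
  then obtain D where D: "\<And>v. bump_alg (D v)" "\<And>x. (dderiv vs f has_derivative (\<lambda>v. D v x)) (at x)"
    using bump_alg_has_derivative by blast
  have "dderiv (v # vs) f = D v"
    using frechet_derivative_at[OF D(2)] by (auto simp: fun_eq_iff)
  then show ?case using D by simp
qed (use assms in simp)

lemma bump_alg_differentiable: "bump_alg f \<Longrightarrow> f differentiable (at x)"
  using bump_alg_has_derivative[of f] unfolding differentiable_def by blast

lemma has_derivative_zero_on_open:
  fixes f :: "'a::real_normed_vector \<Rightarrow> 'b::real_normed_vector"
  assumes "(f has_derivative D) (at x)" "open S" "x \<in> S" "\<And>y. y \<in> S \<Longrightarrow> f y = 0"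
  shows "D = (\<lambda>_. 0)"
proof -
  have "((\<lambda>_. 0) has_derivative D) (at x)"
    using assms(1) by (rule has_derivative_transform_within_open[OF _ assms(2,3)]) (use assms(4) in auto)
  then show ?thesis by (rule has_derivative_unique) simp
qed

lemma dderiv_zero_on_open:
  assumes f: "\<And>vs x. set vs \<subseteq> Basis \<Longrightarrow> dderiv vs f differentiable (at x)" 
    and S: "open S" "\<And>y. y \<in> S \<Longrightarrow> f y = 0"
    and vs: "set vs \<subseteq> Basis"
  shows "y \<in> S \<Longrightarrow> dderiv vs f y = 0"
  using vs
proof (induction vs arbitrary: y)
  case (Cons v vs)
  have "(dderiv vs f has_derivative frechet_derivative (dderiv vs f) (at y)) (at y)"
    using f[of vs y] Cons.prems by (simp add: frechet_derivative_works)
  then have "frechet_derivative (dderiv vs f) (at y) = (\<lambda>_. 0)"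
    by (rule has_derivative_zero_on_open[OF _ S(1)]) (use Cons in auto)
  then show ?case by simp
qed (use S in auto)

text \<open>Bounded derivatives of all orders form the class that is stable under convolution with
  an arbitrary integrable kernel and gives Taylor remainders uniform in the base point.\<close>

definition smooth_bounded :: "('a::euclidean_space \<Rightarrow> real) \<Rightarrow> bool" where
  "smooth_bounded f \<longleftrightarrow> smooth_fun f \<and> (\<forall>vs. set vs \<subseteq> Basis \<longrightarrow> bounded (range (dderiv vs f)))"

text \<open>All derivatives vanish on the open exterior of the ball of radius \<open>r\<close> and
  are continuous on the compact ball, hence are bounded.\<close>

lemma smooth_bounded_bump_alg:
  fixes f :: "'a::euclidean_space \<Rightarrow> real"
  assumes f: "bump_alg f" and z: "\<And>x. r \<le> norm x \<Longrightarrow> f x = 0"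
  shows "smooth_bounded f"
  unfolding smooth_bounded_def smooth_fun_def
proof (intro conjI allI impI)
  fix vs :: "'a list" assume vs: "set vs \<subseteq> Basis"
  show "dderiv vs f differentiable (at x)" for x
    by (intro bump_alg_differentiable bump_alg_dderiv f)
  have o: "open {x::'a. r < norm x}" by (intro open_Collect_less continuous_intros)
  have "dderiv vs f x = 0" if "r < norm x" for x
    by (rule dderiv_zero_on_open[OF _ o _ vs])
       (use that z in \<open>auto intro: bump_alg_differentiable bump_alg_dderiv f\<close>)
  then have "range (dderiv vs f) \<subseteq> insert 0 (dderiv vs f ` cball 0 r)"
    by (fastforce simp: not_less image_iff)
  moreover have "bounded (dderiv vs f ` cball 0 r)"
    by (intro compact_imp_bounded compact_continuous_image bump_alg_continuous_on bump_alg_dderiv f compact_cball)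
  ultimately show "bounded (range (dderiv vs f))"
    by (meson bounded_insert bounded_subset)
qed

section \<open>Uniform Taylor estimates and differentiation of convolutions\<close>

lemma frechet_derivative_sum_Basis:
  fixes f :: "'a::euclidean_space \<Rightarrow> real"
  assumes "f differentiable (at x)"
  shows "frechet_derivative f (at x) h = (\<Sum>b\<in>Basis. (h \<bullet> b) * frechet_derivative f (at x) b)"
proof -
  interpret linear "frechet_derivative f (at x)"
    using assms by (rule linear_frechet_derivative)
  have "frechet_derivative f (at x) h = frechet_derivative f (at x) (\<Sum>b\<in>Basis. (h \<bullet> b) *\<^sub>R b)"
    by (simp add: euclidean_representation)
  also have "\<dots> = (\<Sum>b\<in>Basis. (h \<bullet> b) * frechet_derivative f (at x) b)"
    by (simp only: sum scale real_scaleR_def)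
  finally show ?thesis .
qed

lemma mvt_segment:
  fixes f :: "'a::euclidean_space \<Rightarrow> real"
  assumes f: "\<And>x. f differentiable (at x)"
  shows "\<exists>t\<in>{0..1}. f (z + h) - f z = frechet_derivative f (at (z + t *\<^sub>R h)) h"
proof -
  have "((\<lambda>t. f (z + t *\<^sub>R h)) has_derivative (\<lambda>r. frechet_derivative f (at (z + t *\<^sub>R h)) (r *\<^sub>R h))) (at t within {0..1})" for t :: real
  proof (rule has_derivative_compose[of "\<lambda>t. z + t *\<^sub>R h" "\<lambda>r. r *\<^sub>R h"])
    show "((\<lambda>t. z + t *\<^sub>R h) has_derivative (\<lambda>r. r *\<^sub>R h)) (at t within {0..1})"
      by (auto intro!: derivative_eq_intros)
    show "(f has_derivative frechet_derivative f (at (z + t *\<^sub>R h))) (at (z + t *\<^sub>R h))"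
      using f frechet_derivative_works by blast
  qed
  then have "\<exists>t\<in>{0..1}. f (z + 1 *\<^sub>R h) - f (z + 0 *\<^sub>R h) = frechet_derivative f (at (z + t *\<^sub>R h)) ((1 - 0) *\<^sub>R h)"
    by (intro mvt_very_simple) auto
  then show ?thesis by simp
qed

lemma lipschitz_of_bounded_partials:
  fixes f :: "'a::euclidean_space \<Rightarrow> real" and M :: real
  assumes f: "\<And>x. f differentiable (at x)" and M: "\<And>x b. b \<in> Basis \<Longrightarrow> \<bar>frechet_derivative f (at x) b\<bar> \<le> M"
  shows "\<bar>f (z + h) - f z\<bar> \<le> DIM('a) * M * norm h"
proof -
  obtain t where "f (z + h) - f z = frechet_derivative f (at (z + t *\<^sub>R h)) h"
    using mvt_segment[OF f, of z h] by auto
  also have "\<dots> = (\<Sum>b\<in>Basis. (h \<bullet> b) * frechet_derivative f (at (z + t *\<^sub>R h)) b)"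
    by (rule frechet_derivative_sum_Basis[OF f])
  also have "\<bar>\<dots>\<bar> \<le> (\<Sum>b\<in>(Basis::'a set). norm h * M)"
    by (intro order_trans[OF sum_abs] sum_mono)
       (auto simp: abs_mult intro!: mult_mono M Basis_le_norm)
  finally show ?thesis by (simp add: mult_ac)
qed

lemma dderiv_append: "dderiv (vs @ ws) f = dderiv vs (dderiv ws f)"
  by (induction vs) auto

lemma smooth_bounded_dderiv:
  assumes "smooth_bounded f" "set ws \<subseteq> Basis"
  shows "smooth_bounded (dderiv ws f)"
  using assms by (simp add: smooth_bounded_def smooth_fun_def flip: dderiv_append)

lemma smooth_bounded_differentiable: "smooth_bounded f \<Longrightarrow> f differentiable (at x)"
  unfolding smooth_bounded_def smooth_fun_def by (metis dderiv.simps(1) empty_set empty_subsetI)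

lemma smooth_bounded_continuous_on: "smooth_bounded f \<Longrightarrow> continuous_on A f"
  by (meson continuous_at_imp_continuous_on differentiable_imp_continuous_within smooth_bounded_differentiable)

lemma borel_measurable_smooth_bounded: "smooth_bounded f \<Longrightarrow> f \<in> borel_measurable borel"
  by (intro borel_measurable_continuous_onI smooth_bounded_continuous_on)

lemma smooth_bounded_bound:
  assumes "smooth_bounded f"
  obtains B where "0 \<le> B" "\<And>x. \<bar>f x\<bar> \<le> B"
proof -
  have "bounded (range (dderiv [] f))"
    using assms by (simp add: smooth_bounded_def del: dderiv.simps)
  then obtain B where "\<And>x. \<bar>f x\<bar> \<le> B" by (auto simp: bounded_iff)
  moreover then have "0 \<le> B" by (meson abs_ge_zero order_trans)
  ultimately show ?thesis using that by blast
qed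

lemma smooth_bounded_partials_bound:
  fixes f :: "'a::euclidean_space \<Rightarrow> real"
  assumes f: "smooth_bounded f"
  obtains M where "0 \<le> M" "\<And>x b. b \<in> Basis \<Longrightarrow> \<bar>frechet_derivative f (at x) b\<bar> \<le> M"
proof -
  have "\<forall>b\<in>Basis. \<exists>B\<ge>0. \<forall>x. \<bar>dderiv [b] f x\<bar> \<le> B"
    by (metis smooth_bounded_bound smooth_bounded_dderiv[OF f] empty_set insert_subset list.simps(15) empty_subsetI)
  then obtain B where B: "\<And>b. b \<in> Basis \<Longrightarrow> 0 \<le> B b" "\<And>b x. b \<in> Basis \<Longrightarrow> \<bar>dderiv [b] f x\<bar> \<le> B b"
    by metis
  have "\<bar>frechet_derivative f (at x) b\<bar> \<le> sum B Basis" if "b \<in> Basis" for x and b :: 'a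
    using B(2)[OF that, of x] member_le_sum[of b Basis B] that B(1) by simp
  then show ?thesis using that[of "sum B Basis"] B(1) by (simp add: sum_nonneg)
qed

lemma smooth_bounded_lipschitz:
  fixes f :: "'a::euclidean_space \<Rightarrow> real"
  assumes f: "smooth_bounded f"
  obtains L where "0 \<le> L" "\<And>z h. \<bar>f (z + h) - f z\<bar> \<le> L * norm h"
proof -
  obtain M where M: "0 \<le> M" "\<And>x b. b \<in> Basis \<Longrightarrow> \<bar>frechet_derivative f (at x) b\<bar> \<le> M"
    using smooth_bounded_partials_bound[OF f] by blast
  show ?thesis
    by (rule that[of "DIM('a) * M"])
       (use M lipschitz_of_bounded_partials[OF smooth_bounded_differentiable[OF f]] in auto)
qed

text \<open>The mean value theorem on the segment from \<open>z\<close> to \<open>z + h\<close>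
  leaves only increments of first partial derivatives, which are Lipschitz. That \<open>C\<close>
  does not depend on \<open>z\<close> is the point, since \<open>z\<close> becomes an integration
  variable.\<close>

lemma smooth_bounded_taylor:
  fixes f :: "'a::euclidean_space \<Rightarrow> real"
  assumes f: "smooth_bounded f"
  obtains C where "0 \<le> C" "\<And>z h. \<bar>f (z + h) - f z - (\<Sum>b\<in>Basis. (h \<bullet> b) * dderiv [b] f z)\<bar> \<le> C * (norm h)\<^sup>2"
proof -
  have "\<forall>b\<in>Basis. \<exists>L\<ge>0. \<forall>z h. \<bar>dderiv [b] f (z + h) - dderiv [b] f z\<bar> \<le> L * norm h"
  proof
    fix b :: 'a assume "b \<in> Basis"
    then have "smooth_bounded (dderiv [b] f)" by (intro smooth_bounded_dderiv f) simp
    then show "\<exists>L\<ge>0. \<forall>z h. \<bar>dderiv [b] f (z + h) - dderiv [b] f z\<bar> \<le> L * norm h"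
      by (rule smooth_bounded_lipschitz) blast
  qed
  then obtain L where L: "\<And>b. b \<in> Basis \<Longrightarrow> 0 \<le> L b"
    "\<And>b z h. b \<in> Basis \<Longrightarrow> \<bar>dderiv [b] f (z + h) - dderiv [b] f z\<bar> \<le> L b * norm h"
    by metis
  have "\<bar>f (z + h) - f z - (\<Sum>b\<in>Basis. (h \<bullet> b) * dderiv [b] f z)\<bar> \<le> sum L Basis * (norm h)\<^sup>2" for z h
  proof -
    obtain t where t: "0 \<le> t" "t \<le> 1" "f (z + h) - f z = frechet_derivative f (at (z + t *\<^sub>R h)) h"
      using mvt_segment[OF smooth_bounded_differentiable[OF f], of z h] by auto
    have "f (z + h) - f z = (\<Sum>b\<in>Basis. (h \<bullet> b) * dderiv [b] f (z + t *\<^sub>R h))"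
      unfolding t(3) by (subst frechet_derivative_sum_Basis[OF smooth_bounded_differentiable[OF f]]) simp
    then have "f (z + h) - f z - (\<Sum>b\<in>Basis. (h \<bullet> b) * dderiv [b] f z)
        = (\<Sum>b\<in>Basis. (h \<bullet> b) * (dderiv [b] f (z + t *\<^sub>R h) - dderiv [b] f z))"
      by (simp only: right_diff_distrib sum_subtractf)
    also have "\<bar>\<dots>\<bar> \<le> (\<Sum>b\<in>Basis. norm h * (L b * norm h))"
    proof (intro order_trans[OF sum_abs] sum_mono)
      fix b :: 'a assume b: "b \<in> Basis"
      have "L b * norm (t *\<^sub>R h) \<le> L b * norm h"
        using t L(1)[OF b] by (intro mult_left_mono) (auto simp: mult_left_le_one_le)
      then have "\<bar>dderiv [b] f (z + t *\<^sub>R h) - dderiv [b] f z\<bar> \<le> L b * norm h"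
        using L(2)[OF b, of z "t *\<^sub>R h"] by linarith
      then show "\<bar>(h \<bullet> b) * (dderiv [b] f (z + t *\<^sub>R h) - dderiv [b] f z)\<bar> \<le> norm h * (L b * norm h)"
        unfolding abs_mult by (intro mult_mono Basis_le_norm b) auto
    qed
    also have "\<dots> = sum L Basis * (norm h)\<^sup>2"
      by (simp add: sum_distrib_right sum_distrib_left power2_eq_square mult_ac)
    finally show ?thesis .
  qed
  then show ?thesis using that[of "sum L Basis"] L(1) by (simp add: sum_nonneg)
qed

lemma conv_eq_reflected:
  fixes f g :: "'a::euclidean_space \<Rightarrow> real"
  assumes [measurable]: "f \<in> borel_measurable borel" "g \<in> borel_measurable borel"
  shows "conv f g x = (LBINT y. f y * g (x - y))"
  using integral_lborel_reflect[of "\<lambda>y. f (x - y) * g y" x] by (simp add: conv_borel)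

lemma integrable_mult_bounded:
  fixes f g :: "'a::euclidean_space \<Rightarrow> real"
  assumes f: "integrable lborel f" and [measurable]: "g \<in> borel_measurable borel"
    and B: "\<And>x. \<bar>g x\<bar> \<le> B"
  shows "integrable lborel (\<lambda>x. f x * g x)"
proof (rule Bochner_Integration.integrable_bound)
  show "integrable lborel (\<lambda>x. B * f x)" using f by simp
  have "0 \<le> B" using B[of 0] by linarith
  then show "AE x in lborel. norm (f x * g x) \<le> norm (B * f x)"
    using mult_right_mono[OF B abs_ge_zero] by (intro AE_I2) (simp add: abs_mult mult.commute)
qed (use f in measurable)

lemma abs_conv_le:
  fixes K f :: "'a::euclidean_space \<Rightarrow> real"
  assumes K: "integrable lborel K" and [measurable]: "f \<in> borel_measurable borel"
    and B: "\<And>x. \<bar>f x\<bar> \<le> B"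
  shows "\<bar>conv K f x\<bar> \<le> (LBINT x. \<bar>K x\<bar>) * B"
proof -
  note [measurable] = K
  have "\<bar>conv K f x\<bar> \<le> (LBINT y. \<bar>K y * f (x - y)\<bar>)"
    using integral_abs_bound[of lborel "\<lambda>y. K y * f (x - y)"] by (simp add: conv_eq_reflected)
  also have "\<dots> \<le> (LBINT y. \<bar>K y\<bar> * B)"
  proof (rule integral_mono)
    show "integrable lborel (\<lambda>y. \<bar>K y * f (x - y)\<bar>)"
      by (intro integrable_abs integrable_mult_bounded[OF K _ B]) measurable
    show "\<bar>K y * f (x - y)\<bar> \<le> \<bar>K y\<bar> * B" for y
      unfolding abs_mult by (intro mult_left_mono B) simp
  qed (use K in simp)
  finally show ?thesis by simp
qed

text \<open>Integrating the uniform Taylor remainder of \<open>f\<close> against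
  \<open>\<bar>K\<bar>\<close> gives a remainder of size \<open>(norm h)\<^sup>2\<close>; no limit
  is taken under the integral and \<open>K\<close> is merely integrable.\<close>

lemma has_derivative_conv:
  fixes K f :: "'a::euclidean_space \<Rightarrow> real"
  assumes K: "integrable lborel K" and f: "smooth_bounded f"
  shows "(conv K f has_derivative (\<lambda>h. \<Sum>b\<in>Basis. (h \<bullet> b) * conv K (dderiv [b] f) x)) (at x)"
proof -
  have [measurable]: "K \<in> borel_measurable borel" using K by auto
  have [measurable]: "f \<in> borel_measurable borel" using f by (rule borel_measurable_smooth_bounded)
  have fb: "smooth_bounded (dderiv [b] f)" if "b \<in> Basis" for b
    using smooth_bounded_dderiv[OF f, of "[b]"] that by simp
  have mb: "dderiv [b] f \<in> borel_measurable borel" if "b \<in> Basis" for b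
    using fb[OF that] by (rule borel_measurable_smooth_bounded)
  obtain C where C: "0 \<le> C" "\<And>z h. \<bar>f (z + h) - f z - (\<Sum>b\<in>Basis. (h \<bullet> b) * dderiv [b] f z)\<bar> \<le> C * (norm h)\<^sup>2"
    using smooth_bounded_taylor[OF f] by blast
  obtain B where B: "\<And>x. \<bar>f x\<bar> \<le> B" using smooth_bounded_bound[OF f] by blast
  have i: "integrable lborel (\<lambda>y. K y * f (z - y))" for z
    by (rule integrable_mult_bounded[OF K]) (use B in auto)
  have ib: "integrable lborel (\<lambda>y. K y * dderiv [b] f (z - y))" if b: "b \<in> Basis" for b z
  proof -
    obtain B where B: "\<And>x. \<bar>dderiv [b] f x\<bar> \<le> B" using smooth_bounded_bound[OF fb[OF b]] by blast
    have [measurable]: "dderiv [b] f \<in> borel_measurable borel" using mb[OF b] .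
    show ?thesis by (rule integrable_mult_bounded[OF K _ B]) measurable
  qed
  define A where "A = (LBINT y. \<bar>K y\<bar>)"
  have bd: "\<bar>conv K f (x + h) - conv K f x - (\<Sum>b\<in>Basis. (h \<bullet> b) * conv K (dderiv [b] f) x)\<bar> \<le> A * C * (norm h)\<^sup>2" for h
  proof -
    let ?R = "\<lambda>y. K y * (f (x - y + h) - f (x - y) - (\<Sum>b\<in>Basis. (h \<bullet> b) * dderiv [b] f (x - y)))"
    have Req: "?R y = K y * f ((x + h) - y) - K y * f (x - y) - (\<Sum>b\<in>Basis. (h \<bullet> b) * (K y * dderiv [b] f (x - y)))" for y
      by (simp add: right_diff_distrib sum_distrib_left algebra_simps)
    have isum: "integrable lborel (\<lambda>y. \<Sum>b\<in>Basis. (h \<bullet> b) * (K y * dderiv [b] f (x - y)))"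
      by (intro Bochner_Integration.integrable_sum integrable_mult_right ib)
    have iR: "integrable lborel ?R"
      unfolding Req by (intro Bochner_Integration.integrable_diff i isum)
    have "(LBINT y. ?R y) = conv K f (x + h) - conv K f x - (\<Sum>b\<in>Basis. (h \<bullet> b) * conv K (dderiv [b] f) x)"
    proof -
      have "(LBINT y. ?R y) = (LBINT y. K y * f ((x + h) - y)) - (LBINT y. K y * f (x - y))
          - (LBINT y. (\<Sum>b\<in>Basis. (h \<bullet> b) * (K y * dderiv [b] f (x - y))))"
        unfolding Req
          by (subst Bochner_Integration.integral_diff[OF Bochner_Integration.integrable_diff[OF i i] isum],
              subst Bochner_Integration.integral_diff[OF i i]) (rule refl)
      also have "(LBINT y. (\<Sum>b\<in>Basis. (h \<bullet> b) * (K y * dderiv [b] f (x - y))))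
          = (\<Sum>b\<in>Basis. \<integral>y. (h \<bullet> b) * (K y * dderiv [b] f (x - y)) \<partial>lborel)"
        by (intro Bochner_Integration.integral_sum integrable_mult_right ib)
      also have "\<dots> = (\<Sum>b\<in>Basis. (h \<bullet> b) * conv K (dderiv [b] f) x)"
        by (intro sum.cong refl) (simp only: integral_mult_right_zero conv_eq_reflected[OF \<open>K \<in> borel_measurable borel\<close> mb])
      finally show ?thesis by (simp add: conv_eq_reflected)
    qed
    then have "\<bar>conv K f (x + h) - conv K f x - (\<Sum>b\<in>Basis. (h \<bullet> b) * conv K (dderiv [b] f) x)\<bar> \<le> (LBINT y. \<bar>?R y\<bar>)"
      using integral_abs_bound[of lborel ?R] by simp
    also have "\<dots> \<le> (LBINT y. \<bar>K y\<bar> * (C * (norm h)\<^sup>2))"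
    proof (rule integral_mono)
      show "integrable lborel (\<lambda>y. \<bar>?R y\<bar>)" using iR by (rule integrable_abs)
      show "integrable lborel (\<lambda>y. \<bar>K y\<bar> * (C * (norm h)\<^sup>2))" using K by simp
      show "\<bar>?R y\<bar> \<le> \<bar>K y\<bar> * (C * (norm h)\<^sup>2)" for y
        unfolding abs_mult by (intro mult_left_mono C) simp
    qed
    also have "\<dots> = A * C * (norm h)\<^sup>2" by (simp add: A_def)
    finally show ?thesis .
  qed
  show ?thesis
    unfolding has_derivative_at
  proof (intro conjI)
    show "bounded_linear (\<lambda>h. \<Sum>b\<in>Basis. (h \<bullet> b) * conv K (dderiv [b] f) x)"
      by (intro bounded_linear_sum bounded_linear_mult_const bounded_linear_inner_left)
    show "(\<lambda>h. norm (conv K f (x + h) - conv K f x - (\<Sum>b\<in>Basis. (h \<bullet> b) * conv K (dderiv [b] f) x)) / norm h) \<midarrow>0\<rightarrow> 0"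
    proof (rule Lim_null_comparison)
      show "\<forall>\<^sub>F h in at 0. norm (norm (conv K f (x + h) - conv K f x - (\<Sum>b\<in>Basis. (h \<bullet> b) * conv K (dderiv [b] f) x)) / norm h) \<le> A * C * norm h"
      proof (intro always_eventually allI)
        fix h :: 'a
        have "A * C * (norm h)\<^sup>2 / norm h = A * C * norm h" by (simp add: power2_eq_square)
        with divide_right_mono[OF bd[of h] norm_ge_zero[of h]]
        show "norm (norm (conv K f (x + h) - conv K f x - (\<Sum>b\<in>Basis. (h \<bullet> b) * conv K (dderiv [b] f) x)) / norm h) \<le> A * C * norm h"
          by (simp only: real_norm_def abs_divide abs_idempotent abs_norm_cancel)
      qed
      have "((\<lambda>h::'a. A * C * norm h) \<longlongrightarrow> A * C * norm (0::'a)) (at 0)" by (intro tendsto_intros)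
      then show "((\<lambda>h::'a. A * C * norm h) \<longlongrightarrow> 0) (at 0)" by simp
    qed
  qed
qed

lemma dderiv_conv:
  fixes K f :: "'a::euclidean_space \<Rightarrow> real"
  assumes K: "integrable lborel K" and f: "smooth_bounded f" and vs: "set vs \<subseteq> Basis"
  shows "dderiv vs (conv K f) = conv K (dderiv vs f)"
  using vs
proof (induction vs)
  case (Cons v vs)
  have "smooth_bounded (dderiv vs f)" using Cons.prems f by (intro smooth_bounded_dderiv) auto
  note D = frechet_derivative_at[OF has_derivative_conv[OF K this], symmetric]
  have "dderiv (v # vs) (conv K f) = (\<lambda>x. frechet_derivative (conv K (dderiv vs f)) (at x) v)"
    using Cons by simp
  also have "\<dots> = (\<lambda>x. \<Sum>b\<in>Basis. (v \<bullet> b) * conv K (dderiv [b] (dderiv vs f)) x)"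
    by (simp only: D)
  also have "\<dots> = (\<lambda>x. \<Sum>b\<in>Basis. if b = v then conv K (dderiv [b] (dderiv vs f)) x else 0)"
    using Cons.prems by (intro ext sum.cong) (auto simp: inner_Basis)
  also have "\<dots> = conv K (dderiv (v # vs) f)"
    using Cons.prems by (simp add: fun_eq_iff)
  finally show ?case .
qed simp

lemma smooth_bounded_conv:
  fixes K f :: "'a::euclidean_space \<Rightarrow> real"
  assumes K: "integrable lborel K" and f: "smooth_bounded f"
  shows "smooth_bounded (conv K f)"
  unfolding smooth_bounded_def smooth_fun_def
proof (intro conjI allI impI)
  fix vs :: "'a list" assume vs: "set vs \<subseteq> Basis"
  note s = smooth_bounded_dderiv[OF f vs]
  show "dderiv vs (conv K f) differentiable (at x)" for x
    unfolding dderiv_conv[OF K f vs] differentiable_def using has_derivative_conv[OF K s] by blast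
  obtain B where "\<And>x. \<bar>dderiv vs f x\<bar> \<le> B" using smooth_bounded_bound[OF s] by blast
  then have "\<bar>dderiv vs (conv K f) x\<bar> \<le> (LBINT x. \<bar>K x\<bar>) * B" for x
    unfolding dderiv_conv[OF K f vs]
    by (intro abs_conv_le K borel_measurable_smooth_bounded s)
  then show "bounded (range (dderiv vs (conv K f)))"
    by (auto simp: bounded_iff)
qed

section \<open>Fourier inversion and mollifiers\<close>

lemma exp_heat_fourier:
  fixes z :: "'a::euclidean_space"
  assumes t: "0 < t"
  shows "integrable lborel (\<lambda>\<xi>::'a. exp (- (4 * pi\<^sup>2 * t * (norm \<xi>)\<^sup>2)))"
    and "(LBINT \<xi>. complex_of_real (exp (- (4 * pi\<^sup>2 * t * (norm \<xi>)\<^sup>2))) * char_pos z \<xi>) = complex_of_real (heat_kernel t z)"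
proof -
  \<comment> \<open>The dual time: the Gaussian in \<xi> is a multiple of the heat kernel at
    \<open>\<tau>\<close>, and \<open>4 * pi * \<tau>\<close> is the inverse of
    \<open>4 * pi * t\<close>, so that the two normalisations cancel.\<close>
  define \<tau> where "\<tau> = 1 / (16 * pi\<^sup>2 * t)"
  have \<tau>: "0 < \<tau>" using t by (simp add: \<tau>_def)
  let ?c = "(4 * pi * t) powr (- (DIM('a) / 2))"
  have c: "(4 * pi * \<tau>) powr (- (DIM('a) / 2)) * ?c = 1"
  proof -
    have "4 * pi * \<tau> = inverse (4 * pi * t)" using t by (simp add: \<tau>_def field_simps power2_eq_square)
    then have "(4 * pi * \<tau>) powr (- (DIM('a) / 2)) = inverse ?c"
      using t by (simp only: powr_minus powr_divide inverse_eq_divide) (simp add: powr_divide)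
    then show ?thesis using t by simp
  qed
  have eq: "exp (- (4 * pi\<^sup>2 * t * (norm \<xi>)\<^sup>2)) = ?c * heat_kernel \<tau> \<xi>" for \<xi> :: 'a
  proof -
    have "(norm \<xi>)\<^sup>2 / (4 * \<tau>) = 4 * pi\<^sup>2 * t * (norm \<xi>)\<^sup>2" using t by (simp add: \<tau>_def)
    then have "heat_kernel \<tau> \<xi> = (4 * pi * \<tau>) powr (- (DIM('a) / 2)) * exp (- (4 * pi\<^sup>2 * t * (norm \<xi>)\<^sup>2))"
      by (simp only: heat_kernel_def)
    then have "?c * heat_kernel \<tau> \<xi> = ((4 * pi * \<tau>) powr (- (DIM('a) / 2)) * ?c) * exp (- (4 * pi\<^sup>2 * t * (norm \<xi>)\<^sup>2))"
      by (simp only: mult_ac)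
    then show ?thesis by (simp only: c mult_1)
  qed
  show "integrable lborel (\<lambda>\<xi>::'a. exp (- (4 * pi\<^sup>2 * t * (norm \<xi>)\<^sup>2)))"
    unfolding eq by (intro integrable_mult_right integrable_heat_kernel \<tau>)
  have "(LBINT \<xi>. complex_of_real (exp (- (4 * pi\<^sup>2 * t * (norm \<xi>)\<^sup>2))) * char_pos z \<xi>)
      = (LBINT \<xi>. complex_of_real ?c * (complex_of_real (heat_kernel \<tau> \<xi>) * char_neg \<xi> (- z)))"
    unfolding eq by (simp add: inner_commute mult.assoc)
  also have "\<dots> = complex_of_real ?c * complex_of_real (exp (- (4 * pi\<^sup>2 * \<tau> * (norm (- z))\<^sup>2)))"
    by (simp only: integral_mult_right_zero integral_heat_kernel_exp[OF \<tau>])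
  also have "\<dots> = complex_of_real (heat_kernel t z)"
    using t by (simp add: heat_kernel_def \<tau>_def)
  finally show "(LBINT \<xi>. complex_of_real (exp (- (4 * pi\<^sup>2 * t * (norm \<xi>)\<^sup>2))) * char_pos z \<xi>) = complex_of_real (heat_kernel t z)" .
qed

text \<open>The Gaussian factor makes the double integral absolutely convergent for any integrable
  \<open>f\<close>; the \<xi>-integral is then the inverse transform of a Gaussian.\<close>

lemma heat_fourier_inversion:
  fixes f :: "'a::euclidean_space \<Rightarrow> real"
  assumes f: "integrable lborel f" and t: "0 < t"
  shows "(LBINT \<xi>. complex_of_real (exp (- (4 * pi\<^sup>2 * t * (norm \<xi>)\<^sup>2))) * fourier f \<xi> * char_pos x \<xi>)
    = complex_of_real (conv (heat_kernel t) f x)"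
proof -
  have [measurable]: "f \<in> borel_measurable borel" using f by auto
  let ?g = "\<lambda>\<xi>::'a. exp (- (4 * pi\<^sup>2 * t * (norm \<xi>)\<^sup>2))"
  let ?F = "\<lambda>\<xi> y. complex_of_real (?g \<xi>) * (complex_of_real (f y) * char_neg y \<xi>) * char_pos x \<xi>"
  have p0: "integrable (lborel \<Otimes>\<^sub>M lborel) (\<lambda>(\<xi>::'a, y). ?g \<xi> * f y)"
  proof (rule lborel_pair.Fubini_integrable)
    show "integrable lborel (\<lambda>\<xi>::'a. \<integral>y. norm (case (\<xi>, y) of (\<xi>, y) \<Rightarrow> ?g \<xi> * f y) \<partial>lborel)"
      using exp_heat_fourier(1)[OF t, where 'a = 'a] by (simp add: abs_mult)
  qed (use f in auto)
  have p: "integrable (lborel \<Otimes>\<^sub>M lborel) (\<lambda>(\<xi>, y). ?F \<xi> y)"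
    by (rule Bochner_Integration.integrable_bound[OF p0]) (auto simp: norm_mult)
  have "(LBINT \<xi>. complex_of_real (?g \<xi>) * fourier f \<xi> * char_pos x \<xi>)
      = (LBINT \<xi>. (LBINT y. ?F \<xi> y))"
    by (simp only: integral_mult_left_zero integral_mult_right_zero fourier_borel \<open>f \<in> borel_measurable borel\<close>)
  also have "\<dots> = (LBINT y. (LBINT \<xi>. ?F \<xi> y))"
    by (rule lborel_pair.Fubini_integral[OF p, symmetric])
  also have "\<dots> = (LBINT y. complex_of_real (heat_kernel t (x - y) * f y))"
  proof (rule Bochner_Integration.integral_cong[OF refl])
    fix y
    have "?F \<xi> y = complex_of_real (f y) * (complex_of_real (?g \<xi>) * char_pos (x - y) \<xi>)" for \<xi>
    proof -
      have "char_pos (x - y) \<xi> = char_neg y \<xi> * char_pos x \<xi>"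
        unfolding exp_add[symmetric] by (simp add: inner_diff_left algebra_simps)
      then show ?thesis by (simp only: mult_ac)
    qed
    then have "(LBINT \<xi>. ?F \<xi> y) = complex_of_real (f y) * complex_of_real (heat_kernel t (x - y))"
      by (simp only: integral_mult_right_zero exp_heat_fourier(2)[OF t])
    then show "(LBINT \<xi>. ?F \<xi> y) = complex_of_real (heat_kernel t (x - y) * f y)"
      by (simp add: mult.commute)
  qed
  also have "\<dots> = complex_of_real (conv (heat_kernel t) f x)"
    by (subst integral_complex_of_real) (simp add: conv_borel)
  finally show ?thesis .
qed

text \<open>\<open>f\<close> is Lipschitz and the heat kernel at time \<open>t\<close> has first
  absolute moment of order \<open>sqrt t\<close>, which gives an explicit rate of
  convergence.\<close>

lemma conv_heat_kernel_tendsto: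
  fixes f :: "'a::euclidean_space \<Rightarrow> real"
  assumes f: "smooth_bounded f"
  shows "(\<lambda>n. conv (heat_kernel (1 / real (Suc n))) f x) \<longlonglongrightarrow> f x"
proof -
  have [measurable]: "f \<in> borel_measurable borel" using f by (rule borel_measurable_smooth_bounded)
  obtain L where L: "0 \<le> L" "\<And>z h. \<bar>f (z + h) - f z\<bar> \<le> L * norm h" by (rule smooth_bounded_lipschitz[OF f]) blast
  obtain B where B: "\<And>x. \<bar>f x\<bar> \<le> B" by (rule smooth_bounded_bound[OF f]) blast
  define D where "D = 8 ^ 1 * fact 1 * 2 powr (DIM('a) / 2)"
  have bd: "\<bar>conv (heat_kernel t) f x - f x\<bar> \<le> L * (1 + D) * sqrt t" if t: "0 < t" for t
  proof -
    let ?p = "heat_kernel t :: 'a \<Rightarrow> real"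
    have ip: "integrable lborel ?p" and ip2: "integrable lborel (heat_kernel (2 * t) :: 'a \<Rightarrow> real)"
      using t by (auto intro: integrable_heat_kernel)
    have i1: "integrable lborel (\<lambda>y. ?p y * f (x - y))"
      by (rule integrable_mult_bounded[OF ip _ B]) measurable
    have i2: "integrable lborel (\<lambda>y. ?p y * f x)" using ip by simp
    have "conv ?p f x - f x = (LBINT y. ?p y * f (x - y)) - (LBINT y. ?p y * f x)"
      using t by (simp add: conv_eq_reflected integral_heat_kernel)
    also have "\<dots> = (LBINT y. ?p y * f (x - y) - ?p y * f x)"
      using i1 i2 by simp
    finally have "\<bar>conv ?p f x - f x\<bar> \<le> (LBINT y. \<bar>?p y * f (x - y) - ?p y * f x\<bar>)"
      using integral_abs_bound by metis
    also have "\<dots> \<le> (LBINT y. L * (sqrt t * ?p y + D * sqrt t * heat_kernel (2 * t) y))"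
    proof (rule integral_mono)
      show "integrable lborel (\<lambda>y. \<bar>?p y * f (x - y) - ?p y * f x\<bar>)" using i1 i2 by simp
      show "integrable lborel (\<lambda>y. L * (sqrt t * ?p y + D * sqrt t * heat_kernel (2 * t) y))" using ip ip2 by simp
      fix y :: 'a
      \<comment> \<open>Only even moments are covered by \<open>heat_kernel_moment\<close>; this
        inequality replaces the first moment by the zeroth and the second, balanced at scale
        \<open>sqrt t\<close>.\<close>
      have n: "norm y \<le> sqrt t + (norm y)\<^sup>2 / sqrt t"
      proof (cases "norm y \<le> sqrt t")
        case False
        then have "norm y * sqrt t \<le> norm y * norm y" using t by (intro mult_left_mono) auto
        then have "norm y \<le> (norm y)\<^sup>2 / sqrt t" using t by (simp add: field_simps power2_eq_square)
        then show ?thesis using t by (simp add: add_increasing)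
      qed (use t in \<open>simp add: add_increasing2\<close>)
      have "norm y * ?p y \<le> (sqrt t + (norm y)\<^sup>2 / sqrt t) * ?p y"
        by (rule mult_right_mono[OF n]) simp
      also have "\<dots> = sqrt t * ?p y + (((norm y)\<^sup>2) ^ 1 * ?p y) / sqrt t" by (simp add: algebra_simps)
      also have "\<dots> \<le> sqrt t * ?p y + (D * t ^ 1 * heat_kernel (2 * t) y) / sqrt t"
        unfolding D_def using t heat_kernel_moment[OF t, of y 1] by (intro add_left_mono divide_right_mono) auto
      also have "\<dots> = sqrt t * ?p y + D * sqrt t * heat_kernel (2 * t) y"
        using t by (simp add: field_simps flip: power2_eq_square)
      finally have *: "norm y * ?p y \<le> sqrt t * ?p y + D * sqrt t * heat_kernel (2 * t) y" .
      have "\<bar>?p y * f (x - y) - ?p y * f x\<bar> = ?p y * \<bar>f (x + - y) - f x\<bar>"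
        by (simp add: abs_mult flip: right_diff_distrib)
      also have "\<dots> \<le> ?p y * (L * norm (- y))" by (intro mult_left_mono L) simp
      also have "\<dots> = L * (norm y * ?p y)" by simp
      also have "\<dots> \<le> L * (sqrt t * ?p y + D * sqrt t * heat_kernel (2 * t) y)"
        by (rule mult_left_mono[OF * L(1)])
      finally show "\<bar>?p y * f (x - y) - ?p y * f x\<bar> \<le> L * (sqrt t * ?p y + D * sqrt t * heat_kernel (2 * t) y)" .
    qed
    also have "\<dots> = L * (1 + D) * sqrt t"
      using ip ip2 t by (simp add: integral_heat_kernel algebra_simps)
    finally show ?thesis .
  qed
  have "(\<lambda>n. conv (heat_kernel (1 / real (Suc n))) f x - f x) \<longlonglongrightarrow> 0"
  proof (rule Lim_null_comparison)
    show "\<forall>\<^sub>F n in sequentially. norm (conv (heat_kernel (1 / real (Suc n))) f x - f x) \<le> L * (1 + D) * sqrt (1 / real (Suc n))"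
      using bd by (intro always_eventually allI) simp
    have "(\<lambda>n. L * (1 + D) * sqrt (1 / real (Suc n))) \<longlonglongrightarrow> L * (1 + D) * sqrt 0"
      by (intro tendsto_intros LIMSEQ_Suc lim_1_over_n)
    then show "(\<lambda>n. L * (1 + D) * sqrt (1 / real (Suc n))) \<longlonglongrightarrow> 0" by simp
  qed
  then show ?thesis by (simp add: LIM_zero_iff)
qed

text \<open>Inversion at the origin, regularised by Gaussians, and monotone convergence show that a nonnegative
  transform is integrable. Mollifiers \<open>\<beta> * \<beta>\<close> with \<open>\<beta>\<close> even have this property, so no decay estimate for
  transforms of test functions is required.\<close>

lemma
  fixes f :: "'a::euclidean_space \<Rightarrow> real"
  assumes fi: "integrable lborel f" and f: "smooth_bounded f"
    and r: "\<And>\<xi>. 0 \<le> r \<xi>" "\<And>\<xi>. fourier f \<xi> = complex_of_real (r \<xi>)"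
  shows integrable_fourier_nonneg: "integrable lborel (fourier f)"
    and fourier_inversion_nonneg: "(LBINT \<xi>. fourier f \<xi> * char_pos x \<xi>) = complex_of_real (f x)"
proof -
  note [measurable] = fi
  have req: "r = (\<lambda>\<xi>. Re (fourier f \<xi>))" using r(2) by (simp add: fun_eq_iff)
  have [measurable]: "r \<in> borel_measurable borel" unfolding req by measurable
  define g where "g = (\<lambda>n \<xi>::'a. exp (- (4 * pi\<^sup>2 * (1 / real (Suc n)) * (norm \<xi>)\<^sup>2)))"
  have [measurable]: "g n \<in> borel_measurable borel" for n unfolding g_def by measurable
  have g1: "0 \<le> g n \<xi>" "g n \<xi> \<le> 1" for n \<xi> by (auto simp: g_def)
  have glim: "(\<lambda>n. g n \<xi>) \<longlonglongrightarrow> 1" for \<xi>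
  proof -
    have "(\<lambda>n. g n \<xi>) \<longlonglongrightarrow> exp (- (4 * pi\<^sup>2 * 0 * (norm \<xi>)\<^sup>2))"
      unfolding g_def by (intro tendsto_intros LIMSEQ_Suc lim_1_over_n)
    then show ?thesis by simp
  qed
  have gi: "integrable lborel (\<lambda>\<xi>. g n \<xi> * r \<xi>)" for n
  proof (rule integrable_mult_bounded)
    show "integrable lborel (g n)" unfolding g_def by (rule exp_heat_fourier(1)) simp
    show "\<bar>r \<xi>\<bar> \<le> (LBINT x. \<bar>f x\<bar>)" for \<xi> using norm_fourier_le[OF fi, of \<xi>] r by simp
  qed simp
  have inv: "(LBINT \<xi>. complex_of_real (g n \<xi>) * fourier f \<xi> * char_pos x \<xi>)
      = complex_of_real (conv (heat_kernel (1 / real (Suc n))) f x)" for n x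
    unfolding g_def by (rule heat_fourier_inversion[OF fi]) simp
  have "(\<lambda>n. \<integral>\<xi>. g n \<xi> * r \<xi> \<partial>lborel) \<longlonglongrightarrow> f 0"
  proof -
    have "complex_of_real (LBINT \<xi>. g n \<xi> * r \<xi>) = complex_of_real (conv (heat_kernel (1 / real (Suc n))) f 0)" for n
      using inv[of n 0] by (simp add: r flip: integral_complex_of_real)
    then have "(LBINT \<xi>. g n \<xi> * r \<xi>) = conv (heat_kernel (1 / real (Suc n))) f 0" for n
      by (simp only: of_real_eq_iff)
    then show ?thesis using conv_heat_kernel_tendsto[OF f, of 0] by simp
  qed
  then have ri: "integrable lborel r"
  proof (rule integrable_monotone_convergence[rotated 3])
    show "AE \<xi> in lborel. mono (\<lambda>n. g n \<xi> * r \<xi>)"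
    proof (rule AE_I2, rule monoI)
      fix \<xi> :: 'a and m n :: nat assume "m \<le> n"
      then have "1 / real (Suc n) \<le> 1 / real (Suc m)" by (simp add: frac_le)
      then have "g m \<xi> \<le> g n \<xi>"
        unfolding g_def by (simp only: exp_le_cancel_iff neg_le_iff_le) (intro mult_right_mono mult_left_mono, auto)
      then show "g m \<xi> * r \<xi> \<le> g n \<xi> * r \<xi>" by (rule mult_right_mono[OF _ r(1)])
    qed
    show "AE \<xi> in lborel. (\<lambda>n. g n \<xi> * r \<xi>) \<longlonglongrightarrow> r \<xi>"
      using tendsto_mult_right[OF glim] by simp
  qed (use gi in auto)
  then have "integrable lborel (\<lambda>\<xi>. complex_of_real (r \<xi>))"
    by (simp add: complex_of_real_integrable_eq)
  then show i: "integrable lborel (fourier f)"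
    using r(2) by (simp cong: Bochner_Integration.integrable_cong)
  have "(\<lambda>n. \<integral>\<xi>. complex_of_real (g n \<xi>) * fourier f \<xi> * char_pos x \<xi> \<partial>lborel)
      \<longlonglongrightarrow> (LBINT \<xi>. fourier f \<xi> * char_pos x \<xi>)"
  proof (rule integral_dominated_convergence[where w = r])
    show "AE \<xi> in lborel. norm (complex_of_real (g n \<xi>) * fourier f \<xi> * char_pos x \<xi>) \<le> r \<xi>" for n
      using g1 r by (auto simp: norm_mult mult_left_le_one_le)
    show "AE \<xi> in lborel. (\<lambda>n. complex_of_real (g n \<xi>) * fourier f \<xi> * char_pos x \<xi>)
        \<longlonglongrightarrow> fourier f \<xi> * char_pos x \<xi>"
    proof (rule AE_I2)
      fix \<xi>
      have "(\<lambda>n. complex_of_real (g n \<xi>) * fourier f \<xi> * char_pos x \<xi>)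
        \<longlonglongrightarrow> complex_of_real 1 * fourier f \<xi> * char_pos x \<xi>"
        by (intro tendsto_intros glim)
      then show "(\<lambda>n. complex_of_real (g n \<xi>) * fourier f \<xi> * char_pos x \<xi>)
        \<longlonglongrightarrow> fourier f \<xi> * char_pos x \<xi>" by simp
    qed
  qed (use ri in measurable)
  moreover have "(\<lambda>n. \<integral>\<xi>. complex_of_real (g n \<xi>) * fourier f \<xi> * char_pos x \<xi> \<partial>lborel)
      \<longlonglongrightarrow> complex_of_real (f x)"
    unfolding inv by (intro tendsto_of_real conv_heat_kernel_tendsto f)
  ultimately show "(LBINT \<xi>. fourier f \<xi> * char_pos x \<xi>) = complex_of_real (f x)"
    by (rule LIMSEQ_unique)
qed

text \<open>The last two conjuncts build pointwise Fourier inversion into the notion. They are what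
  allows the operator to be evaluated on test functions through absolutely convergent
  integrals.\<close>

definition mollifier :: "real \<Rightarrow> ('a::euclidean_space \<Rightarrow> real) \<Rightarrow> bool" where
  "mollifier \<epsilon> \<rho> \<longleftrightarrow> smooth_bounded \<rho> \<and> integrable lborel \<rho> \<and> (\<forall>x. 0 \<le> \<rho> x) \<and> (\<forall>x. \<epsilon> \<le> norm x \<longrightarrow> \<rho> x = 0) \<and>
     (LBINT x. \<rho> x) = 1 \<and> integrable lborel (fourier \<rho>) \<and>
     (\<forall>x. (LBINT \<xi>. fourier \<rho> \<xi> * char_pos x \<xi>) = complex_of_real (\<rho> x))"

lemma integrable_bounded_support:
  fixes f :: "'a::euclidean_space \<Rightarrow> real"
  assumes [measurable]: "f \<in> borel_measurable borel" and B: "\<And>x. \<bar>f x\<bar> \<le> B" and z: "\<And>x. r < norm x \<Longrightarrow> f x = 0"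
  shows "integrable lborel f"
proof (rule Bochner_Integration.integrable_bound)
  show "integrable lborel (\<lambda>x::'a. B * indicat_real (cball 0 r) x)"
    by (intro integrable_mult_right integrable_real_indicator) (use emeasure_lborel_cball_finite[of 0 r] in auto)
  show "AE x in lborel. norm (f x) \<le> norm (B * indicat_real (cball 0 r) x)"
  proof (rule AE_I2)
    fix x
    show "norm (f x) \<le> norm (B * indicat_real (cball 0 r) x)"
      using B[of x] z[of x] by (auto simp: indicator_def)
  qed
qed simp

text \<open>For real \<open>f\<close> conjugation reflects the frequency, and evenness undoes the
  reflection.\<close>

lemma fourier_even_real:
  fixes f :: "'a::euclidean_space \<Rightarrow> real"
  assumes f[measurable]: "f \<in> borel_measurable borel" and e: "\<And>x. f (- x) = f x"
  shows "Im (fourier f \<xi>) = 0"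
proof -
  have "cnj (fourier f \<xi>) = fourier f (- \<xi>)"
    unfolding fourier_borel[OF f]
    by (subst Bochner_Integration.integral_cnj[symmetric]) (intro Bochner_Integration.integral_cong refl, simp add: exp_cnj)
  also have "\<dots> = fourier f \<xi>"
    using fourier_reflect[OF f, of \<xi>] by (simp add: e)
  finally show ?thesis by (metis Reals_cnj_iff complex_is_Real_iff)
qed

text \<open>The bump \<open>\<beta>\<close> is radial, so its transform is real and the transform of
  the self-convolution is a square, hence nonnegative. Radius \<open>\<epsilon> / 2\<close> for
  \<open>\<beta>\<close> gives radius \<open>\<epsilon>\<close> for the convolution.\<close>

lemma mollifier_exists:
  assumes \<epsilon>: "0 < \<epsilon>"
  shows "\<exists>\<rho> :: 'a::euclidean_space \<Rightarrow> real. mollifier \<epsilon> \<rho>"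
proof -
  define \<delta> where "\<delta> = \<epsilon> / 2"
  have \<delta>: "0 < \<delta>" using \<epsilon> by (simp add: \<delta>_def)
  define b where "b = (\<lambda>x::'a. exp_recip 0 (\<delta>\<^sup>2 - (norm x)\<^sup>2))"
  have b: "bump_alg b"
    unfolding b_def by (intro bump_alg.exp_recip bump_alg_diff bump_alg.const bump_alg_norm_power2)
  have bz: "b x = 0" if "\<delta> \<le> norm x" for x
  proof -
    have "\<delta>\<^sup>2 \<le> (norm x)\<^sup>2" using that \<delta> by (intro power_mono) auto
    then show ?thesis by (simp add: b_def exp_recip_def)
  qed
  have bpos: "0 < b x" if "norm x < \<delta>" for x
  proof -
    have "(norm x)\<^sup>2 < \<delta>\<^sup>2" using that by (intro power_strict_mono) auto
    then show ?thesis by (simp add: b_def exp_recip_def)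
  qed
  have b0: "0 \<le> b x" for x by (simp add: b_def)
  have [measurable]: "b \<in> borel_measurable borel" using b by (rule borel_measurable_bump_alg)
  have bi: "integrable lborel b"
  proof (rule integrable_bounded_support)
    show "\<bar>b x\<bar> \<le> 1" for x using exp_recip_le[of 0 "\<delta>\<^sup>2 - (norm x)\<^sup>2"] by (simp add: b_def)
    show "b x = 0" if "\<delta> < norm x" for x using that bz by simp
  qed simp
  have c: "0 < (LBINT x. b x)"
  proof (rule ccontr)
    assume "\<not> 0 < (LBINT x. b x)"
    moreover have "0 \<le> (LBINT x. b x)" using b0 by simp
    ultimately have "(LBINT x. b x) = 0" by simp
    then have "AE x in lborel. b x = 0" using integral_nonneg_eq_0_iff_AE[OF bi] b0 by simp
    then have "AE x in lborel. x \<notin> ball (0::'a) \<delta>"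
    proof eventually_elim
      case (elim x)
      then show ?case using bpos[of x] by auto
    qed
    then have "emeasure lborel (ball (0::'a) \<delta>) = 0" by (simp add: AE_iff_measurable[OF _ refl] ball_def)
    then show False using content_ball_pos[OF \<delta>, of "0::'a"] by (simp add: measure_def)
  qed
  define c where "c = 1 / (LBINT x. b x)"
  define \<beta> where "\<beta> = (\<lambda>x. c * b x)"
  have "bump_alg \<beta>" unfolding \<beta>_def by (intro bump_alg.mult bump_alg.const b)
  then have \<beta>s: "smooth_bounded \<beta>" by (rule smooth_bounded_bump_alg[of _ \<delta>]) (simp add: \<beta>_def bz)
  have \<beta>i: "integrable lborel \<beta>" using bi by (simp add: \<beta>_def)
  have \<beta>1: "(LBINT x. \<beta> x) = 1" using c by (simp add: \<beta>_def c_def)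
  have \<beta>0: "0 \<le> \<beta> x" for x using b0 c by (simp add: \<beta>_def c_def)
  have \<beta>z: "\<beta> x = 0" if "\<delta> \<le> norm x" for x using bz[OF that] by (simp add: \<beta>_def)
  note [measurable] = \<beta>i
  define \<rho> where "\<rho> = conv \<beta> \<beta>"
  have \<rho>s: "smooth_bounded \<rho>" unfolding \<rho>_def by (intro smooth_bounded_conv \<beta>i \<beta>s)
  have \<rho>i: "integrable lborel \<rho>" unfolding \<rho>_def by (intro integrable_conv \<beta>i)
  have F: "fourier \<rho> \<xi> = complex_of_real ((Re (fourier \<beta> \<xi>))\<^sup>2)" for \<xi>
  proof -
    have "\<beta> (- x) = \<beta> x" for x by (simp add: \<beta>_def b_def)
    then have "Im (fourier \<beta> \<xi>) = 0" by (intro fourier_even_real) simp_all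
    then have "fourier \<beta> \<xi> = complex_of_real (Re (fourier \<beta> \<xi>))"
      by (simp add: complex_eq_iff)
    then show ?thesis
      by (simp add: \<rho>_def fourier_conv[OF \<beta>i \<beta>i] power2_eq_square)
  qed
  have "mollifier \<epsilon> \<rho>"
    unfolding mollifier_def
  proof (intro conjI allI impI \<rho>s \<rho>i)
    show "0 \<le> \<rho> x" for x
      unfolding \<rho>_def by (simp add: conv_borel \<beta>0)
    show "\<rho> x = 0" if "\<epsilon> \<le> norm x" for x
    proof -
      have "\<beta> (x - y) * \<beta> y = 0" for y
      proof (cases "\<delta> \<le> norm y")
        case False
        then have "\<delta> \<le> norm (x - y)"
          using that norm_triangle_ineq[of "x - y" y] by (simp add: \<delta>_def)
        then show ?thesis by (simp add: \<beta>z)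
      qed (simp add: \<beta>z)
      then have "(\<lambda>y. \<beta> (x - y) * \<beta> y) = (\<lambda>_. 0)" by (intro ext)
      then show ?thesis by (simp add: \<rho>_def conv_borel del: mult_eq_0_iff)
    qed
    show "(LBINT x. \<rho> x) = 1"
      unfolding \<rho>_def by (simp add: integral_conv[OF \<beta>i \<beta>i] \<beta>1)
    show "integrable lborel (fourier \<rho>)"
      by (rule integrable_fourier_nonneg[OF \<rho>i \<rho>s _ F]) simp
    show "(LBINT \<xi>. fourier \<rho> \<xi> * char_pos x \<xi>) = complex_of_real (\<rho> x)" for x
      by (rule fourier_inversion_nonneg[OF \<rho>i \<rho>s _ F]) simp
  qed
  then show ?thesis by blast
qed

text \<open>The positive and negative parts of \<open>w\<close> are densities of two finite measures
  that agree on boxes, an intersection-stable generator of the Borel sets. Equal measures have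
  almost everywhere equal densities.\<close>

lemma AE_zero_if_boxes_zero:
  fixes w :: "'a::euclidean_space \<Rightarrow> real"
  assumes w: "integrable lborel w" and z: "\<And>a b. (LBINT x. indicator (box a b) x * w x) = 0"
  shows "AE x in lborel. w x = 0"
proof -
  note [measurable] = w
  have wp: "integrable lborel (\<lambda>x. max 0 (w x))" and wm: "integrable lborel (\<lambda>x. max 0 (- w x))"
    using w by (auto intro!: integrable_max)
  define M where "M = density lborel (\<lambda>x. ennreal (max 0 (w x)))"
  define N where "N = density lborel (\<lambda>x. ennreal (max 0 (- w x)))"
  have em: "emeasure (density lborel (\<lambda>x. ennreal (f x))) S = ennreal (LBINT x. indicator S x * f x)"
    if f: "integrable lborel f" "\<And>x. 0 \<le> f x" and S[measurable]: "S \<in> sets borel" for f :: "'a \<Rightarrow> real" and S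
  proof -
    note [measurable] = f
    have "emeasure (density lborel (\<lambda>x. ennreal (f x))) S = (\<integral>\<^sup>+x. ennreal (indicator S x * f x) \<partial>lborel)"
      by (simp add: emeasure_density ennreal_mult' ennreal_indicator mult.commute f)
    also have "\<dots> = ennreal (LBINT x. indicator S x * f x)"
      using integrable_mult_indicator[of S lborel f] f by (intro nn_integral_eq_integral) auto
    finally show ?thesis .
  qed
  have MN: "M = N"
  proof (rule measure_eqI_generator_eq)
    let ?E = "range (\<lambda>(a, b). box a b::'a set)"
    show "Int_stable ?E" by (auto simp: Int_stable_def box_Int_box)
    show "?E \<subseteq> Pow UNIV" "sets M = sigma_sets UNIV ?E" "sets N = sigma_sets UNIV ?E"
      by (simp_all add: M_def N_def borel_eq_box)
    let ?A = "\<lambda>n::nat. box (- (real n *\<^sub>R One)) (real n *\<^sub>R One) :: 'a set"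
    show "range ?A \<subseteq> ?E" "(\<Union>i. ?A i) = UNIV" unfolding UN_box_eq_UNIV by auto
    show "emeasure M (?A i) \<noteq> \<infinity>" for i
      using em[OF wp, of "?A i"] by (simp add: M_def)
    show "emeasure M X = emeasure N X" if "X \<in> ?E" for X
    proof -
      from that obtain a b where X: "X = box a b" by (elim rangeE) auto
      have ip: "integrable lborel (\<lambda>x. indicator X x * max 0 (w x))" "integrable lborel (\<lambda>x. indicator X x * max 0 (- w x))"
        using integrable_mult_indicator[of X lborel "\<lambda>x. max 0 (w x)"] integrable_mult_indicator[of X lborel "\<lambda>x. max 0 (- w x)"] wp wm
        by (simp_all add: X)
      have "(LBINT x. indicator X x * max 0 (w x)) - (LBINT x. indicator X x * max 0 (- w x))
          = (LBINT x. indicator X x * max 0 (w x) - indicator X x * max 0 (- w x))"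
        using ip by simp
      also have "\<dots> = (LBINT x. indicator X x * w x)"
        by (intro Bochner_Integration.integral_cong) (auto simp: max_def)
      also have "\<dots> = 0" unfolding X by (rule z)
      finally have "(LBINT x. indicator X x * max 0 (w x)) = (LBINT x. indicator X x * max 0 (- w x))"
        by simp
      moreover have "emeasure M X = ennreal (LBINT x. indicator X x * max 0 (w x))"
        unfolding M_def by (rule em[OF wp]) (simp_all add: X)
      moreover have "emeasure N X = ennreal (LBINT x. indicator X x * max 0 (- w x))"
        unfolding N_def by (rule em[OF wm]) (simp_all add: X)
      ultimately show ?thesis by simp
    qed
  qed
  have "AE x in lborel. ennreal (max 0 (w x)) = ennreal (max 0 (- w x))"
    using MN unfolding M_def N_def
    by (intro sigma_finite_measure.density_unique[OF sigma_finite_lborel]) simp_all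
  then show ?thesis
  proof eventually_elim
    case (elim x)
    then have "max 0 (w x) = max 0 (- w x)" by (simp only: ennreal_inj max.cobounded1)
    then show ?case by (auto simp: max_def split: if_splits)
  qed
qed

text \<open>Off the frontier the indicator is constant on a ball around \<open>y\<close>, so the
  averages are eventually equal to its value.\<close>

lemma mollifier_average_tendsto:
  fixes B :: "'a::euclidean_space set"
  assumes \<rho>: "\<And>n. mollifier (1 / real (Suc n)) (\<rho> n)" and [measurable]: "B \<in> sets borel"
    and y: "y \<notin> frontier B"
  shows "(\<lambda>n. \<integral>x. \<rho> n (y - x) * indicator B x \<partial>lborel) \<longlonglongrightarrow> indicator B y"
proof -
  have \<rho>i: "integrable lborel (\<rho> n)" for n using \<rho>[of n] by (simp add: mollifier_def)
  have [measurable]: "\<rho> n \<in> borel_measurable borel" for n using \<rho>i[of n] by auto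
  obtain e where e: "0 < e" "ball y e \<subseteq> B \<or> ball y e \<inter> B = {}"
  proof (cases "y \<in> interior B")
    case True
    then have "\<exists>e>0. ball y e \<subseteq> B" by (simp add: mem_interior)
    then show ?thesis using that by blast
  next
    case False
    then have "y \<in> - closure B" using y by (simp add: frontier_def)
    then have "\<exists>e>0. ball y e \<subseteq> - closure B" by (intro open_contains_ball[THEN iffD1, rule_format]) auto
    then show ?thesis using that closure_subset[of B] by blast
  qed
  then have ind: "indicator B x = (indicator B y :: real)" if "dist y x < e" for x
  proof -
    have "x \<in> ball y e" "y \<in> ball y e" using that e(1) by auto
    with e(2) have "x \<in> B \<longleftrightarrow> y \<in> B" by blast
    then show ?thesis by (simp add: indicator_def)
  qed
  obtain N where N: "1 / real (Suc N) < e"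
    using nat_approx_posE[OF e(1)] by auto
  have "(LBINT x. \<rho> n (y - x) * indicator B x) = indicator B y" if "N \<le> n" for n
  proof -
    have "1 / real (Suc n) \<le> 1 / real (Suc N)" using that by (simp add: frac_le)
    then have n: "1 / real (Suc n) < e" using N by simp
    have "(LBINT x. \<rho> n (y - x) * indicator B x) = (LBINT x. \<rho> n (y - x) * indicator B y)"
    proof (intro Bochner_Integration.integral_cong refl)
      fix x
      show "\<rho> n (y - x) * indicator B x = \<rho> n (y - x) * (indicator B y :: real)"
      proof (cases "norm (y - x) < 1 / real (Suc n)")
        case True
        then show ?thesis using ind[of x] n by (simp add: dist_norm)
      next
        case False
        then have "\<rho> n (y - x) = 0" using \<rho>[of n] by (simp add: mollifier_def not_less)
        then show ?thesis by simp
      qed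
    qed
    also have "\<dots> = indicator B y"
      using \<rho>[of n] by (simp add: integral_lborel_reflect[of "\<rho> n" y] mollifier_def)
    finally show ?thesis .
  qed
  then show ?thesis
    by (intro tendsto_eventually) (auto simp: eventually_sequentially)
qed

text \<open>The vanishing averages are integrated over \<open>x\<close> in the box, and Fubini's
  theorem moves the mollification from \<open>w\<close> onto the indicator of the box. Its averages
  converge off the boundary, a null set, so dominated convergence finishes without any
  differentiation theorem for \<open>w\<close>.\<close>

lemma integral_box_zero_if_averages_zero:
  fixes w :: "'a::euclidean_space \<Rightarrow> real"
  assumes w[measurable]: "w \<in> borel_measurable borel" and wl: "\<And>R. integrable lborel (\<lambda>x. indicator (cball 0 R) x * w x)"
    and B: "B = box a b" "B \<subseteq> U" and e0: "0 < e0"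
    and z: "\<And>x \<epsilon> \<rho>. x \<in> U \<Longrightarrow> 0 < \<epsilon> \<Longrightarrow> \<epsilon> < e0 \<Longrightarrow> mollifier \<epsilon> \<rho> \<Longrightarrow> (LBINT y. \<rho> (y - x) * w y) = 0"
  shows "(LBINT x. indicator B x * w x) = 0"
proof -
  have [measurable]: "B \<in> sets borel" by (simp add: B)
  obtain R where R: "B \<subseteq> cball 0 R" using bounded_subset_ballD[OF bounded_box[of a b], of 0] ball_subset_cball unfolding B by (metis order_trans)
  \<comment> \<open>\<open>w\<close> is only locally integrable. Mollifiers of radius at most 1
    centred in the box see nothing outside the ball of radius \<open>R + 1\<close>, so the
    truncation changes none of the averages.\<close>
  define v where "v = (\<lambda>x. indicator (cball 0 (R + 1)) x * w x)"
  have [measurable]: "cball (0::'a) (R + 1) \<in> sets borel" by simp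
  have vi: "integrable lborel v" unfolding v_def by (rule wl)
  then have [measurable]: "v \<in> borel_measurable borel" by auto
  have "\<exists>\<rho>. \<forall>n. mollifier (1 / real (Suc n)) (\<rho> n :: 'a \<Rightarrow> real)"
    by (intro choice allI mollifier_exists) simp
  then obtain \<rho> :: "nat \<Rightarrow> 'a \<Rightarrow> real" where \<rho>: "\<And>n. mollifier (1 / real (Suc n)) (\<rho> n)" by blast
  have \<rho>i: "integrable lborel (\<rho> n)" and \<rho>0: "0 \<le> \<rho> n x" and \<rho>1: "(LBINT x. \<rho> n x) = 1"
    and \<rho>z: "1 / real (Suc n) \<le> norm x \<Longrightarrow> \<rho> n x = 0" for n x
    using \<rho>[of n] by (auto simp: mollifier_def)
  have [measurable]: "\<rho> n \<in> borel_measurable borel" for n using \<rho>i[of n] by auto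
  define A where "A = (\<lambda>n y. \<integral>x. \<rho> n (y - x) * indicator B x \<partial>lborel)"
  have [measurable]: "A n \<in> borel_measurable borel" for n unfolding A_def by measurable
  have iB: "integrable lborel (\<lambda>x. \<rho> n (y - x))" for n y
    using integrable_lborel_reflect[of "\<rho> n" y] \<rho>i by simp
  have A: "0 \<le> A n y" "A n y \<le> 1" for n y
  proof -
    show "0 \<le> A n y" unfolding A_def by (intro integral_nonneg_AE AE_I2) (simp add: \<rho>0)
    have "A n y \<le> (LBINT x. \<rho> n (y - x))"
      unfolding A_def
    proof (rule integral_mono)
      show "integrable lborel (\<lambda>x. \<rho> n (y - x) * indicat_real B x)"
        by (rule integrable_mult_bounded[OF iB, of _ 1]) (auto simp: indicator_def)
    qed (auto simp: iB \<rho>0 indicator_def)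
    then show "A n y \<le> 1" using integral_lborel_reflect[of "\<rho> n" y] \<rho>1 by simp
  qed
  have zero: "(LBINT y. A n y * v y) = 0" if n: "1 / real (Suc n) < e0" for n
  proof -
    have p: "integrable (lborel \<Otimes>\<^sub>M lborel) (\<lambda>(x, y). indicator B x * (\<rho> n (y - x) * v y))"
    proof (rule Bochner_Integration.integrable_bound)
      show "integrable (lborel \<Otimes>\<^sub>M lborel) (\<lambda>(x, y). \<rho> n (- (x - y)) * v y)"
        using integrable_lborel_reflect[of "\<rho> n" 0] \<rho>i vi by (intro integrable_conv_pair) auto
    qed (auto simp: indicator_def)
    have "(LBINT y. A n y * v y) = (LBINT y. (LBINT x. indicator B x * (\<rho> n (y - x) * v y)))"
      unfolding A_def by (intro Bochner_Integration.integral_cong refl, subst integral_mult_left_zero[symmetric]) (simp add: mult_ac)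
    also have "\<dots> = (LBINT x. (LBINT y. indicator B x * (\<rho> n (y - x) * v y)))"
      by (rule lborel_pair.Fubini_integral[OF p])
    also have "\<dots> = (\<integral>x. 0 \<partial>(lborel :: 'a measure))"
    proof (intro Bochner_Integration.integral_cong refl)
      fix x
      show "(LBINT y. indicator B x * (\<rho> n (y - x) * v y)) = 0"
      proof (cases "x \<in> B")
        case True
        have "\<rho> n (y - x) * v y = \<rho> n (y - x) * w y" for y
        proof (cases "norm (y - x) < 1 / real (Suc n)")
          case True
          have "norm y \<le> norm x + norm (y - x)" using norm_triangle_ineq[of x "y - x"] by simp
          moreover have "norm x \<le> R" using R \<open>x \<in> B\<close> by auto
          moreover have "1 / real (Suc n) \<le> 1" by simp
          ultimately have "norm y \<le> R + 1" using True by linarith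
          then show ?thesis by (simp add: v_def)
        next
          case False
          then show ?thesis by (simp add: \<rho>z)
        qed
        then have "(LBINT y. \<rho> n (y - x) * v y) = (LBINT y. \<rho> n (y - x) * w y)"
          by (simp only:)
        also have "\<dots> = 0"
          using z[OF _ _ n \<rho>[of n], of x] True B(2) by auto
        finally show ?thesis using True by simp
      qed simp
    qed
    finally show ?thesis by simp
  qed
  have lim: "(\<lambda>n. \<integral>y. A n y * v y \<partial>lborel) \<longlonglongrightarrow> (LBINT y. indicator B y * v y)"
  proof (rule integral_dominated_convergence[where w = "\<lambda>y. \<bar>v y\<bar>"])
    show "AE y in lborel. norm (A n y * v y) \<le> \<bar>v y\<bar>" for n
      using A by (auto simp: abs_mult mult_left_le_one_le)
    have "AE y in lborel. y \<notin> cbox a b - box a b"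
      by (rule AE_not_in[OF null_sets_cbox_Diff_box])
    then show "AE y in lborel. (\<lambda>n. A n y * v y) \<longlonglongrightarrow> indicator B y * v y"
    proof eventually_elim
      case (elim y)
      have "frontier B \<subseteq> cbox a b - box a b"
        using closure_minimal[OF box_subset_cbox closed_cbox, of a b] interior_open[OF open_box, of a b]
        by (auto simp: B frontier_def)
      then have "(\<lambda>n. A n y) \<longlonglongrightarrow> indicator B y"
        unfolding A_def by (intro mollifier_average_tendsto \<rho>) (use elim in auto)
      then show ?case by (intro tendsto_mult tendsto_const)
    qed
  qed (use vi in auto)
  obtain N where N: "1 / real (Suc N) < e0" using nat_approx_posE[OF e0] by auto
  have "\<forall>\<^sub>F n in sequentially. (LBINT y. A n y * v y) = 0"
    unfolding eventually_sequentially
  proof (intro exI[of _ N] allI impI)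
    fix n assume "N \<le> n"
    then have "1 / real (Suc n) \<le> 1 / real (Suc N)" by (simp add: frac_le)
    then show "(LBINT y. A n y * v y) = 0" using N by (intro zero) simp
  qed
  then have "(\<lambda>n. \<integral>y. A n y * v y \<partial>lborel) \<longlonglongrightarrow> 0" by (rule tendsto_eventually)
  then have "(LBINT y. indicator B y * v y) = 0" using lim LIMSEQ_unique by blast
  moreover have "indicator B y * v y = indicator B y * w y" for y using R by (auto simp: v_def indicator_def)
  ultimately show ?thesis by simp
qed

text \<open>The fundamental lemma of the calculus of variations, in the form with small mollifiers
  only. Intersections of boxes are boxes, so the previous results settle each closed box in
  \<open>U\<close>, and countably many of these cover \<open>U\<close>.\<close>

lemma AE_zero_if_averages_zero:
  fixes w :: "'a::euclidean_space \<Rightarrow> real"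
  assumes w[measurable]: "w \<in> borel_measurable borel" and wl: "\<And>R. integrable lborel (\<lambda>x. indicator (cball 0 R) x * w x)"
    and U: "open U" and e0: "0 < e0"
    and z: "\<And>x \<epsilon> \<rho>. x \<in> U \<Longrightarrow> 0 < \<epsilon> \<Longrightarrow> \<epsilon> < e0 \<Longrightarrow> mollifier \<epsilon> \<rho> \<Longrightarrow> (LBINT y. \<rho> (y - x) * w y) = 0"
  shows "AE x in lborel. x \<in> U \<longrightarrow> w x = 0"
proof -
  have box: "AE x in lborel. x \<in> cbox a b \<longrightarrow> w x = 0" if ab: "cbox a b \<subseteq> U" for a b
  proof -
    obtain R where R: "box a b \<subseteq> cball 0 R" using bounded_subset_ballD[OF bounded_box[of a b], of 0] ball_subset_cball by (metis order_trans)
    have "AE x in lborel. indicator (box a b) x * w x = 0"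
    proof (rule AE_zero_if_boxes_zero)
      have eq: "(\<lambda>x. indicator (box a b) x * w x) = (\<lambda>x. indicator (box a b) x *\<^sub>R (indicator (cball 0 R) x * w x))"
        using R by (auto simp: indicator_def fun_eq_iff)
      show "integrable lborel (\<lambda>x. indicator (box a b) x * w x)"
        unfolding eq by (rule integrable_mult_indicator[OF _ wl[of R]]) simp
      fix c d
      obtain e f where ef: "box a b \<inter> box c d = box e f" using box_Int_box[of a b c d] by blast
      have "(LBINT x. indicator (box e f) x * w x) = 0"
      proof (rule integral_box_zero_if_averages_zero[OF w wl refl _ e0 z])
        show "box e f \<subseteq> U" using ef ab box_subset_cbox[of a b] by blast
      qed
      moreover have "(\<lambda>x. indicator (box c d) x * (indicator (box a b) x * w x)) = (\<lambda>x. indicator (box e f) x * w x)"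
        unfolding ef[symmetric] by (simp add: fun_eq_iff indicator_inter_arith mult_ac)
      ultimately show "(LBINT x. indicator (box c d) x * (indicator (box a b) x * w x)) = 0" by (simp only:)
    qed
    moreover have "AE x in lborel. x \<notin> cbox a b - box a b"
      by (rule AE_not_in[OF null_sets_cbox_Diff_box])
    ultimately show ?thesis by eventually_elim (auto simp: indicator_def split: if_splits)
  qed
  obtain D where D: "countable D" "\<And>X. X \<in> D \<Longrightarrow> \<exists>a b. X = cbox a b" "D \<subseteq> Pow U" "\<Union>D = U"
    by (rule open_countable_Union_open_cbox[OF U]) blast
  have "AE x in lborel. \<forall>X\<in>D. x \<in> X \<longrightarrow> w x = 0"
  proof (rule AE_ball_countable[THEN iffD2, OF D(1)], rule ballI)
    fix X assume "X \<in> D"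
    then show "AE x in lborel. x \<in> X \<longrightarrow> w x = 0" using box D(2)[of X] D(3) by auto
  qed
  then show ?thesis
  proof eventually_elim
    case (elim x)
    then show ?case using D(4) by blast
  qed
qed

text \<open>Integrability of the transform of \<open>\<rho>\<close> alone justifies Fubini's
  theorem; nothing is asked of the transform of \<open>K\<close> beyond its definition by an
  integrable function.\<close>

lemma conv_fourier_inversion:
  fixes K \<rho> :: "'a::euclidean_space \<Rightarrow> real"
  assumes K: "integrable lborel K" and \<rho>: "mollifier \<epsilon> \<rho>"
  shows "integrable lborel (\<lambda>\<xi>. fourier K \<xi> * fourier \<rho> \<xi> * char_pos x \<xi>)"
    and "(LBINT \<xi>. fourier K \<xi> * fourier \<rho> \<xi> * char_pos x \<xi>) = complex_of_real (conv K \<rho> x)"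
proof -
  have \<rho>i: "integrable lborel \<rho>" and F: "integrable lborel (fourier \<rho>)"
    and inv: "(LBINT \<xi>. fourier \<rho> \<xi> * char_pos x \<xi>) = complex_of_real (\<rho> x)" for x
    using \<rho> by (auto simp: mollifier_def)
  have [measurable]: "\<rho> \<in> borel_measurable borel" "K \<in> borel_measurable borel" using \<rho>i K by auto
  let ?e = "\<lambda>x \<xi>. char_pos x \<xi>"
  let ?F = "\<lambda>\<xi> y. complex_of_real (K y) * char_neg y \<xi> * (fourier \<rho> \<xi> * ?e x \<xi>)"
  have p0: "integrable (lborel \<Otimes>\<^sub>M lborel) (\<lambda>(\<xi>::'a, y). complex_of_real (K y) * fourier \<rho> \<xi>)"
  proof (rule lborel_pair.Fubini_integrable)
    show "integrable lborel (\<lambda>\<xi>::'a. \<integral>y. norm (case (\<xi>, y) of (\<xi>, y) \<Rightarrow> complex_of_real (K y) * fourier \<rho> \<xi>) \<partial>lborel)"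
      using F by (simp add: norm_mult)
  qed (use K in \<open>auto simp: complex_of_real_integrable_eq\<close>)
  have p: "integrable (lborel \<Otimes>\<^sub>M lborel) (\<lambda>(\<xi>, y). ?F \<xi> y)"
    by (rule Bochner_Integration.integrable_bound[OF p0]) (auto simp: norm_mult)
  have eq: "fourier K \<xi> * fourier \<rho> \<xi> * ?e x \<xi> = (LBINT y. ?F \<xi> y)" for \<xi>
    by (simp only: integral_mult_left_zero fourier_borel[OF \<open>K \<in> borel_measurable borel\<close>] mult.assoc[of _ "fourier \<rho> \<xi>"])
  show "integrable lborel (\<lambda>\<xi>. fourier K \<xi> * fourier \<rho> \<xi> * ?e x \<xi>)"
    unfolding eq by (rule lborel_pair.integrable_fst[OF p])
  have "(LBINT \<xi>. fourier K \<xi> * fourier \<rho> \<xi> * ?e x \<xi>) = (LBINT \<xi>. (LBINT y. ?F \<xi> y))"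
    unfolding eq ..
  also have "\<dots> = (LBINT y. (LBINT \<xi>. ?F \<xi> y))"
    by (rule lborel_pair.Fubini_integral[OF p, symmetric])
  also have "\<dots> = (LBINT y. complex_of_real (K y * \<rho> (x - y)))"
  proof (intro Bochner_Integration.integral_cong refl)
    fix y
    have "?F \<xi> y = complex_of_real (K y) * (fourier \<rho> \<xi> * ?e (x - y) \<xi>)" for \<xi>
    proof -
      have "?e (x - y) \<xi> = char_neg y \<xi> * ?e x \<xi>"
        unfolding exp_add[symmetric] by (simp add: inner_diff_left algebra_simps)
      then show ?thesis by (simp only: mult_ac)
    qed
    then have "(LBINT \<xi>. ?F \<xi> y) = complex_of_real (K y) * complex_of_real (\<rho> (x - y))"
      by (simp only: integral_mult_right_zero inv)
    then show "(LBINT \<xi>. ?F \<xi> y) = complex_of_real (K y * \<rho> (x - y))" by simp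
  qed
  also have "\<dots> = complex_of_real (conv K \<rho> x)"
    by (subst integral_complex_of_real) (simp add: conv_eq_reflected)
  finally show "(LBINT \<xi>. fourier K \<xi> * fourier \<rho> \<xi> * ?e x \<xi>) = complex_of_real (conv K \<rho> x)" .
qed

text \<open>An average of the difference against a mollifier is a value of the convolution of the
  reflected difference with that mollifier, and inversion computes it from a transform that is
  identically zero.\<close>

theorem fourier_unique:
  fixes f g :: "'a::euclidean_space \<Rightarrow> real"
  assumes f: "integrable lborel f" and g: "integrable lborel g" and eq: "\<And>\<xi>. fourier f \<xi> = fourier g \<xi>"
  shows "AE x in lborel. f x = g x"
proof -
  define h where "h = (\<lambda>x. f x - g x)"
  have hi: "integrable lborel h" unfolding h_def using f g by simp
  note [measurable] = hi
  have h0: "fourier h \<xi> = 0" for \<xi> unfolding h_def by (simp add: fourier_diff[OF f g] eq)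
  have "AE x in lborel. x \<in> UNIV \<longrightarrow> h x = 0"
  proof (rule AE_zero_if_averages_zero[of h UNIV 1])
    show "integrable lborel (\<lambda>x. indicator (cball 0 R) x * h x)" for R
      using integrable_mult_indicator[of "cball 0 R" lborel h] hi by simp
    fix x :: 'a and \<epsilon> and \<rho> :: "'a \<Rightarrow> real" assume \<rho>: "mollifier \<epsilon> \<rho>"
    then have [measurable]: "\<rho> \<in> borel_measurable borel" by (auto simp: mollifier_def)
    have K: "integrable lborel (\<lambda>y. h (- y))" using integrable_lborel_reflect[of h 0] hi by simp
    have "complex_of_real (conv (\<lambda>y. h (- y)) \<rho> (- x)) = 0"
      by (subst conv_fourier_inversion(2)[OF K \<rho>, symmetric]) (simp add: fourier_reflect h0)
    then have "conv (\<lambda>y. h (- y)) \<rho> (- x) = 0" by simp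
    then have "(LBINT y. \<rho> (- y - x) * h (- y)) = 0"
      by (simp add: conv_eq_reflected minus_diff_commute mult.commute)
    then show "(LBINT y. \<rho> (y - x) * h y) = 0"
      using integral_lborel_reflect[of "\<lambda>y. \<rho> (y - x) * h y" 0] by simp
  qed auto
  then show ?thesis by (simp add: h_def)
qed

section \<open>The compactly supported parametrix\<close>

text \<open>The fundamental theorem on the unit segment is integrated over all \<open>x\<close>. One
  side vanishes by translation invariance, the other is the integral of \<open>g'\<close> by
  Fubini's theorem. This is integration by parts without any decay hypothesis at infinity.\<close>

lemma integral_line_derivative_eq_0:
  fixes g g' :: "'a::euclidean_space \<Rightarrow> complex"
  assumes g: "integrable lborel g" and g': "integrable lborel g'"
    and d: "\<And>x \<tau>. ((\<lambda>\<tau>. g (x + \<tau> *\<^sub>R v)) has_vector_derivative g' (x + \<tau> *\<^sub>R v)) (at \<tau>)"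
    and c: "continuous_on UNIV g'"
  shows "(LBINT x. g' x) = 0"
proof -
  note [measurable] = g g'
  have tr: "(LBINT x. norm (g' (x + c))) = (LBINT x. norm (g' x))" for c
    using integral_lborel_translate[of "\<lambda>x. norm (g' x)" c] by simp
  have ftc: "(LBINT \<tau>. indicator {0..1::real} \<tau> *\<^sub>R g' (x + \<tau> *\<^sub>R v)) = g (x + v) - g x" for x
  proof -
    have "has_bochner_integral lborel (\<lambda>\<tau>. indicator {0..1} \<tau> *\<^sub>R g' (x + \<tau> *\<^sub>R v)) (g (x + 1 *\<^sub>R v) - g (x + 0 *\<^sub>R v))"
    proof (rule has_bochner_integral_FTC_Icc)
      show "continuous_on {0..1} (\<lambda>\<tau>. g' (x + \<tau> *\<^sub>R v))"
        by (intro continuous_on_compose2[OF c] continuous_intros) auto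
    qed (auto intro!: has_vector_derivative_at_within d)
    then show ?thesis by (simp add: has_bochner_integral_iff)
  qed
  have p: "integrable (lborel \<Otimes>\<^sub>M lborel) (\<lambda>(\<tau>, x). indicator {0..1::real} \<tau> *\<^sub>R g' (x + \<tau> *\<^sub>R v))"
  proof (rule lborel_pair.Fubini_integrable)
    have "(\<lambda>\<tau>. \<integral>x. norm (case (\<tau>, x) of (\<tau>, x) \<Rightarrow> indicator {0..1::real} \<tau> *\<^sub>R g' (x + \<tau> *\<^sub>R v)) \<partial>lborel)
        = (\<lambda>\<tau>. indicator {0..1} \<tau> * (LBINT x. norm (g' x)))"
      by (intro ext) (simp add: tr)
    then show "integrable lborel (\<lambda>\<tau>. \<integral>x. norm (case (\<tau>, x) of (\<tau>, x) \<Rightarrow> indicator {0..1::real} \<tau> *\<^sub>R g' (x + \<tau> *\<^sub>R v)) \<partial>lborel)"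
      by simp
    show "AE \<tau> in lborel. integrable lborel (\<lambda>x. case (\<tau>, x) of (\<tau>, x) \<Rightarrow> indicator {0..1::real} \<tau> *\<^sub>R g' (x + \<tau> *\<^sub>R v))"
      using g' by (intro AE_I2) (simp add: integrable_lborel_translate)
  qed measurable
  have "0 = (LBINT x. g (x + v) - g x)"
    using g by (simp add: integral_lborel_translate integrable_lborel_translate)
  also have "\<dots> = (LBINT x. (LBINT \<tau>. indicator {0..1::real} \<tau> *\<^sub>R g' (x + \<tau> *\<^sub>R v)))"
    by (simp only: ftc)
  also have "\<dots> = (LBINT \<tau>. (LBINT x. indicator {0..1::real} \<tau> *\<^sub>R g' (x + \<tau> *\<^sub>R v)))"
    by (rule lborel_pair.Fubini_integral[OF p])
  also have "\<dots> = (LBINT \<tau>. indicator {0..1::real} \<tau> *\<^sub>R (LBINT x. g' x))"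
    by (simp add: integral_lborel_translate)
  also have "\<dots> = (LBINT x. g' x)" by simp
  finally show ?thesis by simp
qed

text \<open>The product of \<open>f\<close> with the character has a line derivative consisting of
  two terms, and their integrals cancel by the previous lemma.\<close>

lemma fourier_line_derivative:
  fixes f f' :: "'a::euclidean_space \<Rightarrow> real"
  assumes f: "integrable lborel f" and f': "integrable lborel f'"
    and d: "\<And>x \<tau>. ((\<lambda>\<tau>. f (x + \<tau> *\<^sub>R v)) has_real_derivative f' (x + \<tau> *\<^sub>R v)) (at \<tau>)"
    and c: "continuous_on UNIV f" "continuous_on UNIV f'"
  shows "fourier f' \<xi> = 2 * pi * \<i> * complex_of_real (v \<bullet> \<xi>) * fourier f \<xi>"
proof -
  let ?e = "\<lambda>x. char_neg x \<xi>"
  let ?k = "2 * pi * \<i> * complex_of_real (v \<bullet> \<xi>)"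
  define g' where "g' = (\<lambda>x. complex_of_real (f' x) * ?e x - ?k * (complex_of_real (f x) * ?e x))"
  have m: "f \<in> borel_measurable borel" "f' \<in> borel_measurable borel" using f f' by auto
  have "(LBINT x. g' x) = 0"
  proof (rule integral_line_derivative_eq_0[where v = v])
    show "integrable lborel (\<lambda>x. complex_of_real (f x) * ?e x)" by (rule integrable_fourier[OF f])
    show "integrable lborel g'" unfolding g'_def
      by (intro Bochner_Integration.integrable_diff integrable_mult_right integrable_fourier f f')
    show "continuous_on UNIV g'" unfolding g'_def by (intro continuous_intros c)
    fix x \<tau>
    have 1: "((\<lambda>\<tau>. complex_of_real (f (x + \<tau> *\<^sub>R v))) has_vector_derivative complex_of_real (f' (x + \<tau> *\<^sub>R v))) (at \<tau>)"
      by (intro has_vector_derivative_of_real d)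
    have 2: "((\<lambda>\<tau>. ?e (x + \<tau> *\<^sub>R v)) has_vector_derivative (- ?k * ?e (x + \<tau> *\<^sub>R v))) (at \<tau>)"
    proof -
      have "((\<lambda>\<tau>. - (2 * pi * \<i> * complex_of_real ((x + \<tau> *\<^sub>R v) \<bullet> \<xi>))) has_vector_derivative - ?k) (at \<tau>)"
      proof -
        have "((\<lambda>\<tau>. (x + \<tau> *\<^sub>R v) \<bullet> \<xi>) has_real_derivative v \<bullet> \<xi>) (at \<tau>)"
          by (auto intro!: derivative_eq_intros simp: inner_add_left)
        from has_vector_derivative_mult_right[OF has_vector_derivative_of_real[OF this, where 'a = complex], of "- (2 * pi * \<i>)"]
        show ?thesis by simp
      qed
      from field_vector_diff_chain_at[OF this DERIV_exp]
      show ?thesis by (simp add: o_def mult.commute)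
    qed
    show "((\<lambda>\<tau>. complex_of_real (f (x + \<tau> *\<^sub>R v)) * ?e (x + \<tau> *\<^sub>R v)) has_vector_derivative g' (x + \<tau> *\<^sub>R v)) (at \<tau>)"
      using has_vector_derivative_mult[OF 1 2] by (simp add: g'_def algebra_simps)
  qed
  moreover have "(LBINT x. g' x) = fourier f' \<xi> - ?k * fourier f \<xi>"
    unfolding g'_def Bochner_Integration.integral_diff[OF integrable_fourier[OF f'] integrable_mult_right[OF integrable_fourier[OF f]]]
    by (simp only: fourier_borel[OF m(1)] fourier_borel[OF m(2)] integral_mult_right_zero)
  ultimately show ?thesis by simp
qed

text \<open>Since the coefficients vanish near the origin, the powers of \<open>1 / t\<close> created by differentiating the
  heat kernel are harmless: they are absorbed by the Gaussian decay in \<open>(norm x)\<^sup>2 / t\<close>.\<close>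

inductive heat_alg :: "real \<Rightarrow> (real \<Rightarrow> 'a::euclidean_space \<Rightarrow> real) \<Rightarrow> bool" for \<delta> where
  base: "bump_alg a \<Longrightarrow> (\<And>x. norm x < \<delta> \<Longrightarrow> a x = 0) \<Longrightarrow> heat_alg \<delta> (\<lambda>t x. a x / t ^ j * heat_kernel t x)"
| add: "heat_alg \<delta> F \<Longrightarrow> heat_alg \<delta> F' \<Longrightarrow> heat_alg \<delta> (\<lambda>t x. F t x + F' t x)"

lemma heat_alg_cmult: "heat_alg \<delta> F \<Longrightarrow> heat_alg \<delta> (\<lambda>t x. c * F t x)"
proof (induction rule: heat_alg.induct)
  case (base a j)
  have "heat_alg \<delta> (\<lambda>t x. (c * a x) / t ^ j * heat_kernel t x)"
    by (rule heat_alg.base) (auto intro: bump_alg.intros base)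
  then show ?case by (simp add: mult.assoc)
next
  case (add F F')
  then show ?case using heat_alg.add by (simp add: distrib_left)
qed

lemma heat_alg_zero: "heat_alg \<delta> (\<lambda>t x. 0)"
  using heat_alg.base[OF bump_alg.const[of 0], of \<delta> 0] by simp

lemma heat_alg_sum: "finite A \<Longrightarrow> (\<And>i. i \<in> A \<Longrightarrow> heat_alg \<delta> (F i)) \<Longrightarrow> heat_alg \<delta> (\<lambda>t x. \<Sum>i\<in>A. F i t x)"
  by (induction A rule: finite_induct) (auto intro: heat_alg_zero heat_alg.add)

lemma heat_alg_measurable: "heat_alg \<delta> F \<Longrightarrow> (\<lambda>(t, x). F t x) \<in> borel_measurable (lborel \<Otimes>\<^sub>M lborel)"
proof (induction rule: heat_alg.induct)
  case (base a j)
  have [measurable]: "a \<in> borel_measurable borel" using base(1) by (rule borel_measurable_bump_alg)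
  show ?case by measurable
next
  case (add F F')
  then show ?case by (auto simp: split_beta' intro: borel_measurable_add)
qed

lemma heat_alg_continuous_on: "heat_alg \<delta> F \<Longrightarrow> continuous_on UNIV (F t)"
proof (induction rule: heat_alg.induct)
  case (base a j)
  then show ?case
    unfolding heat_kernel_def divide_inverse
    by (intro continuous_intros bump_alg_continuous_on)
next
  case (add F F')
  then show ?case by (intro continuous_intros)
qed

text \<open>The powers of \<open>1 + t\<close> stem from the polynomial growth of the coefficient;
  the factor \<open>exp (- t)\<close> in the weight of the Bessel kernel absorbs them later.\<close>

lemma heat_alg_bound:
  assumes F: "heat_alg \<delta> (F :: real \<Rightarrow> 'a::euclidean_space \<Rightarrow> real)" and \<delta>: "0 < \<delta>"
  shows "\<exists>C N. 0 \<le> C \<and> (\<forall>t>0. \<forall>x. \<bar>F t x\<bar> \<le> C * (1 + t) ^ N * heat_kernel (2 * t) x)"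
  using F
proof (induction rule: heat_alg.induct)
  case (base a j)
  obtain C N where C: "0 \<le> C" "\<And>x. \<bar>a x\<bar> \<le> C * (1 + (norm x)\<^sup>2) ^ N"
    using bump_alg_poly_bounded[OF base(1)] by blast
  define D where "D = (\<lambda>M::nat. (8::real) ^ M * fact M * 2 powr (DIM('a) / 2))"
  have D: "0 \<le> D M" for M by (simp add: D_def)
  have mom: "((norm x)\<^sup>2) ^ M * heat_kernel t x \<le> D M * t ^ M * heat_kernel (2 * t) x" if "0 < t" for t M and x :: 'a
    using heat_kernel_moment[OF that] by (simp add: D_def)
  \<comment> \<open>Two moments enter: order \<open>j\<close> cancels the power of
    \<open>1 / t\<close>, and order \<open>N + j\<close> also pays for the growth of
    \<open>a\<close>.\<close>
  let ?K = "C * (1 / \<delta>\<^sup>2) ^ j * 2 ^ N * (D j + D (N + j))"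
  have pw: "(1 + X) ^ N \<le> 2 ^ N * (1 + X ^ N)" if "0 \<le> X" for X :: real
  proof -
    have "(1 + X) ^ N \<le> (2 * max 1 X) ^ N" using that by (intro power_mono) auto
    also have "\<dots> \<le> 2 ^ N * (1 + X ^ N)"
      using that by (auto simp: power_mult_distrib max_def)
    finally show ?thesis .
  qed
  have "\<bar>a x / t ^ j * heat_kernel t x\<bar> \<le> ?K * (1 + t) ^ N * heat_kernel (2 * t) x" if t: "0 < t" for t x
  proof (cases "norm x < \<delta>")
    case True
    then show ?thesis using base(2) C D t by (auto intro!: mult_nonneg_nonneg add_nonneg_nonneg)
  next
    case False
    let ?X = "(norm x)\<^sup>2"
    have "\<delta>\<^sup>2 \<le> ?X" using False \<delta> by (intro power_mono) auto
    then have "1 \<le> ?X / \<delta>\<^sup>2" using \<delta> by simp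
    \<comment> \<open>Where \<open>a\<close> can be nonzero the norm is at least
      \<open>\<delta>\<close>, so this factor may be inserted. It supplies the powers of
      \<open>(norm x)\<^sup>2\<close> that \<open>mom\<close> trades for
      \<open>t ^ j\<close>.\<close>
    then have 1: "1 \<le> (1 / \<delta>\<^sup>2) ^ j * ?X ^ j" by (simp add: one_le_power flip: power_mult_distrib)
    have "\<bar>a x\<bar> \<le> C * (2 ^ N * (1 + ?X ^ N)) * 1"
      using C(2)[of x] mult_left_mono[OF pw[of ?X] C(1)] by simp
    also have "\<dots> \<le> C * (2 ^ N * (1 + ?X ^ N)) * ((1 / \<delta>\<^sup>2) ^ j * ?X ^ j)"
      using C(1) by (intro mult_left_mono[OF 1]) auto
    finally have "\<bar>a x\<bar> \<le> (C * (1 / \<delta>\<^sup>2) ^ j * 2 ^ N) * (?X ^ j + ?X ^ (N + j))"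
      by (simp add: algebra_simps power_add)
    then have "\<bar>a x / t ^ j * heat_kernel t x\<bar> \<le> (C * (1 / \<delta>\<^sup>2) ^ j * 2 ^ N) * (?X ^ j + ?X ^ (N + j)) / t ^ j * heat_kernel t x"
      using t by (auto simp: abs_mult intro!: mult_right_mono divide_right_mono)
    also have "\<dots> = (C * (1 / \<delta>\<^sup>2) ^ j * 2 ^ N) / t ^ j * (?X ^ j * heat_kernel t x + ?X ^ (N + j) * heat_kernel t x)"
      by (simp add: algebra_simps add_divide_distrib)
    also have "\<dots> \<le> (C * (1 / \<delta>\<^sup>2) ^ j * 2 ^ N) / t ^ j * (D j * t ^ j * heat_kernel (2 * t) x + D (N + j) * t ^ (N + j) * heat_kernel (2 * t) x)"
      using t C(1) by (intro mult_left_mono add_mono mom) auto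
    also have "\<dots> = (C * (1 / \<delta>\<^sup>2) ^ j * 2 ^ N) * ((D j + D (N + j) * t ^ N) * heat_kernel (2 * t) x)"
    proof -
      have "K / T * (a * T * q + b * (S * T) * q) = K * ((a + b * S) * q)" if "T \<noteq> 0" for K T a b S q :: real
        using that by (simp add: field_simps)
      from this[of "t ^ j"] show ?thesis using t by (simp add: power_add)
    qed
    also have "\<dots> \<le> (C * (1 / \<delta>\<^sup>2) ^ j * 2 ^ N) * (((D j + D (N + j)) * (1 + t) ^ N) * heat_kernel (2 * t) x)"
    proof (intro mult_left_mono mult_right_mono)
      have "D j * 1 \<le> D j * (1 + t) ^ N" using t by (intro mult_left_mono D one_le_power) auto
      moreover have "D (N + j) * t ^ N \<le> D (N + j) * (1 + t) ^ N" using t by (intro mult_left_mono D power_mono) auto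
      ultimately show "D j + D (N + j) * t ^ N \<le> (D j + D (N + j)) * (1 + t) ^ N" by (simp add: distrib_right)
    qed (use C(1) in auto)
    finally show ?thesis by (simp only: mult_ac)
  qed
  moreover have "0 \<le> ?K" using C(1) D by (auto intro!: mult_nonneg_nonneg add_nonneg_nonneg)
  ultimately show ?case by (intro exI[of _ ?K] exI[of _ N]) auto
next
  case (add F F')
  obtain C N where C: "0 \<le> C" "\<And>t x. 0 < t \<Longrightarrow> \<bar>F t x\<bar> \<le> C * (1 + t) ^ N * heat_kernel (2 * t) x"
    using add.IH(1) by blast
  obtain C' N' where C': "0 \<le> C'" "\<And>t x. 0 < t \<Longrightarrow> \<bar>F' t x\<bar> \<le> C' * (1 + t) ^ N' * heat_kernel (2 * t) x"
    using add.IH(2) by blast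
  note b = C C'
  have "\<bar>F t x + F' t x\<bar> \<le> (C + C') * (1 + t) ^ (N + N') * heat_kernel (2 * t) x" if t: "0 < t" for t x
  proof -
    have "C * (1 + t) ^ N * heat_kernel (2 * t) x \<le> C * (1 + t) ^ (N + N') * heat_kernel (2 * t) x"
      "C' * (1 + t) ^ N' * heat_kernel (2 * t) x \<le> C' * (1 + t) ^ (N + N') * heat_kernel (2 * t) x"
      using b t by (auto intro!: mult_left_mono mult_right_mono power_increasing)
    then show ?thesis using b(2)[OF t, of x] b(4)[OF t, of x] by (simp add: distrib_right)
  qed
  then show ?case using b by (intro exI[of _ "C + C'"] exI[of _ "N + N'"]) auto
qed

lemma heat_alg_integrable:
  assumes F: "heat_alg \<delta> F" and \<delta>: "0 < \<delta>" and t: "0 < t"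
  shows "integrable lborel (F t)"
proof -
  obtain C N where C: "\<And>x. \<bar>F t x\<bar> \<le> C * (1 + t) ^ N * heat_kernel (2 * t) x"
    using heat_alg_bound[OF F \<delta>] t by blast
  show ?thesis
  proof (rule Bochner_Integration.integrable_bound)
    show "integrable lborel (\<lambda>x. C * (1 + t) ^ N * heat_kernel (2 * t) x)"
      using t by (intro integrable_mult_right integrable_heat_kernel) simp
    show "F t \<in> borel_measurable lborel"
      using borel_measurable_continuous_onI[OF heat_alg_continuous_on[OF F]] by simp
    show "AE x in lborel. norm (F t x) \<le> norm (C * (1 + t) ^ N * heat_kernel (2 * t) x)"
      by (intro AE_I2) (simp only: real_norm_def, rule order_trans[OF C abs_ge_self])
  qed
qed

text \<open>Differentiating the Gaussian produces the factor
  \<open>- (x \<bullet> v) / (2 * t)\<close>, so the class is kept at the price of raising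
  \<open>j\<close> by one. Derivatives of the coefficient still vanish on the open ball.\<close>

lemma heat_alg_line_derivative:
  assumes F: "heat_alg \<delta> (F :: real \<Rightarrow> 'a::euclidean_space \<Rightarrow> real)"
  shows "\<exists>F'. heat_alg \<delta> F' \<and> (\<forall>t>0. \<forall>x \<tau>. ((\<lambda>\<tau>. F t (x + \<tau> *\<^sub>R v)) has_real_derivative F' t (x + \<tau> *\<^sub>R v)) (at \<tau>))"
  using F
proof (induction rule: heat_alg.induct)
  case (base a j)
  obtain D where D: "\<And>v. bump_alg (D v)" "\<And>x. (a has_derivative (\<lambda>v. D v x)) (at x)"
    using bump_alg_has_derivative[OF base(1)] by blast
  have Dz: "D w x = 0" if "norm x < \<delta>" for x w
  proof -
    have "open {x::'a. norm x < \<delta>}" by (intro open_Collect_less continuous_intros)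
    then have "(\<lambda>v. D v x) = (\<lambda>_. 0)"
      by (rule has_derivative_zero_on_open[OF D(2)]) (use that base(2) in auto)
    then show ?thesis by metis
  qed
  let ?F' = "\<lambda>t x. D v x / t ^ j * heat_kernel t x + ((- 1 / 2) * ((x \<bullet> v) * a x)) / t ^ Suc j * heat_kernel t x"
  have "heat_alg \<delta> ?F'"
    by (intro heat_alg.add heat_alg.base bump_alg.mult bump_alg.const bump_alg.inner base(1) D(1)) (auto simp: Dz base(2))
  moreover have "((\<lambda>\<tau>. a (x + \<tau> *\<^sub>R v) / t ^ j * heat_kernel t (x + \<tau> *\<^sub>R v)) has_real_derivative ?F' t (x + \<tau> *\<^sub>R v)) (at \<tau>)"
    if t: "0 < t" for t x \<tau>
  proof -
    have 1: "((\<lambda>\<tau>. a (x + \<tau> *\<^sub>R v)) has_real_derivative D v (x + \<tau> *\<^sub>R v)) (at \<tau>)"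
    proof -
      have "((\<lambda>\<tau>. x + \<tau> *\<^sub>R v) has_derivative (\<lambda>r. r *\<^sub>R v)) (at \<tau>)" by (auto intro!: derivative_eq_intros)
      from has_derivative_compose[OF this D(2)]
      have "((\<lambda>\<tau>. a (x + \<tau> *\<^sub>R v)) has_derivative (\<lambda>r. D (r *\<^sub>R v) (x + \<tau> *\<^sub>R v))) (at \<tau>)" .
      moreover have "D (r *\<^sub>R v) y = D v y * r" for r y
        using linear_scale[OF has_derivative_linear[OF D(2)[of y]], of r v] by simp
      ultimately show ?thesis by (simp add: has_field_derivative_def)
    qed
    have 2: "((\<lambda>\<tau>. heat_kernel t (x + \<tau> *\<^sub>R v)) has_real_derivative heat_kernel t (x + \<tau> *\<^sub>R v) * (- (2 * ((x + \<tau> *\<^sub>R v) \<bullet> v)) / (4 * t))) (at \<tau>)"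
    proof -
      have "((\<lambda>\<tau>. - ((x + \<tau> *\<^sub>R v) \<bullet> (x + \<tau> *\<^sub>R v) / (4 * t))) has_real_derivative - (2 * ((x + \<tau> *\<^sub>R v) \<bullet> v)) / (4 * t)) (at \<tau>)"
      proof -
        have eq: "(x + \<tau> *\<^sub>R v) \<bullet> (x + \<tau> *\<^sub>R v) = x \<bullet> x + 2 * \<tau> * (x \<bullet> v) + \<tau>\<^sup>2 * (v \<bullet> v)" for \<tau>
          by (simp add: inner_add_left inner_add_right inner_commute power2_eq_square algebra_simps)
        show ?thesis
          unfolding eq using t by (auto intro!: derivative_eq_intros simp: inner_add_left field_simps)
      qed
      from DERIV_cmult[OF DERIV_chain2[OF DERIV_exp this], of "(4 * pi * t) powr - (DIM('a) / 2)"]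
      show ?thesis by (simp add: heat_kernel_def power2_norm_eq_inner mult.assoc)
    qed
    show ?thesis
      using DERIV_mult[OF DERIV_cdivide[OF 1, of "t ^ j"] 2] t by (simp add: field_simps)
  qed
  ultimately show ?case by (intro exI[of _ ?F']) blast
next
  case (add F1 F2)
  then obtain F1' F2' where "heat_alg \<delta> F1'" "heat_alg \<delta> F2'"
    "\<And>t x \<tau>. 0 < t \<Longrightarrow> ((\<lambda>\<tau>. F1 t (x + \<tau> *\<^sub>R v)) has_real_derivative F1' t (x + \<tau> *\<^sub>R v)) (at \<tau>)"
    "\<And>t x \<tau>. 0 < t \<Longrightarrow> ((\<lambda>\<tau>. F2 t (x + \<tau> *\<^sub>R v)) has_real_derivative F2' t (x + \<tau> *\<^sub>R v)) (at \<tau>)" by blast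
  then show ?case by (intro exI[of _ "\<lambda>t x. F1' t x + F2' t x"]) (auto intro: heat_alg.add DERIV_add)
qed

lemma heat_alg_fourier_derivative:
  assumes F: "heat_alg \<delta> (F :: real \<Rightarrow> 'a::euclidean_space \<Rightarrow> real)" and \<delta>: "0 < \<delta>"
  shows "\<exists>F'. heat_alg \<delta> F' \<and> (\<forall>t>0. \<forall>\<xi>. fourier (F' t) \<xi> = 2 * pi * \<i> * complex_of_real (v \<bullet> \<xi>) * fourier (F t) \<xi>)"
proof -
  obtain F' where F': "heat_alg \<delta> F'"
    "\<And>t x \<tau>. 0 < t \<Longrightarrow> ((\<lambda>\<tau>. F t (x + \<tau> *\<^sub>R v)) has_real_derivative F' t (x + \<tau> *\<^sub>R v)) (at \<tau>)"
    using heat_alg_line_derivative[OF F, of v] by blast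
  have "fourier (F' t) \<xi> = 2 * pi * \<i> * complex_of_real (v \<bullet> \<xi>) * fourier (F t) \<xi>" if t: "0 < t" for t \<xi>
    by (rule fourier_line_derivative[OF heat_alg_integrable[OF F \<delta> t] heat_alg_integrable[OF F'(1) \<delta> t] F'(2)[OF t]
        heat_alg_continuous_on[OF F] heat_alg_continuous_on[OF F'(1)]])
  then show ?thesis using F'(1) by blast
qed

lemma fourier_cmult:
  assumes [measurable]: "f \<in> borel_measurable borel"
  shows "fourier (\<lambda>x. c * f x) \<xi> = complex_of_real c * fourier f \<xi>"
  by (simp add: fourier_borel mult.assoc)

lemma fourier_sum:
  fixes f :: "'i \<Rightarrow> 'a::euclidean_space \<Rightarrow> real"
  assumes "finite A" "\<And>i. i \<in> A \<Longrightarrow> integrable lborel (f i)"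
  shows "fourier (\<lambda>x. \<Sum>i\<in>A. f i x) \<xi> = (\<Sum>i\<in>A. fourier (f i) \<xi>)"
  using assms
proof (induction A rule: finite_induct)
  case empty
  then show ?case by (simp add: fourier_def)
next
  case (insert i A)
  then show ?case by (simp add: fourier_add)
qed

text \<open>\<open>F'\<close> is \<open>F\<close> minus its second derivatives along the basis
  vectors, that is, the identity minus the Laplacian applied in \<open>x\<close>; each second
  derivative contributes the square of \<open>2 * pi * \<i> * (b \<bullet> \<xi>)\<close>.\<close>

lemma heat_alg_fourier_laplacian:
  assumes F: "heat_alg \<delta> (F :: real \<Rightarrow> 'a::euclidean_space \<Rightarrow> real)" and \<delta>: "0 < \<delta>"
  shows "\<exists>F'. heat_alg \<delta> F' \<and> (\<forall>t>0. \<forall>\<xi>. fourier (F' t) \<xi> = complex_of_real (1 + 4 * pi\<^sup>2 * (norm \<xi>)\<^sup>2) * fourier (F t) \<xi>)"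
proof -
  have "\<exists>F2. heat_alg \<delta> F2 \<and> (\<forall>t>0. \<forall>\<xi>. fourier (F2 t) \<xi> = - complex_of_real (4 * pi\<^sup>2 * (\<xi> \<bullet> b)\<^sup>2) * fourier (F t) \<xi>)" for b
  proof -
    obtain F1 where F1: "heat_alg \<delta> F1" "\<And>t \<xi>. 0 < t \<Longrightarrow> fourier (F1 t) \<xi> = 2 * pi * \<i> * complex_of_real (b \<bullet> \<xi>) * fourier (F t) \<xi>"
      using heat_alg_fourier_derivative[OF F \<delta>, of b] by blast
    obtain F2 where F2: "heat_alg \<delta> F2" "\<And>t \<xi>. 0 < t \<Longrightarrow> fourier (F2 t) \<xi> = 2 * pi * \<i> * complex_of_real (b \<bullet> \<xi>) * fourier (F1 t) \<xi>"
      using heat_alg_fourier_derivative[OF F1(1) \<delta>, of b] by blast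
    have "fourier (F2 t) \<xi> = - complex_of_real (4 * pi\<^sup>2 * (\<xi> \<bullet> b)\<^sup>2) * fourier (F t) \<xi>" if "0 < t" for t \<xi>
      unfolding F2(2)[OF that] F1(2)[OF that] by (simp add: power2_eq_square inner_commute algebra_simps)
    then show ?thesis using F2(1) by blast
  qed
  then obtain F2 where F2: "\<And>b. heat_alg \<delta> (F2 b)"
    "\<And>b t \<xi>. 0 < t \<Longrightarrow> fourier (F2 b t) \<xi> = - complex_of_real (4 * pi\<^sup>2 * (\<xi> \<bullet> b)\<^sup>2) * fourier (F t) \<xi>"
    by metis
  define F' where "F' = (\<lambda>t x. F t x + (\<Sum>b\<in>Basis. - 1 * F2 b t x))"
  have "heat_alg \<delta> F'" unfolding F'_def by (intro heat_alg.add F heat_alg_sum heat_alg_cmult F2) simp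
  moreover have "fourier (F' t) \<xi> = complex_of_real (1 + 4 * pi\<^sup>2 * (norm \<xi>)\<^sup>2) * fourier (F t) \<xi>" if t: "0 < t" for t \<xi>
  proof -
    have i: "integrable lborel (\<lambda>x. - 1 * F2 b t x)" for b
      by (intro integrable_mult_right heat_alg_integrable[OF F2(1) \<delta> t])
    have [measurable]: "F2 b t \<in> borel_measurable borel" for b
      using heat_alg_integrable[OF F2(1) \<delta> t, of b] by auto
    have "fourier (F' t) \<xi> = fourier (F t) \<xi> + (\<Sum>b\<in>Basis. fourier (\<lambda>x. - 1 * F2 b t x) \<xi>)"
      unfolding F'_def
      by (subst fourier_add[OF heat_alg_integrable[OF F \<delta> t] Bochner_Integration.integrable_sum[OF i]])
         (simp only: fourier_sum[OF finite_Basis i])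
    also have "(\<Sum>b\<in>Basis. fourier (\<lambda>x. - 1 * F2 b t x) \<xi>) = (\<Sum>b\<in>Basis. complex_of_real (4 * pi\<^sup>2 * (\<xi> \<bullet> b)\<^sup>2) * fourier (F t) \<xi>)"
      by (intro sum.cong refl) (subst fourier_cmult, simp_all add: F2(2)[OF t])
    also have "\<dots> = complex_of_real (4 * pi\<^sup>2 * (norm \<xi>)\<^sup>2) * fourier (F t) \<xi>"
      by (simp add: norm_power2_sum_Basis sum_distrib_left sum_distrib_right)
    finally show ?thesis by (simp add: distrib_right)
  qed
  ultimately show ?thesis by blast
qed

lemma cutoff_exists:
  assumes r: "0 < r"
  shows "\<exists>a :: 'a::euclidean_space \<Rightarrow> real. bump_alg a \<and> (\<forall>x. norm x < r / 2 \<longrightarrow> a x = 0) \<and> (\<forall>x. r \<le> norm x \<longrightarrow> a x = 1)"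
proof (intro exI conjI allI impI)
  \<comment> \<open>The inner bump times \<open>exp (2 / r\<^sup>2)\<close> is at least 1 for
    \<open>norm x < r / 2\<close> and is 0 for \<open>r \<le> norm x\<close>. The outer argument is
    thus nonpositive near the origin and equal to 1 far away, where
    \<open>exp_recip 0 1 = exp (- 1)\<close> explains the factor \<open>exp 1\<close>. The result is
    one minus a cutoff.\<close>
  let ?a = "\<lambda>x::'a. exp 1 * exp_recip 0 (1 - exp (2 / r\<^sup>2) * exp_recip 0 (r\<^sup>2 - (norm x)\<^sup>2))"
  show "bump_alg ?a"
    by (intro bump_alg.mult bump_alg.const bump_alg.exp_recip bump_alg_diff bump_alg_norm_power2)
  fix x :: 'a
  {
    assume "norm x < r / 2"
    then have "(norm x)\<^sup>2 \<le> (r / 2)\<^sup>2" by (intro power_mono) auto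
    then have x: "r\<^sup>2 / 2 \<le> r\<^sup>2 - (norm x)\<^sup>2" 
    proof -
      have "(r / 2)\<^sup>2 = r\<^sup>2 / 4" by (simp add: power_divide)
      then show ?thesis using \<open>(norm x)\<^sup>2 \<le> (r / 2)\<^sup>2\<close> zero_le_power2[of r] by linarith
    qed
    have r2: "0 < r\<^sup>2 / 2" using r by simp
    have "1 / (r\<^sup>2 - (norm x)\<^sup>2) \<le> 1 / (r\<^sup>2 / 2)" 
      by (rule divide_left_mono[OF x]) (use r2 order.strict_trans2[OF r2 x] in \<open>auto intro!: mult_pos_pos\<close>)
    then have "1 \<le> exp (2 / r\<^sup>2) * exp_recip 0 (r\<^sup>2 - (norm x)\<^sup>2)"
      using r2 order.strict_trans2[OF r2 x] by (simp add: exp_recip_def mult_exp_exp)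
    then show "?a x = 0" by (simp add: exp_recip_def)
  }
  {
    assume "r \<le> norm x"
    then have "r\<^sup>2 \<le> (norm x)\<^sup>2" using r by (intro power_mono) auto
    then show "?a x = 1" by (simp add: exp_recip_def mult_exp_exp)
  }
qed

text \<open>Serves to absorb the factor \<open>(1 + t) ^ N\<close> lost in
  \<open>heat_alg_bound\<close>: up to the constant \<open>2 ^ N\<close> the integrand is dominated
  by two Gamma integrands.\<close>

lemma integrable_Gamma_poly:
  fixes a :: real
  assumes a: "0 < a"
  shows "integrable lborel (\<lambda>t. indicator {0<..} t * (t powr (a - 1) * exp (- t)) * (1 + t) ^ N)"
proof (rule Bochner_Integration.integrable_bound)
  show "integrable lborel (\<lambda>t. 2 ^ N * (indicator {0<..} t * (t powr (a - 1) * exp (- 1 * t)) + indicator {0<..} t * (t powr (a + real N - 1) * exp (- 1 * t))))"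
    using has_bochner_integral_Gamma[of a 1] has_bochner_integral_Gamma[of "a + real N" 1] a
    by (intro integrable_mult_right Bochner_Integration.integrable_add) (simp_all only: has_bochner_integral_iff)
  have "\<bar>indicator {0<..} t * (t powr (a - 1) * exp (- t)) * (1 + t) ^ N\<bar>
      \<le> 2 ^ N * (indicator {0<..} t * (t powr (a - 1) * exp (- 1 * t)) + indicator {0<..} t * (t powr (a + real N - 1) * exp (- 1 * t)))" for t
  proof (cases "0 < t")
    case True
    have "(1 + t) ^ N \<le> (2 * max 1 t) ^ N" using True by (intro power_mono) auto
    also have "\<dots> \<le> 2 ^ N * (1 + t ^ N)" using True by (auto simp: power_mult_distrib max_def)
    finally have "t powr (a - 1) * exp (- t) * (1 + t) ^ N \<le> t powr (a - 1) * exp (- t) * (2 ^ N * (1 + t ^ N))"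
      by (intro mult_left_mono) auto
    moreover have "t powr (a + real N - 1) = t powr (a - 1) * t ^ N"
      using True by (simp add: powr_realpow[symmetric] flip: powr_add) (simp add: algebra_simps)
    ultimately show ?thesis using True by (simp add: algebra_simps)
  qed simp
  then show "AE t in lborel. norm (indicator {0<..} t * (t powr (a - 1) * exp (- t)) * (1 + t) ^ N)
      \<le> norm (2 ^ N * (indicator {0<..} t * (t powr (a - 1) * exp (- 1 * t)) + indicator {0<..} t * (t powr (a + real N - 1) * exp (- 1 * t))))"
    by (intro AE_I2) (simp only: real_norm_def, rule order_trans[OF _ abs_ge_self])
qed simp

text \<open>All differentiation takes place under the time integral: the identity minus the
  Laplacian is applied twice to \<open>a\<close> times the heat kernel at fixed \<open>t\<close>,
  and the superposition of the results is \<open>H\<close>. The Bessel kernel itself is never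
  differentiated.\<close>

theorem bessel_potential_cutoff:
  fixes r s :: real
  assumes s: "0 < s" and r: "0 < r"
  shows "\<exists>\<psi> H :: 'a::euclidean_space \<Rightarrow> real. integrable lborel \<psi> \<and> integrable lborel H \<and> (\<forall>x. r \<le> norm x \<longrightarrow> \<psi> x = 0) \<and>
    (\<forall>\<xi>. fourier \<psi> \<xi> = fourier (bessel_potential s) \<xi> - complex_of_real ((1 + 4 * pi\<^sup>2 * (norm \<xi>)\<^sup>2) powr - 2) * fourier H \<xi>)"
proof -
  let ?L = "\<lambda>\<xi>::'a. 1 + 4 * pi\<^sup>2 * (norm \<xi>)\<^sup>2"
  have Lpos: "0 < ?L \<xi>" for \<xi> by (intro add_pos_nonneg) auto
  define w where "w = (\<lambda>t. indicator {0<..} t * (t powr (s - 1) * exp (- t)) / Gamma s)"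
  have \<Gamma>: "0 < Gamma s" using s by (rule Gamma_real_pos)
  have w0: "0 \<le> w t" "t \<le> 0 \<Longrightarrow> w t = 0" for t using \<Gamma> by (auto simp: w_def)
  have wi: "integrable lborel (\<lambda>t. C * (w t * (1 + t) ^ N))" for C N
    using integrable_Gamma_poly[OF s, of N] by (simp add: w_def)
  have [measurable]: "w \<in> borel_measurable borel" unfolding w_def by measurable
  obtain a :: "'a \<Rightarrow> real" where a: "bump_alg a" "\<And>x. norm x < r / 2 \<Longrightarrow> a x = 0" "\<And>x. r \<le> norm x \<Longrightarrow> a x = 1"
    using cutoff_exists[OF r] by blast
  have \<delta>: "0 < r / 2" using r by simp
  \<comment> \<open>The division by \<open>t ^ 0\<close> brings the function into the syntactic form
    of \<open>heat_alg.base\<close>.\<close>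
  define F0 where "F0 = (\<lambda>t x. a x / t ^ 0 * heat_kernel t x)"
  have F0: "heat_alg (r / 2) F0" unfolding F0_def by (rule heat_alg.base) (use a in auto)
  obtain F1 where F1: "heat_alg (r / 2) F1" "\<And>t \<xi>. 0 < t \<Longrightarrow> fourier (F1 t) \<xi> = complex_of_real (?L \<xi>) * fourier (F0 t) \<xi>"
    using heat_alg_fourier_laplacian[OF F0 \<delta>] by blast
  obtain F2 where F2: "heat_alg (r / 2) F2" "\<And>t \<xi>. 0 < t \<Longrightarrow> fourier (F2 t) \<xi> = complex_of_real (?L \<xi>) * fourier (F1 t) \<xi>"
    using heat_alg_fourier_laplacian[OF F1(1) \<delta>] by blast
  have pair: "integrable (lborel \<Otimes>\<^sub>M lborel) (\<lambda>(t, x). w t * F t x)" if F: "heat_alg (r / 2) F" for F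
  proof -
    obtain C N where C: "0 \<le> C" "\<And>t x. 0 < t \<Longrightarrow> \<bar>F t x\<bar> \<le> C * (1 + t) ^ N * heat_kernel (2 * t) x"
      using heat_alg_bound[OF F \<delta>] by blast
    have [measurable]: "(\<lambda>(t, x). F t x) \<in> borel_measurable (lborel \<Otimes>\<^sub>M lborel)" using F by (rule heat_alg_measurable)
    have m: "(\<lambda>(t, x). w t * F t x) = (\<lambda>z. w (fst z) * (case z of (t, x) \<Rightarrow> F t x))" by auto
    show ?thesis
    proof (rule integrable_heat_dominated[where W = "\<lambda>t. C * (w t * (1 + t) ^ N)" and c = 2])
      show "(\<lambda>(t, x). w t * F t x) \<in> borel_measurable (lborel \<Otimes>\<^sub>M lborel)" unfolding m by measurable
      show "\<bar>w t * F t x\<bar> \<le> C * (w t * (1 + t) ^ N) * heat_kernel (2 * t) x" if "0 < t" for t x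
        using mult_left_mono[OF C(2)[OF that, of x] w0(1)[of t]] w0(1)[of t] by (simp add: abs_mult mult_ac)
    qed (use wi w0 in auto)
  qed
  define h where "h = (\<lambda>x. \<integral>t. w t * F0 t x \<partial>lborel)"
  define H where "H = (\<lambda>x. \<integral>t. w t * F2 t x \<partial>lborel)"
  have hi: "integrable lborel h" unfolding h_def by (rule integrable_superposition[OF pair[OF F0]])
  have Hi: "integrable lborel H" unfolding H_def by (rule integrable_superposition[OF pair[OF F2(1)]])
  have fm: "fourier (\<lambda>x. w t * F t x) \<xi> = complex_of_real (w t) * fourier (F t) \<xi>" if "heat_alg (r / 2) F" for F t \<xi>
    by (rule fourier_cmult) (rule borel_measurable_continuous_onI[OF heat_alg_continuous_on[OF that]])
  have FH: "fourier H \<xi> = complex_of_real ((?L \<xi>)\<^sup>2) * fourier h \<xi>" for \<xi>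
  proof -
    have "fourier H \<xi> = (LBINT t. complex_of_real (w t) * fourier (F2 t) \<xi>)"
      unfolding H_def fourier_superposition[OF pair[OF F2(1)]] by (simp only: fm[OF F2(1)])
    also have "\<dots> = (LBINT t. complex_of_real ((?L \<xi>)\<^sup>2) * (complex_of_real (w t) * fourier (F0 t) \<xi>))"
    proof (intro Bochner_Integration.integral_cong refl)
      \<comment> \<open>The identities for \<open>F1\<close> and \<open>F2\<close> hold for positive
        times only; at the other times \<open>w t\<close> is zero.\<close>
      fix t
      show "complex_of_real (w t) * fourier (F2 t) \<xi> = complex_of_real ((?L \<xi>)\<^sup>2) * (complex_of_real (w t) * fourier (F0 t) \<xi>)"
        by (cases "0 < t") (simp_all only: F1(2) F2(2) power2_eq_square of_real_mult mult_ac not_less w0(2) of_real_0 mult_zero_left mult_zero_right)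
    qed
    also have "\<dots> = complex_of_real ((?L \<xi>)\<^sup>2) * fourier h \<xi>"
      unfolding h_def fourier_superposition[OF pair[OF F0]] by (simp only: fm[OF F0] integral_mult_right_zero)
    finally show ?thesis .
  qed
  have heq: "h x = a x * bessel_potential s x" for x
  proof -
    have "h x = (LBINT t. a x * (w t * heat_kernel t x))"
      unfolding h_def F0_def by (simp add: mult_ac)
    then show ?thesis by (simp add: bessel_potential_def subordinate_def w_def)
  qed
  define \<psi> where "\<psi> = (\<lambda>x. bessel_potential s x - h x)"
  have Gi: "integrable lborel (bessel_potential s :: 'a \<Rightarrow> real)" by (rule integrable_bessel_potential[OF s])
  have "integrable lborel \<psi>" unfolding \<psi>_def using Gi hi by simp
  moreover have "\<forall>x. r \<le> norm x \<longrightarrow> \<psi> x = 0" by (simp add: \<psi>_def heq a)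
  moreover have "fourier \<psi> \<xi> = fourier (bessel_potential s) \<xi> - complex_of_real (?L \<xi> powr - 2) * fourier H \<xi>" for \<xi>
  proof -
    have "?L \<xi> powr - 2 * (?L \<xi>)\<^sup>2 = 1"
      using Lpos[of \<xi>] by (simp add: powr_minus powr_numeral)
    then have "complex_of_real (?L \<xi> powr - 2) * fourier H \<xi> = fourier h \<xi>"
      unfolding FH mult.assoc[symmetric] of_real_mult[symmetric] by simp
    then show ?thesis unfolding \<psi>_def fourier_diff[OF Gi hi] by simp
  qed
  ultimately show ?thesis using Hi by blast
qed

lemma bessel_kernel_bessel_potential:
  assumes "0 < s"
  shows "bessel_kernel s (bessel_potential s :: 'a::euclidean_space \<Rightarrow> real)"
proof -
  have i: "integrable lborel (bessel_potential s :: 'a \<Rightarrow> real)" using assms by (rule integrable_bessel_potential)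
  then have "integrable lebesgue (bessel_potential s :: 'a \<Rightarrow> real)"
    by (subst integrable_completion) auto
  then show ?thesis by (simp add: bessel_kernel_def fourier_bessel_potential[OF assms])
qed

text \<open>Both identities are algebra of symbols. The first becomes one of functions by
  \<open>fourier_unique\<close>, with \<open>h\<close> carrying the factor
  \<open>L powr (s - 2)\<close>. In the second, pulling out \<open>L powr (- s)\<close> is what
  makes the remainder factor through the Bessel kernel.\<close>

theorem parametrix_exists:
  fixes s r :: real
  assumes s: "0 < s" "s < 1" and r: "0 < r"
  shows "\<exists>\<psi> h k :: 'a::euclidean_space \<Rightarrow> real. integrable lborel \<psi> \<and> integrable lborel h \<and> integrable lborel k \<and>
    (\<forall>x. r \<le> norm x \<longrightarrow> \<psi> x = 0) \<and>
    (AE x in lborel. \<psi> x = bessel_potential s x - conv (bessel_potential s) h x) \<and>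
    (\<forall>\<xi>. complex_of_real ((2 * pi * norm \<xi>) powr (2 * s)) * fourier \<psi> \<xi> = 1 - fourier (conv (bessel_potential s) k) \<xi>)"
proof -
  let ?G = "bessel_potential s :: 'a \<Rightarrow> real"
  define L where "L = (\<lambda>\<xi>::'a. 1 + 4 * pi\<^sup>2 * (norm \<xi>)\<^sup>2)"
  have L: "0 < L \<xi>" for \<xi> unfolding L_def by (intro add_pos_nonneg) auto
  obtain \<psi> H :: "'a \<Rightarrow> real" where \<psi>: "integrable lborel \<psi>" "\<And>x. r \<le> norm x \<Longrightarrow> \<psi> x = 0" and H: "integrable lborel H"
    and F\<psi>: "\<And>\<xi>. fourier \<psi> \<xi> = fourier ?G \<xi> - complex_of_real (L \<xi> powr - 2) * fourier H \<xi>"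
    using bessel_potential_cutoff[OF s(1) r, where 'a = 'a] unfolding L_def by blast
  have G: "integrable lborel ?G" by (rule integrable_bessel_potential[OF s(1)])
  have FG: "fourier ?G \<xi> = complex_of_real (L \<xi> powr - s)" for \<xi>
    unfolding L_def by (rule fourier_bessel_potential[OF s(1)])
  define h where "h = conv (bessel_potential (2 - s)) H"
  define h2 where "h2 = conv (bessel_potential (2 - 2 * s)) H"
  define m where "m = (powr_diff_kernel s :: 'a \<Rightarrow> real)"
  \<comment> \<open>With hats for transforms,
    \<open>(L powr s - m^) * (L powr (- s) - L powr (- 2) * H^)\<close> equals 1 minus
    \<open>L powr (- s)\<close> times
    \<open>m^ + L powr (2 * s - 2) * H^ - m^ * L powr (s - 2) * H^\<close>. These three terms are
    the transforms of \<open>m\<close>, \<open>h2\<close> and \<open>conv m h\<close>.\<close>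
  define k where "k = (\<lambda>x. (m x + h2 x) - conv m h x)"
  have B: "0 < 2 - s" "0 < 2 - 2 * s" using s by auto
  have h: "integrable lborel h" and h2: "integrable lborel h2"
    unfolding h_def h2_def by (intro integrable_conv integrable_bessel_potential B H)+
  have m: "integrable lborel m" unfolding m_def by (rule integrable_powr_diff_kernel[OF s])
  have mh: "integrable lborel (conv m h)" by (rule integrable_conv[OF m h])
  have mh2: "integrable lborel (\<lambda>x. m x + h2 x)" using m h2 by simp
  have k: "integrable lborel k" unfolding k_def using mh mh2 by simp
  have Fh: "fourier h \<xi> = complex_of_real (L \<xi> powr (s - 2)) * fourier H \<xi>" for \<xi>
    unfolding h_def fourier_conv[OF integrable_bessel_potential[OF B(1)] H] fourier_bessel_potential[OF B(1)] L_def
    by simp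
  have Fh2: "fourier h2 \<xi> = complex_of_real (L \<xi> powr (2 * s - 2)) * fourier H \<xi>" for \<xi>
    unfolding h2_def fourier_conv[OF integrable_bessel_potential[OF B(2)] H] fourier_bessel_potential[OF B(2)] L_def
    by simp
  have Fm: "fourier m \<xi> = complex_of_real (L \<xi> powr s - (2 * pi * norm \<xi>) powr (2 * s))" for \<xi>
  proof -
    have "(2 * pi * norm \<xi>) powr (2 * s) = (4 * pi\<^sup>2 * (norm \<xi>)\<^sup>2) powr s"
    proof (cases "\<xi> = 0")
      case False
      then have "(2 * pi * norm \<xi>) powr (2 * s) = ((2 * pi * norm \<xi>) powr 2) powr s" by (simp only: powr_powr)
      also have "(2 * pi * norm \<xi>) powr 2 = 4 * pi\<^sup>2 * (norm \<xi>)\<^sup>2"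
        using False by (simp add: powr_numeral power_mult_distrib)
      finally show ?thesis .
    qed simp
    then show ?thesis unfolding m_def L_def by (simp add: fourier_powr_diff_kernel[OF s])
  qed
  have Gh: "integrable lborel (conv ?G h)" by (rule integrable_conv[OF G h])
  have "AE x in lborel. \<psi> x = ?G x - conv ?G h x"
  proof (rule fourier_unique[OF \<psi>(1) Bochner_Integration.integrable_diff[OF G Gh]])
    fix \<xi>
    have "L \<xi> powr - s * L \<xi> powr (s - 2) = L \<xi> powr - 2" by (simp flip: powr_add)
    then have "complex_of_real (L \<xi> powr - 2) = complex_of_real (L \<xi> powr - s) * complex_of_real (L \<xi> powr (s - 2))"
      by (metis of_real_mult)
    then show "fourier \<psi> \<xi> = fourier (\<lambda>x. ?G x - conv ?G h x) \<xi>"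
      unfolding F\<psi> fourier_diff[OF G Gh] fourier_conv[OF G h] Fh FG by (simp only: mult.assoc)
  qed
  moreover have "complex_of_real ((2 * pi * norm \<xi>) powr (2 * s)) * fourier \<psi> \<xi> = 1 - fourier (conv ?G k) \<xi>" for \<xi>
  proof -
    define l where "l = complex_of_real ((2 * pi * norm \<xi>) powr (2 * s))"
    define a where "a = complex_of_real (L \<xi> powr s)"
    define b where "b = complex_of_real (L \<xi> powr - s)"
    have ab: "b * a = 1" using L[of \<xi>] unfolding a_def b_def by (simp flip: powr_add of_real_mult)
    have e1: "complex_of_real (L \<xi> powr (s - 2)) = complex_of_real (L \<xi> powr - 2) * a"
      unfolding a_def by (simp add: add.commute flip: powr_add of_real_mult)
    have e2: "complex_of_real (L \<xi> powr (2 * s - 2)) = complex_of_real (L \<xi> powr - 2) * a * a"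
      unfolding a_def by (simp add: algebra_simps flip: powr_add of_real_mult)
    define X where "X = complex_of_real (L \<xi> powr - 2) * fourier H \<xi>"
    have Fk: "fourier k \<xi> = (a - l) + X * a * a - (a - l) * (X * a)"
      unfolding k_def fourier_diff[OF mh2 mh] fourier_add[OF m h2] fourier_conv[OF m h] Fm Fh Fh2 e1 e2
      by (simp add: a_def l_def X_def algebra_simps)
    have "1 - fourier (conv ?G k) \<xi> = 1 - b * ((a - l) + X * a * a - (a - l) * (X * a))"
      by (simp add: fourier_conv[OF G k] FG Fk b_def)
    also have "\<dots> = 1 - b * a + l * b - l * ((b * a) * X)"
      by (simp add: algebra_simps)
    also have "\<dots> = l * (b - X)" unfolding ab by (simp add: algebra_simps)
    also have "\<dots> = l * fourier \<psi> \<xi>" by (simp add: F\<psi> FG X_def b_def)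
    finally show ?thesis by (simp add: l_def)
  qed
  ultimately show ?thesis using \<psi> h k by blast
qed

section \<open>Local regularity\<close>

lemma fourier_reflect_translate:
  fixes f :: "'a::euclidean_space \<Rightarrow> real"
  assumes [measurable]: "f \<in> borel_measurable borel"
  shows "fourier (\<lambda>x. f (c - x)) \<xi> = char_neg c \<xi> * fourier f (- \<xi>)"
proof -
  have m: "(\<lambda>x. f (c - x)) \<in> borel_measurable borel" by measurable
  have "fourier (\<lambda>x. f (c - x)) \<xi>
      = (LBINT x. char_neg c \<xi> * (complex_of_real (f (c - x)) * char_neg (c - x) (- \<xi>)))"
    unfolding fourier_borel[OF m]
  proof (intro Bochner_Integration.integral_cong refl)
    fix x
    have "char_neg x \<xi>
        = char_neg c \<xi> * char_neg (c - x) (- \<xi>)"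
      unfolding exp_add[symmetric] by (simp add: inner_diff_left algebra_simps)
    then show "complex_of_real (f (c - x)) * char_neg x \<xi>
        = char_neg c \<xi> * (complex_of_real (f (c - x)) * char_neg (c - x) (- \<xi>))"
      by (simp only: mult_ac)
  qed
  also have "\<dots> = char_neg c \<xi> * fourier f (- \<xi>)"
    using integral_lborel_reflect[of "\<lambda>x. complex_of_real (f x) * char_neg x (- \<xi>)" c]
    by (simp only: integral_mult_right_zero fourier_borel[OF assms]) simp
  finally show ?thesis .
qed

text \<open>The symbol is even, so the hypothesis at \<open>- \<xi>\<close> handles the reflected
  kernel. Its constant term 1 returns the mollifier translated to \<open>c\<close>, and both
  inversions are legitimate because the transform of \<open>\<rho>\<close> is integrable.\<close>

lemma frac_lap_conv_mollifier:
  fixes \<psi> K \<rho> :: "'a::euclidean_space \<Rightarrow> real"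
  assumes \<psi>: "integrable lborel \<psi>" and K: "integrable lborel K" and \<rho>: "mollifier \<epsilon> \<rho>"
    and eq: "\<And>\<xi>. complex_of_real ((2 * pi * norm \<xi>) powr (2 * s)) * fourier \<psi> \<xi> = 1 - fourier K \<xi>"
  shows "frac_lap s (conv (\<lambda>y. \<psi> (c - y)) \<rho>) y = \<rho> (y - c) - conv (\<lambda>y. K (c - y)) \<rho> y"
proof -
  have \<rho>i: "integrable lborel \<rho>" and F\<rho>: "integrable lborel (fourier \<rho>)"
    and inv: "(LBINT \<xi>. fourier \<rho> \<xi> * char_pos x \<xi>) = complex_of_real (\<rho> x)" for x
    using \<rho> by (auto simp: mollifier_def)
  have [measurable]: "\<psi> \<in> borel_measurable borel" "K \<in> borel_measurable borel" "\<rho> \<in> borel_measurable borel"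
    using \<psi> K \<rho>i by auto
  let ?\<psi>' = "\<lambda>y. \<psi> (c - y)" and ?K' = "\<lambda>y. K (c - y)"
  have \<psi>': "integrable lborel ?\<psi>'" and K': "integrable lborel ?K'"
    using \<psi> K by (simp_all add: integrable_lborel_reflect)
  let ?e = "\<lambda>x \<xi>. char_pos x \<xi>"
  have F: "complex_of_real ((2 * pi * norm \<xi>) powr (2 * s)) * fourier (conv ?\<psi>' \<rho>) \<xi> * ?e y \<xi>
      = fourier \<rho> \<xi> * ?e (y - c) \<xi> - fourier ?K' \<xi> * fourier \<rho> \<xi> * ?e y \<xi>" for \<xi>
  proof -
    let ?E = "char_neg c \<xi>"
    have e: "?e (y - c) \<xi> = ?E * ?e y \<xi>"
      unfolding exp_add[symmetric] by (simp add: inner_diff_left algebra_simps)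
    have "complex_of_real ((2 * pi * norm \<xi>) powr (2 * s)) * fourier (conv ?\<psi>' \<rho>) \<xi> * ?e y \<xi>
        = ?E * (complex_of_real ((2 * pi * norm (- \<xi>)) powr (2 * s)) * fourier \<psi> (- \<xi>)) * fourier \<rho> \<xi> * ?e y \<xi>"
      by (simp only: fourier_conv[OF \<psi>' \<rho>i] fourier_reflect_translate[OF \<open>\<psi> \<in> borel_measurable borel\<close>] norm_minus_cancel mult_ac)
    also have "\<dots> = ?E * (1 - fourier K (- \<xi>)) * fourier \<rho> \<xi> * ?e y \<xi>"
      by (simp only: eq)
    also have "\<dots> = fourier \<rho> \<xi> * ?e (y - c) \<xi> - fourier ?K' \<xi> * fourier \<rho> \<xi> * ?e y \<xi>"
    proof -
      have "E * (1 - k) * q * z = q * (E * z) - (E * k) * q * z" for E k q z :: complex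
        by (simp add: algebra_simps)
      then show ?thesis unfolding e fourier_reflect_translate[OF \<open>K \<in> borel_measurable borel\<close>] .
    qed
    finally show ?thesis .
  qed
  have i1: "integrable lborel (\<lambda>\<xi>. fourier \<rho> \<xi> * ?e (y - c) \<xi>)"
    by (rule Bochner_Integration.integrable_bound[OF F\<rho>]) (auto simp: norm_mult)
  note i2 = conv_fourier_inversion(1)[OF K' \<rho>, of y]
  have "frac_lap s (conv ?\<psi>' \<rho>) y
      = Re (\<integral>\<xi>. complex_of_real ((2 * pi * norm \<xi>) powr (2 * s)) * fourier (conv ?\<psi>' \<rho>) \<xi> * ?e y \<xi> \<partial>lebesgue)"
    by (simp only: frac_lap_def)
  also have "(\<integral>\<xi>. complex_of_real ((2 * pi * norm \<xi>) powr (2 * s)) * fourier (conv ?\<psi>' \<rho>) \<xi> * ?e y \<xi> \<partial>lebesgue)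
      = (LBINT \<xi>. fourier \<rho> \<xi> * ?e (y - c) \<xi> - fourier ?K' \<xi> * fourier \<rho> \<xi> * ?e y \<xi>)"
    unfolding F by (rule integral_completion) measurable
  also have "\<dots> = complex_of_real (\<rho> (y - c)) - complex_of_real (conv ?K' \<rho> y)"
    by (subst Bochner_Integration.integral_diff[OF i1 i2]) (simp only: inv conv_fourier_inversion(2)[OF K' \<rho>])
  finally show ?thesis by simp
qed

text \<open>Smoothness comes entirely from \<open>\<rho>\<close>, as \<open>\<psi>\<close> is only
  integrable; the support radii \<open>r\<close> and \<open>\<epsilon>\<close> add up.\<close>

lemma test_fun_conv_mollifier:
  fixes \<psi> \<rho> :: "'a::euclidean_space \<Rightarrow> real"
  assumes \<psi>: "integrable lborel \<psi>" "\<And>x. r \<le> norm x \<Longrightarrow> \<psi> x = 0" and \<rho>: "mollifier \<epsilon> \<rho>"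
    and sub: "cball c (r + \<epsilon>) \<subseteq> \<Omega>"
  shows "test_fun \<Omega> (conv (\<lambda>y. \<psi> (c - y)) \<rho>)"
proof -
  have \<rho>i: "integrable lborel \<rho>" and \<rho>s: "smooth_bounded \<rho>" and \<rho>z: "\<And>x. \<epsilon> \<le> norm x \<Longrightarrow> \<rho> x = 0"
    using \<rho> by (auto simp: mollifier_def)
  note [measurable] = \<psi> \<rho>i
  let ?\<phi> = "conv (\<lambda>y. \<psi> (c - y)) \<rho>"
  have \<psi>': "integrable lborel (\<lambda>y. \<psi> (c - y))" using \<psi> by (simp add: integrable_lborel_reflect)
  have z: "?\<phi> y = 0" if "y \<notin> cball c (r + \<epsilon>)" for y
  proof -
    have "\<psi> (c - (y - x)) * \<rho> x = 0" for x
    proof (cases "\<epsilon> \<le> norm x")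
      case False
      have "norm (c - y) \<le> norm (c - (y - x)) + norm x"
        using norm_triangle_ineq4[of "c - (y - x)" x] by simp
      then have "r \<le> norm (c - (y - x))" using that False by (simp add: dist_norm)
      then show ?thesis by (simp add: \<psi>(2))
    qed (simp add: \<rho>z)
    then have "(\<lambda>x. \<psi> (c - (y - x)) * \<rho> x) = (\<lambda>_. 0)" by (intro ext)
    then show ?thesis by (simp add: conv_borel del: mult_eq_0_iff)
  qed
  have "{x. ?\<phi> x \<noteq> 0} \<subseteq> cball c (r + \<epsilon>)" using z by blast
  then have ts: "tsupport ?\<phi> \<subseteq> cball c (r + \<epsilon>)"
    unfolding tsupport_def by (rule closure_minimal) simp
  then have "compact (tsupport ?\<phi>)"
    using bounded_subset[OF bounded_cball ts] by (simp add: compact_eq_bounded_closed tsupport_def)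
  moreover have "smooth_fun ?\<phi>"
    using smooth_bounded_conv[OF \<psi>' \<rho>s] by (simp add: smooth_bounded_def)
  ultimately show ?thesis using ts sub by (auto simp: test_fun_def)
qed

text \<open>Fubini's theorem transfers the kernel from the mollifier to \<open>v\<close>. For
  absolute convergence, the convolution \<open>V\<close> of the absolute values is in
  \<open>L^p\<close> by Young's inequality, hence locally integrable, and the mollifier is bounded
  with bounded support.\<close>

lemma
  fixes K v \<rho> :: "'a::euclidean_space \<Rightarrow> real"
  assumes p: "1 < p" and K: "integrable lborel K" and v: "Lp_mem p lborel v" and \<rho>: "mollifier \<epsilon> \<rho>"
  shows integrable_mult_conv_mollifier: "integrable lborel (\<lambda>y. v y * conv (\<lambda>y. K (c - y)) \<rho> y)"
    and integrable_mollifier_mult_conv: "integrable lborel (\<lambda>z. \<rho> (z - c) * conv K v z)"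
    and integral_mult_conv_mollifier: "(LBINT y. v y * conv (\<lambda>y. K (c - y)) \<rho> y) = (LBINT z. \<rho> (z - c) * conv K v z)"
proof -
  have \<rho>i: "integrable lborel \<rho>" and \<rho>s: "smooth_bounded \<rho>" and \<rho>z: "\<And>x. \<epsilon> \<le> norm x \<Longrightarrow> \<rho> x = 0"
    using \<rho> by (auto simp: mollifier_def)
  have [measurable]: "K \<in> borel_measurable borel" "\<rho> \<in> borel_measurable borel" "v \<in> borel_measurable borel"
    using K \<rho>i Lp_memD[OF v] by auto
  obtain B where B: "\<And>x. \<bar>\<rho> x\<bar> \<le> B" by (rule smooth_bounded_bound[OF \<rho>s]) blast
  have K': "integrable lborel (\<lambda>x. \<bar>K x\<bar>)" and v': "Lp_mem p lborel (\<lambda>x. \<bar>v x\<bar>)"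
    using K v by (auto intro: Lp_mem_abs)
  define V where "V = conv (\<lambda>x. \<bar>K x\<bar>) (\<lambda>x. \<bar>v x\<bar>)"
  have V: "Lp_mem p lborel V" unfolding V_def by (rule Lp_mem_conv[OF p K' v'])
  have "integrable lborel (\<lambda>z. (indicator (cball c \<epsilon>) z * V z) * \<bar>\<rho> (z - c)\<bar>)"
    by (rule integrable_mult_bounded[OF integrable_on_bounded_Lp[OF p V], of _ B]) (use B in auto)
  moreover have "(indicator (cball c \<epsilon>) z * V z) * \<bar>\<rho> (z - c)\<bar> = \<bar>\<rho> (z - c)\<bar> * V z" for z
    using \<rho>z[of "z - c"] by (auto simp: indicator_def dist_norm norm_minus_commute)
  ultimately have iV: "integrable lborel (\<lambda>z. \<bar>\<rho> (z - c)\<bar> * V z)" by simp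
  have P: "integrable (lborel \<Otimes>\<^sub>M lborel) (\<lambda>(z, y). \<rho> (z - c) * (K (z - y) * v y))"
  proof (rule lborel_pair.Fubini_integrable)
    have "(\<lambda>z. \<integral>y. norm (case (z, y) of (z, y) \<Rightarrow> \<rho> (z - c) * (K (z - y) * v y)) \<partial>lborel) = (\<lambda>z. \<bar>\<rho> (z - c)\<bar> * V z)"
      by (intro ext) (simp add: abs_mult V_def conv_borel)
    then show "integrable lborel (\<lambda>z. \<integral>y. norm (case (z, y) of (z, y) \<Rightarrow> \<rho> (z - c) * (K (z - y) * v y)) \<partial>lborel)"
      using iV by simp
    show "AE z in lborel. integrable lborel (\<lambda>y. case (z, y) of (z, y) \<Rightarrow> \<rho> (z - c) * (K (z - y) * v y))"
      using AE_integrable_conv_Lp[OF p K v] by eventually_elim simp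
  qed measurable
  have eq1: "(LBINT y. \<rho> (z - c) * (K (z - y) * v y)) = \<rho> (z - c) * conv K v z" for z
    by (simp only: integral_mult_right_zero) (simp add: conv_borel)
  have eq2: "(LBINT z. \<rho> (z - c) * (K (z - y) * v y)) = v y * conv (\<lambda>y. K (c - y)) \<rho> y" for y
  proof -
    have "(LBINT z. \<rho> (z - c) * (K (z - y) * v y)) = (LBINT z. v y * (K (z - y) * \<rho> (z - c)))"
      by (simp only: mult_ac)
    also have "\<dots> = v y * (LBINT z. K (z - y) * \<rho> (z - c))"
      by (rule integral_mult_right_zero)
    also have "(LBINT z. K (z - y) * \<rho> (z - c)) = conv (\<lambda>y. K (c - y)) \<rho> y"
      using integral_lborel_translate[of "\<lambda>z. K (z - y) * \<rho> (z - c)" c]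
      by (simp add: conv_borel algebra_simps)
    finally show ?thesis .
  qed
  show "integrable lborel (\<lambda>z. \<rho> (z - c) * conv K v z)"
    using lborel_pair.integrable_fst[OF P] by (simp only: eq1)
  show "integrable lborel (\<lambda>y. v y * conv (\<lambda>y. K (c - y)) \<rho> y)"
    using lborel_pair.integrable_snd[OF P] by (simp only: eq2)
  show "(LBINT y. v y * conv (\<lambda>y. K (c - y)) \<rho> y) = (LBINT z. \<rho> (z - c) * conv K v z)"
    using lborel_pair.Fubini_integral[OF P] by (simp only: eq1 eq2)
qed

lemma integrable_mollifier_mult_Lp:
  fixes v \<rho> :: "'a::euclidean_space \<Rightarrow> real"
  assumes p: "1 < p" and v: "Lp_mem p lborel v" and \<rho>: "mollifier \<epsilon> \<rho>"
  shows "integrable lborel (\<lambda>z. \<rho> (z - c) * v z)"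
proof -
  have \<rho>i: "integrable lborel \<rho>" and \<rho>s: "smooth_bounded \<rho>" and \<rho>z: "\<And>x. \<epsilon> \<le> norm x \<Longrightarrow> \<rho> x = 0"
    using \<rho> by (auto simp: mollifier_def)
  note [measurable] = \<rho>i
  obtain B where B: "\<And>x. \<bar>\<rho> x\<bar> \<le> B" by (rule smooth_bounded_bound[OF \<rho>s]) blast
  have "integrable lborel (\<lambda>z. (indicator (cball c \<epsilon>) z * v z) * \<rho> (z - c))"
    by (rule integrable_mult_bounded[OF integrable_on_bounded_Lp[OF p v], of _ B]) (use B in auto)
  moreover have "(indicator (cball c \<epsilon>) z * v z) * \<rho> (z - c) = \<rho> (z - c) * v z" for z
    using \<rho>z[of "z - c"] by (auto simp: indicator_def dist_norm norm_minus_commute)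
  ultimately show ?thesis by simp
qed

text \<open>Testing with the reflected, translated and mollified kernel says that all small averages
  of the defect \<open>w\<close> around points of \<open>U\<close> vanish, and the fundamental lemma
  applies. The measurability premises in \<open>sol\<close> let the equation be transferred from
  \<open>lebesgue\<close> to Borel representatives.\<close>

lemma AE_representation:
  fixes \<psi> K u f :: "'a::euclidean_space \<Rightarrow> real"
  assumes p: "1 < p" and \<psi>: "integrable lborel \<psi>" "\<And>x. r \<le> norm x \<Longrightarrow> \<psi> x = 0" and K: "integrable lborel K"
    and eq: "\<And>\<xi>. complex_of_real ((2 * pi * norm \<xi>) powr (2 * s)) * fourier \<psi> \<xi> = 1 - fourier K \<xi>"
    and u: "Lp_mem p lborel u" and f: "Lp_mem p lborel f"
    and sol: "\<And>\<phi>. test_fun \<Omega> \<phi> \<Longrightarrow> \<phi> \<in> borel_measurable borel \<Longrightarrow> frac_lap s \<phi> \<in> borel_measurable borel \<Longrightarrow>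
      (LBINT x. u x * frac_lap s \<phi> x) = (LBINT x. f x * \<phi> x)"
    and U: "open U" "0 < e0" "\<And>c. c \<in> U \<Longrightarrow> cball c (r + e0) \<subseteq> \<Omega>"
  shows "AE x in lborel. x \<in> U \<longrightarrow> u x = conv K u x + conv \<psi> f x"
proof -
  have [measurable]: "\<psi> \<in> borel_measurable borel" "K \<in> borel_measurable borel" "u \<in> borel_measurable borel" "f \<in> borel_measurable borel"
    using \<psi> K Lp_memD[OF u] Lp_memD[OF f] by auto
  define w where "w = (\<lambda>x. u x + - 1 * (conv K u x + conv \<psi> f x))"
  have wL: "Lp_mem p lborel w"
    unfolding w_def using p by (intro Lp_mem_add Lp_mem_cmult Lp_mem_conv u f \<psi>(1) K) auto
  have "AE x in lborel. x \<in> U \<longrightarrow> w x = 0"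
  proof (rule AE_zero_if_averages_zero[OF _ integrable_on_bounded_Lp[OF p wL] U(1,2)])
    show "w \<in> borel_measurable borel" unfolding w_def by measurable
    fix c \<epsilon> and \<rho> :: "'a \<Rightarrow> real"
    assume c: "c \<in> U" and \<epsilon>: "0 < \<epsilon>" "\<epsilon> < e0" and \<rho>: "mollifier \<epsilon> \<rho>"
    have [measurable]: "\<rho> \<in> borel_measurable borel" using \<rho> by (auto simp: mollifier_def)
    let ?\<phi> = "conv (\<lambda>y. \<psi> (c - y)) \<rho>"
    have "cball c (r + \<epsilon>) \<subseteq> cball c (r + e0)" using \<epsilon> by (intro cball_subset_cball_iff[THEN iffD2]) auto
    then have "test_fun \<Omega> ?\<phi>" using U(3)[OF c] by (intro test_fun_conv_mollifier[OF \<psi> \<rho>]) auto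
    moreover have fl: "frac_lap s ?\<phi> = (\<lambda>y. \<rho> (y - c) - conv (\<lambda>y. K (c - y)) \<rho> y)"
      by (intro ext frac_lap_conv_mollifier[OF \<psi>(1) K \<rho> eq])
    moreover have "frac_lap s ?\<phi> \<in> borel_measurable borel" unfolding fl by measurable
    ultimately have "(LBINT x. u x * (\<rho> (x - c) - conv (\<lambda>y. K (c - y)) \<rho> x)) = (LBINT x. f x * ?\<phi> x)"
      using sol[of ?\<phi>] by simp
    also have "(LBINT x. f x * ?\<phi> x) = (LBINT z. \<rho> (z - c) * conv \<psi> f z)"
      by (rule integral_mult_conv_mollifier[OF p \<psi>(1) f \<rho>])
    also have "(LBINT x. u x * (\<rho> (x - c) - conv (\<lambda>y. K (c - y)) \<rho> x))
        = (LBINT x. \<rho> (x - c) * u x - u x * conv (\<lambda>y. K (c - y)) \<rho> x)"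
      by (simp only: right_diff_distrib mult.commute)
    also have "\<dots> = (LBINT x. \<rho> (x - c) * u x) - (LBINT x. u x * conv (\<lambda>y. K (c - y)) \<rho> x)"
      by (rule Bochner_Integration.integral_diff[OF integrable_mollifier_mult_Lp[OF p u \<rho>] integrable_mult_conv_mollifier[OF p K u \<rho>]])
    also have "(LBINT x. u x * conv (\<lambda>y. K (c - y)) \<rho> x) = (LBINT z. \<rho> (z - c) * conv K u z)"
      by (rule integral_mult_conv_mollifier[OF p K u \<rho>])
    finally have *: "(LBINT x. \<rho> (x - c) * u x) - (LBINT z. \<rho> (z - c) * conv K u z) = (LBINT z. \<rho> (z - c) * conv \<psi> f z)" .
    have "(LBINT y. \<rho> (y - c) * w y) = (LBINT y. \<rho> (y - c) * u y - \<rho> (y - c) * conv K u y - \<rho> (y - c) * conv \<psi> f y)"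
      unfolding w_def by (simp only: algebra_simps mult_minus1 mult_minus1_right) (simp add: algebra_simps)
    also have "\<dots> = (LBINT x. \<rho> (x - c) * u x) - (LBINT z. \<rho> (z - c) * conv K u z) - (LBINT z. \<rho> (z - c) * conv \<psi> f z)"
    proof -
      note i = integrable_mollifier_mult_Lp[OF p u \<rho>, of c] integrable_mollifier_mult_conv[OF p K u \<rho>, of c]
        integrable_mollifier_mult_conv[OF p \<psi>(1) f \<rho>, of c]
      show ?thesis
        by (subst Bochner_Integration.integral_diff[OF Bochner_Integration.integrable_diff[OF i(1,2)] i(3)],
            subst Bochner_Integration.integral_diff[OF i(1,2)]) (rule refl)
    qed
    finally show "(LBINT y. \<rho> (y - c) * w y) = 0" using * by simp
  qed
  then show ?thesis by eventually_elim (auto simp: w_def)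
qed

text \<open>The hypotheses of the theorem live on the completed measure, whereas Fubini's theorem is
  used on products of \<open>lborel\<close>. A Borel representative bridges the two.\<close>

lemma Lp_mem_lebesgue_borel:
  fixes v :: "'a::euclidean_space \<Rightarrow> real"
  assumes v: "Lp_mem p lebesgue v"
  obtains v' where "Lp_mem p lborel v'" "AE x in lebesgue. v x = v' x" "Lp_norm p lborel v' = Lp_norm p lebesgue v"
proof -
  have vm: "v \<in> borel_measurable lebesgue" and vi: "integrable lebesgue (\<lambda>x. \<bar>v x\<bar> powr p)"
    using v by (auto simp: Lp_mem_def)
  obtain v' where v'[measurable]: "v' \<in> borel_measurable lborel" and "AE x in lborel. v x = v' x"
    using completion_ex_borel_measurable_real[OF vm] by blast
  then have ae: "AE x in lebesgue. v x = v' x" by (intro AE_completion)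
  then have ae': "AE x in lebesgue. \<bar>v x\<bar> powr p = \<bar>v' x\<bar> powr p" by eventually_elim simp
  have m': "(\<lambda>x. \<bar>v' x\<bar> powr p) \<in> borel_measurable lebesgue" by (rule measurable_completion) measurable
  have "integrable lebesgue (\<lambda>x. \<bar>v' x\<bar> powr p)"
    using vi ae' m' by (subst integrable_cong_AE[OF _ _ ae', symmetric]) (auto intro: borel_measurable_integrable)
  then have "integrable lborel (\<lambda>x. \<bar>v' x\<bar> powr p)" by (subst (asm) integrable_completion) measurable
  moreover have "(LBINT x. \<bar>v' x\<bar> powr p) = (\<integral>x. \<bar>v x\<bar> powr p \<partial>lebesgue)"
  proof -
    have "(LBINT x. \<bar>v' x\<bar> powr p) = (\<integral>x. \<bar>v' x\<bar> powr p \<partial>lebesgue)"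
      by (rule integral_completion[symmetric]) measurable
    also have "\<dots> = (\<integral>x. \<bar>v x\<bar> powr p \<partial>lebesgue)"
      by (rule integral_cong_AE[OF m' borel_measurable_integrable[OF vi]]) (use ae' in auto)
    finally show ?thesis .
  qed
  ultimately show ?thesis using that[of v'] v' ae by (simp add: Lp_mem_def Lp_norm_def)
qed

text \<open>Convolution needs data on the whole space, and extension by zero costs nothing in
  norm.\<close>

lemma
  assumes \<Omega>: "\<Omega> \<in> sets M"
  shows Lp_mem_restrict_space: "Lp_mem p (restrict_space M \<Omega>) f \<Longrightarrow> Lp_mem p M (\<lambda>x. indicator \<Omega> x * f x)"
    and Lp_norm_restrict_space: "Lp_norm p (restrict_space M \<Omega>) f = Lp_norm p M (\<lambda>x. indicator \<Omega> x * f x)"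
proof -
  have \<Omega>': "\<Omega> \<inter> space M \<in> sets M" using \<Omega> by auto
  have eq: "(\<lambda>x. \<bar>indicator \<Omega> x * f x\<bar> powr p) = (\<lambda>x. indicator \<Omega> x *\<^sub>R \<bar>f x\<bar> powr p)"
    by (auto simp: indicator_def)
  show "Lp_norm p (restrict_space M \<Omega>) f = Lp_norm p M (\<lambda>x. indicator \<Omega> x * f x)"
    unfolding Lp_norm_def eq integral_restrict_space[OF \<Omega>'] ..
  show "Lp_mem p M (\<lambda>x. indicator \<Omega> x * f x)" if "Lp_mem p (restrict_space M \<Omega>) f"
    using that unfolding Lp_mem_def eq
    by (simp add: borel_measurable_restrict_space_iff[OF \<Omega>'] integrable_restrict_space[OF \<Omega>'] mult.commute)
qed

theorem theorem5p2:
  fixes \<Omega> \<Omega>' :: "'a::euclidean_space set" and s p :: real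
  assumes "open \<Omega>" and "bounded \<Omega>"
    and "compact (closure \<Omega>')" and "closure \<Omega>' \<subseteq> \<Omega>"
    and "0 < s" and "s < 1" and "1 < p"
  shows "\<exists>C>0. \<forall>f u :: 'a \<Rightarrow> real.
           Lp_mem p (restrict_space lebesgue \<Omega>) f \<longrightarrow> Lp_mem p lebesgue u \<longrightarrow>
           dist_solution s \<Omega> u f \<longrightarrow>
           in_bessel_space s p \<Omega>' u \<and>
           bessel_norm s p \<Omega>' u \<le>
             C * (Lp_norm p (restrict_space lebesgue \<Omega>) f + Lp_norm p lebesgue u)"
proof -
  note s = \<open>0 < s\<close> \<open>s < 1\<close> and p = \<open>1 < p\<close>
  obtain e where e: "0 < e" "(\<Union>x\<in>closure \<Omega>'. ball x e) \<subseteq> \<Omega>"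
    using compact_subset_open_imp_ball_epsilon_subset[OF assms(3,1,4)] by blast
  \<comment> \<open>Points of \<open>U\<close> are within \<open>r\<close> of \<Omega>', the kernel
    has radius \<open>r\<close> and the mollifiers have radius below \<open>r\<close>; the total
    \<open>3 * r\<close> stays below \<open>e\<close>.\<close>
  define r where "r = e / 4"
  have r: "0 < r" using e by (simp add: r_def)
  define U where "U = (\<Union>x\<in>\<Omega>'. ball x r)"
  have U: "open U" "\<Omega>' \<subseteq> U" using r by (auto simp: U_def)
  have cU: "cball c (r + r) \<subseteq> \<Omega>" if "c \<in> U" for c
  proof
    fix y assume y: "y \<in> cball c (r + r)"
    from that obtain x where "x \<in> \<Omega>'" "c \<in> ball x r" unfolding U_def by blast
    then have x: "x \<in> \<Omega>'" "dist x c < r" by auto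
    have "dist x y < e" using dist_triangle[of x y c] x(2) y r by (simp add: r_def)
    then have "y \<in> ball x e" by simp
    then show "y \<in> \<Omega>" using e(2) x(1) closure_subset[of \<Omega>'] by blast
  qed
  let ?G = "bessel_potential s :: 'a \<Rightarrow> real"
  obtain \<psi> h k :: "'a \<Rightarrow> real" where \<psi>: "integrable lborel \<psi>" "\<And>x. r \<le> norm x \<Longrightarrow> \<psi> x = 0"
    and h: "integrable lborel h" and k: "integrable lborel k"
    and \<psi>eq: "AE x in lborel. \<psi> x = ?G x - conv ?G h x"
    and F: "\<And>\<xi>. complex_of_real ((2 * pi * norm \<xi>) powr (2 * s)) * fourier \<psi> \<xi> = 1 - fourier (conv ?G k) \<xi>"
    using parametrix_exists[OF s r, where 'a = 'a] by blast
  have G: "integrable lborel ?G" by (rule integrable_bessel_potential[OF s(1)])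
  note [measurable] = \<psi> h k G
  define A where "A = (LBINT x. \<bar>k x\<bar>)"
  define B where "B = (LBINT x. \<bar>h x\<bar>)"
  have A: "0 \<le> A" and B: "0 \<le> B" by (simp_all add: A_def B_def)
  \<comment> \<open>The quasi-triangle inequality is used once for the term with \<open>u\<close>
    and twice for those with \<open>f\<close>, whence 4 and 16. The sum dominates both coefficients,
    and \<open>h\<close> and \<open>k\<close> were fixed before \<open>f\<close> and
    \<open>u\<close>.\<close>
  define C where "C = 4 * A + 16 * (1 + B)"
  have C: "0 < C" using A B by (simp add: C_def)
  have "in_bessel_space s p \<Omega>' u \<and> bessel_norm s p \<Omega>' u \<le> C * (Lp_norm p (restrict_space lebesgue \<Omega>) f + Lp_norm p lebesgue u)"
    if f: "Lp_mem p (restrict_space lebesgue \<Omega>) f" and u: "Lp_mem p lebesgue u" and sol: "dist_solution s \<Omega> u f" for f u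
  proof -
    have \<Omega>m: "\<Omega> \<in> sets lebesgue" using assms(1) by simp
    obtain u' where u': "Lp_mem p lborel u'" "AE x in lebesgue. u x = u' x" "Lp_norm p lborel u' = Lp_norm p lebesgue u"
      using Lp_mem_lebesgue_borel[OF u] by blast
    obtain f' where f': "Lp_mem p lborel f'" "AE x in lebesgue. indicator \<Omega> x * f x = f' x"
      "Lp_norm p lborel f' = Lp_norm p (restrict_space lebesgue \<Omega>) f"
      unfolding Lp_norm_restrict_space[OF \<Omega>m]
      using Lp_mem_lebesgue_borel[OF Lp_mem_restrict_space[OF \<Omega>m f]] by blast
    have fm: "(\<lambda>x. indicator \<Omega> x * f x) \<in> borel_measurable lebesgue" and um: "u \<in> borel_measurable lebesgue"
      using Lp_memD[OF Lp_mem_restrict_space[OF \<Omega>m f]] Lp_memD[OF u] by auto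
    have [measurable]: "u' \<in> borel_measurable borel" "f' \<in> borel_measurable borel"
      using Lp_memD[OF u'(1)] Lp_memD[OF f'(1)] by auto
    have sol': "(LBINT x. u' x * frac_lap s \<phi> x) = (LBINT x. f' x * \<phi> x)"
      if t: "test_fun \<Omega> \<phi>" and [measurable]: "\<phi> \<in> borel_measurable borel" "frac_lap s \<phi> \<in> borel_measurable borel" for \<phi>
    proof -
      have mc: "g \<in> borel_measurable lebesgue" if "g \<in> borel_measurable borel" for g :: "'a \<Rightarrow> real"
        using that by (intro measurable_completion) simp
      have "(LBINT x. u' x * frac_lap s \<phi> x) = (\<integral>x. u' x * frac_lap s \<phi> x \<partial>lebesgue)"
        by (rule integral_completion[symmetric]) measurable
      also have "\<dots> = (\<integral>x. u x * frac_lap s \<phi> x \<partial>lebesgue)"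
      proof (rule integral_cong_AE)
        show "(\<lambda>x. u' x * frac_lap s \<phi> x) \<in> borel_measurable lebesgue" by (rule mc) measurable
        show "(\<lambda>x. u x * frac_lap s \<phi> x) \<in> borel_measurable lebesgue"
          by (rule borel_measurable_times[OF um mc]) measurable
        show "AE x in lebesgue. u' x * frac_lap s \<phi> x = u x * frac_lap s \<phi> x"
          using u'(2) by eventually_elim simp
      qed
      also have "\<dots> = (LINT x:\<Omega>|lebesgue. f x * \<phi> x)" using sol t by (simp add: dist_solution_def)
      also have "\<dots> = (\<integral>x. (indicator \<Omega> x * f x) * \<phi> x \<partial>lebesgue)"
        by (simp add: set_lebesgue_integral_def mult.assoc)
      also have "\<dots> = (\<integral>x. f' x * \<phi> x \<partial>lebesgue)"
      proof (rule integral_cong_AE)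
        show "(\<lambda>x. f' x * \<phi> x) \<in> borel_measurable lebesgue" by (rule mc) measurable
        show "(\<lambda>x. (indicator \<Omega> x * f x) * \<phi> x) \<in> borel_measurable lebesgue"
          by (rule borel_measurable_times[OF fm mc]) measurable
        show "AE x in lebesgue. (indicator \<Omega> x * f x) * \<phi> x = f' x * \<phi> x"
          using f'(2) by eventually_elim simp
      qed
      also have "\<dots> = (LBINT x. f' x * \<phi> x)" by (rule integral_completion) measurable
      finally show ?thesis .
    qed
    have rep: "AE x in lborel. x \<in> U \<longrightarrow> u' x = conv (conv ?G k) u' x + conv \<psi> f' x"
      by (rule AE_representation[OF p \<psi> integrable_conv[OF G k] F u'(1) f'(1) sol' U(1) r cU])
    \<comment> \<open>Since \<open>\<psi>\<close> is \<open>?G\<close> minus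
      \<open>conv ?G h\<close> almost everywhere, convolving this \<open>g\<close> with
      \<open>?G\<close> reproduces the right-hand side of \<open>rep\<close>. Differences are
      written with \<open>- 1 *\<close> to match the lemmas on sums and scalar multiples.\<close>
    define g where "g = (\<lambda>x. conv k u' x + (f' x + - 1 * conv h f' x))"
    have ku: "Lp_mem p lborel (conv k u')" and hf: "Lp_mem p lborel (conv h f')"
      by (rule Lp_mem_conv[OF p k u'(1)], rule Lp_mem_conv[OF p h f'(1)])
    have hf': "Lp_mem p lborel (\<lambda>x. - 1 * conv h f' x)" by (rule Lp_mem_cmult[OF hf])
    have fhf: "Lp_mem p lborel (\<lambda>x. f' x + - 1 * conv h f' x)"
      using p by (intro Lp_mem_add f'(1) hf') simp
    have g: "Lp_mem p lborel g" unfolding g_def using p by (intro Lp_mem_add ku fhf) simp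
    have [measurable]: "g \<in> borel_measurable borel" using Lp_memD[OF g] by simp
    \<comment> \<open>Convolution is linear and associative only where the integrals involved
      converge, so six almost everywhere statements are combined.\<close>
    have Gg: "AE x in lborel. conv ?G g x = conv (conv ?G k) u' x + conv \<psi> f' x"
      using AE_conv_assoc[OF p G k u'(1)] AE_conv_assoc[OF p G h f'(1)]
        AE_integrable_conv_Lp[OF p G ku] AE_integrable_conv_Lp[OF p G f'(1)] AE_integrable_conv_Lp[OF p G hf]
        AE_integrable_conv_Lp[OF p integrable_conv[OF G h] f'(1)]
    proof eventually_elim
      case (elim x)
      have "conv ?G g x = (LBINT y. (?G (x - y) * conv k u' y + ?G (x - y) * f' y) - ?G (x - y) * conv h f' y)"
        unfolding g_def by (subst conv_borel) (auto simp: algebra_simps)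
      also have "\<dots> = conv ?G (conv k u') x + conv ?G f' x - conv ?G (conv h f') x"
        by (subst Bochner_Integration.integral_diff[OF Bochner_Integration.integrable_add[OF elim(3,4)] elim(5)],
            subst Bochner_Integration.integral_add[OF elim(3,4)]) (simp add: conv_borel)
      finally have 1: "conv ?G g x = conv ?G (conv k u') x + conv ?G f' x - conv ?G (conv h f') x" .
      have "conv ?G f' x - conv (conv ?G h) f' x = (LBINT y. ?G (x - y) * f' y - conv ?G h (x - y) * f' y)"
        by (subst Bochner_Integration.integral_diff[OF elim(4,6)]) (simp add: conv_borel)
      also have "\<dots> = conv (\<lambda>x. ?G x - conv ?G h x) f' x"
        by (subst conv_borel) (simp_all add: left_diff_distrib)
      also have "\<dots> = conv \<psi> f' x"
        by (rule conv_cong_AE[symmetric]) (use \<psi>eq in measurable)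
      finally show ?case using elim(1,2) 1 by simp
    qed
    have Lg: "Lp_mem p lebesgue v" "Lp_norm p lebesgue v = Lp_norm p lborel v" if "Lp_mem p lborel v" for v :: "'a \<Rightarrow> real"
    proof -
      have [measurable]: "v \<in> borel_measurable borel" using Lp_memD[OF that] by simp
      show "Lp_mem p lebesgue v" using that
        by (simp add: Lp_mem_def integrable_completion measurable_completion)
      show "Lp_norm p lebesgue v = Lp_norm p lborel v"
        by (simp add: Lp_norm_def integral_completion)
    qed
    have mem: "Lp_norm p lborel g \<in> bessel_reps s p \<Omega>' u"
    proof -
      have "AE x in lebesgue. x \<in> U \<longrightarrow> u' x = conv (conv ?G k) u' x + conv \<psi> f' x"
        "AE x in lebesgue. conv ?G g x = conv (conv ?G k) u' x + conv \<psi> f' x"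
        by (rule AE_completion[OF rep], rule AE_completion[OF Gg])
      then have ae: "AE x in lebesgue. x \<in> \<Omega>' \<longrightarrow> conv ?G g x = u x"
        using u'(2)
      proof eventually_elim
        case (elim x)
        then show ?case using U(2) by auto
      qed
      show ?thesis
        unfolding bessel_reps_def mem_Collect_eq
        by (rule exI[of _ g], rule exI[of _ ?G], rule exI[of _ "conv ?G g"],
            intro conjI Lg(1) g ae Lp_mem_conv[OF p G g] bessel_kernel_bessel_potential[OF s(1)] Lg(2)[OF g, symmetric])
          simp
    qed
    have "Lp_norm p lborel g \<le> 4 * (Lp_norm p lborel (conv k u') + Lp_norm p lborel (\<lambda>x. f' x + - 1 * conv h f' x))"
      unfolding g_def using p by (intro Lp_norm_add_le ku fhf) simp
    moreover have "Lp_norm p lborel (\<lambda>x. f' x + - 1 * conv h f' x) \<le> 4 * (Lp_norm p lborel f' + Lp_norm p lborel (\<lambda>x. - 1 * conv h f' x))"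
      using p by (intro Lp_norm_add_le f'(1) hf') simp
    moreover have "Lp_norm p lborel (\<lambda>x. - 1 * conv h f' x) = Lp_norm p lborel (conv h f')"
      by (simp add: Lp_norm_def)
    moreover have "Lp_norm p lborel (conv h f') \<le> B * Lp_norm p lborel f'"
      unfolding B_def by (rule Lp_norm_conv_le[OF p h f'(1)])
    moreover have "Lp_norm p lborel (conv k u') \<le> A * Lp_norm p lborel u'"
      unfolding A_def by (rule Lp_norm_conv_le[OF p k u'(1)])
    ultimately have "Lp_norm p lborel g \<le> 4 * (A * Lp_norm p lborel u') + 16 * ((1 + B) * Lp_norm p lborel f')"
      by (simp add: algebra_simps)
    also have "\<dots> \<le> C * Lp_norm p lborel u' + C * Lp_norm p lborel f'"
    proof -
      have "4 * A * Lp_norm p lborel u' \<le> C * Lp_norm p lborel u'" "16 * (1 + B) * Lp_norm p lborel f' \<le> C * Lp_norm p lborel f'"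
        using A B by (auto intro!: mult_right_mono simp: C_def)
      then show ?thesis by (simp only: mult.assoc add_mono)
    qed
    finally have "Lp_norm p lborel g \<le> C * (Lp_norm p (restrict_space lebesgue \<Omega>) f + Lp_norm p lebesgue u)"
      using u'(3) f'(3) by (simp add: algebra_simps)
    \<comment> \<open>The set of representing norms is bounded below by 0, so its infimum is at most
      the member just found.\<close>
    moreover have "bessel_norm s p \<Omega>' u \<le> Lp_norm p lborel g"
      unfolding bessel_norm_def by (rule cInf_lower[OF mem]) (auto intro!: bdd_belowI[of _ 0] simp: bessel_reps_def)
    moreover have "in_bessel_space s p \<Omega>' u" using mem by (auto simp: in_bessel_space_def)
    ultimately show ?thesis by simp
  qed
  then show ?thesis using C by blast
qed

end
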